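(* Let $C$ be a commutative unital ring in which $2$ is invertible. Let $A$ be a $C$-algebra. Then $\operatorname{id}(A\otimes_C S)=\operatorname{id}(A\otimes_C\mathfrak{G})$, where $S$ is the free supercommutative algebra over $C$ and $\mathfrak{G}$ is the generalized Grassmann algebra over $C$. In particular, $\operatorname{id}(\operatorname{M}_n(S))=\operatorname{id}(\operatorname{M}_n(\mathfrak{G}))$ for every $n$.
   Context: Algebras are associative, not necessarily unital; $[a,b]=ab-ba$. $C\langle X\rangle$ is the free associative $C$-algebra on a countably infinite alphabet $X$. For a $C$-algebra $B$, $\operatorname{id}(B)\subseteq C\langle X\rangle$ is the set of all $f(x_1,\dots,x_n)\in C\langle X\rangle$ such that $f(b_1,\dots,b_n)=0$ for all $b_1,\dots,b_n\in B$. $\operatorname{M}_n(R)$ is the algebra of $n\times n$ matrices over $R$. A superalgebra is a $\mathbb{Z}/2\mathbb{Z}$-graded algebra $A=A_0\oplus A_1$; for homogeneous $x,y$ the supercommutator is $\{x,y\}=xy-(-1)^{|x||y|}yx$, extended bilinearly. The free supercommutative algebra $S$ over $C$ is the (unital) superalgebra generated by countably many even generators $y_1,y_2,\dots$ and countably many odd generators $z_1,z_2,\dots$, whose only relations are $\{a,b\}=0$ for all $a,b\in S$. $C[\varepsilon]$ denotes the commutative unital $C$-algebra $C[\theta,\varepsilon_1,\varepsilon_2,\dots]$ subject to the relations $\theta^2=2$ and $\varepsilon_i^2=\theta\varepsilon_i$ for all $i$. The generalized Grassmann algebra $\mathfrak{G}$ over $C$ is the unital algebra generated by $e_1,e_2,\dots$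 over the central subring $C[\varepsilon]$, subject to the relations $[e_i,e_j]=\varepsilon_i\varepsilon_j e_ie_j$ for all $i,j$ (including $i=j$). *)

theory Defs
  imports "HOL-Library.Multiset" "HOL-Algebra.Module" "HOL-Algebra.QuotRing"
begin

text \<open>
  Associative, not necessarily unital algebras over a commutative unital ring. They are carried by
  the \<^type>\<open>module\<close> record of HOL-Algebra, whose field \<open>one\<close> is ignored; the library locale
  \<^locale>\<open>algebra\<close> is not applicable since it asks for a commutative unital ring.
\<close>

locale assoc_algebra = module R A for R and A (structure) +
  assumes m_closed: "\<lbrakk>x \<in> carrier A; y \<in> carrier A\<rbrakk> \<Longrightarrow> x \<otimes> y \<in> carrier A"
    and m_assoc: "\<lbrakk>x \<in> carrier A; y \<in> carrier A; z \<in> carrier A\<rbrakk> \<Longrightarrow>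
      (x \<otimes> y) \<otimes> z = x \<otimes> (y \<otimes> z)"
    and l_distr: "\<lbrakk>x \<in> carrier A; y \<in> carrier A; z \<in> carrier A\<rbrakk> \<Longrightarrow>
      (x \<oplus> y) \<otimes> z = x \<otimes> z \<oplus> y \<otimes> z"
    and r_distr: "\<lbrakk>x \<in> carrier A; y \<in> carrier A; z \<in> carrier A\<rbrakk> \<Longrightarrow>
      z \<otimes> (x \<oplus> y) = z \<otimes> x \<oplus> z \<otimes> y"
    and smult_mult_l: "\<lbrakk>a \<in> carrier R; x \<in> carrier A; y \<in> carrier A\<rbrakk> \<Longrightarrow>
      (a \<odot> x) \<otimes> y = a \<odot> (x \<otimes> y)"
    and smult_mult_r: "\<lbrakk>a \<in> carrier R; x \<in> carrier A; y \<in> carrier A\<rbrakk> \<Longrightarrow>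
      x \<otimes> (a \<odot> y) = a \<odot> (x \<otimes> y)"


section \<open>Monoid algebras, free algebras and polynomial algebras\<close>

definition delta :: "('c, 'r) ring_scheme \<Rightarrow> 'm \<Rightarrow> 'm \<Rightarrow> 'c" where
  "delta R w = (\<lambda>v. if v = w then \<one>\<^bsub>R\<^esub> else \<zero>\<^bsub>R\<^esub>)"

definition supp :: "('c, 'r) ring_scheme \<Rightarrow> ('m \<Rightarrow> 'c) \<Rightarrow> 'm set" where
  "supp R f = {w. f w \<noteq> \<zero>\<^bsub>R\<^esub>}"

text \<open>
  The algebra \<open>R[M]\<close> of finitely supported functions \<open>M \<rightarrow> R\<close> under convolution. It is also used
  for semigroups \<open>M\<close>; it then has no unit, and its field \<open>one\<close> is meaningless.
\<close>

definition monoid_alg ::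
  "('c, 'r) ring_scheme \<Rightarrow> ('m, 's) monoid_scheme \<Rightarrow> ('c, 'm \<Rightarrow> 'c) module" where
  "monoid_alg R M = \<lparr>
     carrier = {f. (\<forall>w. f w \<in> carrier R) \<and> finite (supp R f) \<and> supp R f \<subseteq> carrier M},
     monoid.mult = (\<lambda>f g w. \<Oplus>\<^bsub>R\<^esub>p \<in> {p \<in> supp R f \<times> supp R g. fst p \<otimes>\<^bsub>M\<^esub> snd p = w}.
               f (fst p) \<otimes>\<^bsub>R\<^esub> g (snd p)),
     one = delta R \<one>\<^bsub>M\<^esub>,
     zero = (\<lambda>w. \<zero>\<^bsub>R\<^esub>),
     add = (\<lambda>f g w. f w \<oplus>\<^bsub>R\<^esub> g w),
     smult = (\<lambda>c f w. c \<otimes>\<^bsub>R\<^esub> f w)\<rparr>"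

definition free_alg :: "('c, 'r) ring_scheme \<Rightarrow> ('c, 'x list \<Rightarrow> 'c) module" where
  "free_alg R = monoid_alg R \<lparr>carrier = UNIV, monoid.mult = (@), one = []\<rparr>"

text \<open>The free non-unital algebra: noncommutative polynomials without constant term.\<close>

definition free_nonunital_alg :: "('c, 'r) ring_scheme \<Rightarrow> ('c, 'x list \<Rightarrow> 'c) module" where
  "free_nonunital_alg R = monoid_alg R \<lparr>carrier = {w. w \<noteq> []}, monoid.mult = (@), one = []\<rparr>"

text \<open>The commutative polynomial algebra; monomials are finite multisets of variables.\<close>

definition poly_alg :: "('c, 'r) ring_scheme \<Rightarrow> ('c, 'x multiset \<Rightarrow> 'c) module" where
  "poly_alg R = monoid_alg R \<lparr>carrier = UNIV, monoid.mult = (+), one = {#}\<rparr>"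


section \<open>Quotients and tensor products\<close>

text \<open>\<^const>\<open>FactRing\<close> together with the induced scalar multiplication.\<close>

definition quot_alg :: "('c, 'b, 'm) module_scheme \<Rightarrow> 'b set \<Rightarrow> ('c, 'b set) module" where
  "quot_alg B I = ring.extend (B Quot I)
     (module.fields (\<lambda>c X. \<Union>x\<in>X. I +>\<^bsub>B\<^esub> (c \<odot>\<^bsub>B\<^esub> x)))"

definition submodule_generated ::
  "('c, 'r) ring_scheme \<Rightarrow> ('c, 'b, 'm) module_scheme \<Rightarrow> 'b set \<Rightarrow> 'b set" where
  "submodule_generated R M X = \<Inter>{N. submodule N R M \<and> X \<subseteq> N}"

text \<open>
  \<open>A \<otimes> B\<close> is the free module on \<open>A \<times> B\<close> modulo the bilinearity relations. The product
  \<open>(a \<otimes> b) (a' \<otimes> b') = a a' \<otimes> b b'\<close> is induced by that of the semigroup algebra of \<open>A \<times> B\<close>, in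
  which the submodule generated by the relations is a two-sided ideal.
\<close>

definition tensor_relations ::
  "('c, 'r) ring_scheme \<Rightarrow> ('c, 'a, 'm) module_scheme \<Rightarrow> ('c, 'b, 'n) module_scheme
    \<Rightarrow> ('a \<times> 'b \<Rightarrow> 'c) set" where
  "tensor_relations R A B = (let F = monoid_alg R (A \<times>\<times> B); d = delta R in
     {d (x \<oplus>\<^bsub>A\<^esub> x', y) \<ominus>\<^bsub>F\<^esub> (d (x, y) \<oplus>\<^bsub>F\<^esub> d (x', y)) | x x' y.
        x \<in> carrier A \<and> x' \<in> carrier A \<and> y \<in> carrier B} \<union>
     {d (x, y \<oplus>\<^bsub>B\<^esub> y') \<ominus>\<^bsub>F\<^esub> (d (x, y) \<oplus>\<^bsub>F\<^esub> d (x, y')) | x y y'.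
        x \<in> carrier A \<and> y \<in> carrier B \<and> y' \<in> carrier B} \<union>
     {d (c \<odot>\<^bsub>A\<^esub> x, y) \<ominus>\<^bsub>F\<^esub> c \<odot>\<^bsub>F\<^esub> d (x, y) | c x y.
        c \<in> carrier R \<and> x \<in> carrier A \<and> y \<in> carrier B} \<union>
     {d (x, c \<odot>\<^bsub>B\<^esub> y) \<ominus>\<^bsub>F\<^esub> c \<odot>\<^bsub>F\<^esub> d (x, y) | c x y.
        c \<in> carrier R \<and> x \<in> carrier A \<and> y \<in> carrier B})"

definition tensor_alg ::
  "('c, 'r) ring_scheme \<Rightarrow> ('c, 'a, 'm) module_scheme \<Rightarrow> ('c, 'b, 'n) module_scheme
    \<Rightarrow> ('c, ('a \<times> 'b \<Rightarrow> 'c) set) module" where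
  "tensor_alg R A B = (let F = monoid_alg R (A \<times>\<times> B) in
     quot_alg F (submodule_generated R F (tensor_relations R A B)))"


section \<open>Matrix algebras\<close>

definition mat_alg :: "nat \<Rightarrow> ('c, 'b, 'm) module_scheme \<Rightarrow> ('c, nat \<times> nat \<Rightarrow> 'b) module" where
  "mat_alg n B = (let D = {..<n} \<times> {..<n} in \<lparr>
     carrier = D \<rightarrow>\<^sub>E carrier B,
     monoid.mult = (\<lambda>f g. \<lambda>(i, j)\<in>D. \<Oplus>\<^bsub>B\<^esub>k\<in>{..<n}. f (i, k) \<otimes>\<^bsub>B\<^esub> g (k, j)),
     one = (\<lambda>(i, j)\<in>D. if i = j then \<one>\<^bsub>B\<^esub> else \<zero>\<^bsub>B\<^esub>),
     zero = (\<lambda>p\<in>D. \<zero>\<^bsub>B\<^esub>),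
     add = (\<lambda>f g. \<lambda>p\<in>D. f p \<oplus>\<^bsub>B\<^esub> g p),
     smult = (\<lambda>c f. \<lambda>p\<in>D. c \<odot>\<^bsub>B\<^esub> f p)\<rparr>)"


section \<open>Polynomial identities\<close>

text \<open>The product of a nonempty word; the value at the empty word is never used below.\<close>

fun word_prod :: "('c, 'b, 'm) module_scheme \<Rightarrow> ('x \<Rightarrow> 'b) \<Rightarrow> 'x list \<Rightarrow> 'b" where
  "word_prod B b [] = \<one>\<^bsub>B\<^esub>"
| "word_prod B b [x] = b x"
| "word_prod B b (x # y # ys) = b x \<otimes>\<^bsub>B\<^esub> word_prod B b (y # ys)"

definition eval_alg ::
  "('c, 'r) ring_scheme \<Rightarrow> ('c, 'b, 'm) module_scheme \<Rightarrow> ('x \<Rightarrow> 'b) \<Rightarrow> ('x list \<Rightarrow> 'c) \<Rightarrow> 'b" where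
  "eval_alg R B b f = (\<Oplus>\<^bsub>B\<^esub>w \<in> supp R f. f w \<odot>\<^bsub>B\<^esub> word_prod B b w)"

definition identities ::
  "('c, 'r) ring_scheme \<Rightarrow> ('c, 'b, 'm) module_scheme \<Rightarrow> (nat list \<Rightarrow> 'c) set" where
  "identities R B = {f \<in> carrier (free_nonunital_alg R).
     \<forall>b \<in> UNIV \<rightarrow> carrier B. eval_alg R B b f = \<zero>\<^bsub>B\<^esub>}"


section \<open>The free supercommutative algebra\<close>

datatype svar = Even_gen nat | Odd_gen nat

fun svar_degree :: "svar \<Rightarrow> nat" where
  "svar_degree (Even_gen i) = 0"
| "svar_degree (Odd_gen i) = 1"

definition word_degree :: "svar list \<Rightarrow> nat" where
  "word_degree w = sum_list (map svar_degree w) mod 2"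

definition homogeneous_part ::
  "('c, 'r) ring_scheme \<Rightarrow> nat \<Rightarrow> (svar list \<Rightarrow> 'c) \<Rightarrow> (svar list \<Rightarrow> 'c)" where
  "homogeneous_part R d f = (\<lambda>w. if word_degree w = d then f w else \<zero>\<^bsub>R\<^esub>)"

text \<open>\<open>{a, b} = \<Sum> a\<^sub>d b\<^sub>e - (-1)\<^sup>d\<^sup>e b\<^sub>e a\<^sub>d\<close>, summed over the degrees \<open>d\<close>, \<open>e\<close> in \<open>{0, 1}\<close>.\<close>

definition supercommutator ::
  "('c, 'r) ring_scheme \<Rightarrow> (svar list \<Rightarrow> 'c) \<Rightarrow> (svar list \<Rightarrow> 'c) \<Rightarrow> (svar list \<Rightarrow> 'c)" where
  "supercommutator R a b = (let F = free_alg R; h = homogeneous_part R in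
     \<Oplus>\<^bsub>F\<^esub>d\<in>{0, 1}. \<Oplus>\<^bsub>F\<^esub>e\<in>{0, 1}.
       h d a \<otimes>\<^bsub>F\<^esub> h e b \<ominus>\<^bsub>F\<^esub> ((\<ominus>\<^bsub>R\<^esub> \<one>\<^bsub>R\<^esub>) [^]\<^bsub>R\<^esub> (d * e)) \<odot>\<^bsub>F\<^esub> (h e b \<otimes>\<^bsub>F\<^esub> h d a))"

definition free_supercomm_alg :: "('c, 'r) ring_scheme \<Rightarrow> ('c, (svar list \<Rightarrow> 'c) set) module" where
  "free_supercomm_alg R = (let F = free_alg R in
     quot_alg F (Idl\<^bsub>F\<^esub> {supercommutator R a b | a b. a \<in> carrier F \<and> b \<in> carrier F}))"


section \<open>The generalized Grassmann algebra\<close>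

datatype evar = Theta | Eps nat

definition eps_ideal :: "('c, 'r) ring_scheme \<Rightarrow> (evar multiset \<Rightarrow> 'c) set" where
  "eps_ideal R = (let P = poly_alg R; \<theta> = delta R {#Theta#}; \<epsilon> = (\<lambda>i. delta R {#Eps i#}) in
     Idl\<^bsub>P\<^esub> ({\<theta> \<otimes>\<^bsub>P\<^esub> \<theta> \<ominus>\<^bsub>P\<^esub> (\<one>\<^bsub>P\<^esub> \<oplus>\<^bsub>P\<^esub> \<one>\<^bsub>P\<^esub>)} \<union>
       {\<epsilon> i \<otimes>\<^bsub>P\<^esub> \<epsilon> i \<ominus>\<^bsub>P\<^esub> \<theta> \<otimes>\<^bsub>P\<^esub> \<epsilon> i | i. True}))"

definition eps_alg :: "('c, 'r) ring_scheme \<Rightarrow> ('c, (evar multiset \<Rightarrow> 'c) set) module" where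
  "eps_alg R = quot_alg (poly_alg R) (eps_ideal R)"

definition eps :: "('c, 'r) ring_scheme \<Rightarrow> nat \<Rightarrow> (evar multiset \<Rightarrow> 'c) set" where
  "eps R i = eps_ideal R +>\<^bsub>poly_alg R\<^esub> delta R {#Eps i#}"

text \<open>First as an algebra over \<open>C[\<epsilon>]\<close>, then with scalars restricted along \<open>C \<rightarrow> C[\<epsilon>]\<close>.\<close>

definition grassmann_over_eps ::
  "('c, 'r) ring_scheme \<Rightarrow>
    ((evar multiset \<Rightarrow> 'c) set, (nat list \<Rightarrow> (evar multiset \<Rightarrow> 'c) set) set) module" where
  "grassmann_over_eps R = (let E = eps_alg R; F = free_alg E; e = (\<lambda>i. delta E [i]) in
     quot_alg F (Idl\<^bsub>F\<^esub>
       {(e i \<otimes>\<^bsub>F\<^esub> e j \<ominus>\<^bsub>F\<^esub> e j \<otimes>\<^bsub>F\<^esub> e i) \<ominus>\<^bsub>F\<^esub> (eps R i \<otimes>\<^bsub>E\<^esub> eps R j) \<odot>\<^bsub>F\<^esub> (e i \<otimes>\<^bsub>F\<^esub> e j)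
         | i j. True}))"

definition grassmann_alg ::
  "('c, 'r) ring_scheme \<Rightarrow> ('c, (nat list \<Rightarrow> (evar multiset \<Rightarrow> 'c) set) set) module" where
  "grassmann_alg R = ring.extend (ring.truncate (grassmann_over_eps R))
     (module.fields (\<lambda>c x. (c \<odot>\<^bsub>eps_alg R\<^esub> \<one>\<^bsub>eps_alg R\<^esub>) \<odot>\<^bsub>grassmann_over_eps R\<^esub> x))"

end

theory Submission
  imports Defs
begin

text \<open>
  Since \<open>2\<close> is invertible, so is \<open>\<theta>\<close>, and \<open>p\<^sub>i = \<theta>\<^sup>-\<^sup>1 \<epsilon>\<^sub>i\<close> is an idempotent of \<open>C[\<epsilon>]\<close> with
  \<open>\<epsilon>\<^sub>i = \<theta> p\<^sub>i\<close>. In these terms the relations of the generalized Grassmann algebra \<open>G\<close> read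
  \<open>e\<^sub>j e\<^sub>i = (1 - 2 p\<^sub>i p\<^sub>j) e\<^sub>i e\<^sub>j\<close>: where \<open>p\<^sub>i = 1\<close> the generator \<open>e\<^sub>i\<close> is an odd variable, and where
  \<open>p\<^sub>i = 0\<close> it is an even one. The parity of a generator of \<open>G\<close> is a parameter, and this relates \<open>G\<close>
  to the free supercommutative algebra \<open>S\<close> in both directions.

  \<^item> \<open>S\<close> maps onto \<open>G\<close> (\<open>S_to_G_surj\<close>): the odd generators go to the odd parts \<open>p\<^sub>i e\<^sub>i\<close>, and the even
    ones to the even parts \<open>(1 - p\<^sub>i) e\<^sub>i\<close> and to the central elements \<open>p\<^sub>i\<close> and \<open>\<theta>\<close>. These generate
    \<open>G\<close>, because \<open>e\<^sub>i\<close> is the sum of its two parts and \<open>\<epsilon>\<^sub>i = \<theta> p\<^sub>i\<close>.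
  \<^item> \<open>G\<close> maps onto \<open>S \<oplus> \<surd>2 S\<close> (\<open>G_to_D_surj\<close>): let \<open>e\<^sub>i\<close> become even for even \<open>i\<close> and odd for odd \<open>i\<close>, and
    send \<open>\<theta>\<close> to the adjoined square root of \<open>2\<close>. The algebra \<open>S \<oplus> \<surd>2 S\<close> contains \<open>S\<close>, and the
    projection to the first summand is a linear retraction onto it.

  Polynomial identities pass to homomorphic images and to subalgebras (\<open>identities_surj\<close>,
  \<open>identities_inj\<close>). Both \<open>A \<otimes> _\<close> and \<open>M\<^sub>n\<close> are functors that preserve surjectivity; \<open>M\<^sub>n\<close> preserves
  injectivity, and \<open>A \<otimes> _\<close> preserves it for maps with a linear retraction. Hence
  \<open>id(A \<otimes> S) \<subseteq> id(A \<otimes> G) \<subseteq> id(A \<otimes> (S \<oplus> \<surd>2 S)) \<subseteq> id(A \<otimes> S)\<close>, and the same for matrices.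

  All algebras involved are quotients of semigroup algebras. Maps out of them come from the universal
  property of a semigroup algebra (\<open>linear_extension_algebra_map\<close>), followed by a passage to the
  quotient (\<open>quot_map_algebra_map\<close>).
\<close>


section \<open>Linear maps and polynomial identities\<close>

locale linear_map = dom: module R A + cod: module R B
  for R :: "('c, 'r) ring_scheme" and A :: "('c, 'a, 'm) module_scheme"
    and B :: "('c, 'b, 'n) module_scheme" and h :: "'a \<Rightarrow> 'b" +
  assumes map_closed: "x \<in> carrier A \<Longrightarrow> h x \<in> carrier B"
    and map_add: "\<lbrakk>x \<in> carrier A; y \<in> carrier A\<rbrakk> \<Longrightarrow> h (x \<oplus>\<^bsub>A\<^esub> y) = h x \<oplus>\<^bsub>B\<^esub> h y"
    and map_smult: "\<lbrakk>c \<in> carrier R; x \<in> carrier A\<rbrakk> \<Longrightarrow> h (c \<odot>\<^bsub>A\<^esub> x) = c \<odot>\<^bsub>B\<^esub> h x"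
begin

lemma map_zero: "h \<zero>\<^bsub>A\<^esub> = \<zero>\<^bsub>B\<^esub>"
proof -
  have "h (\<zero>\<^bsub>R\<^esub> \<odot>\<^bsub>A\<^esub> \<zero>\<^bsub>A\<^esub>) = \<zero>\<^bsub>R\<^esub> \<odot>\<^bsub>B\<^esub> h \<zero>\<^bsub>A\<^esub>"
    by (rule map_smult) auto
  then show ?thesis by (simp add: map_closed)
qed

lemma map_neg:
  assumes "x \<in> carrier A" shows "h (\<ominus>\<^bsub>A\<^esub> x) = \<ominus>\<^bsub>B\<^esub> h x"
proof -
  have "h (\<ominus>\<^bsub>A\<^esub> x) \<oplus>\<^bsub>B\<^esub> h x = \<zero>\<^bsub>B\<^esub>"
    using assms by (simp add: map_add[symmetric] dom.l_neg map_zero)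
  then show ?thesis
    using assms by (metis cod.minus_equality dom.a_inv_closed map_closed)
qed

lemma map_diff:
  assumes "x \<in> carrier A" "y \<in> carrier A" shows "h (x \<ominus>\<^bsub>A\<^esub> y) = h x \<ominus>\<^bsub>B\<^esub> h y"
  using assms by (simp add: a_minus_def map_add map_neg)

lemma map_finsum:
  assumes "f \<in> I \<rightarrow> carrier A"
  shows "h (\<Oplus>\<^bsub>A\<^esub>i\<in>I. f i) = (\<Oplus>\<^bsub>B\<^esub>i\<in>I. h (f i))"
proof (cases "finite I")
  case True
  then show ?thesis using assms
  proof (induction I rule: finite_induct)
    case empty then show ?case by (simp add: map_zero)
  next
    case (insert i I)
    have "f \<in> I \<rightarrow> carrier A" "f i \<in> carrier A" using insert.prems by auto
    moreover from this have "(\<lambda>i. h (f i)) \<in> I \<rightarrow> carrier B" by (auto intro: map_closed)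
    ultimately show ?case
      using insert by (simp add: map_add map_closed)
  qed
next
  case False
  then show ?thesis by (simp add: map_zero)
qed

lemma preimage_submodule:
  assumes "submodule N R B" shows "submodule {x \<in> carrier A. h x \<in> N} R A"
proof (rule dom.submoduleI)
  have N: "\<zero>\<^bsub>B\<^esub> \<in> N"
    using assms by (metis submodule.axioms(1) subgroup.one_closed monoid.simps(2))
  show "\<zero>\<^bsub>A\<^esub> \<in> {x \<in> carrier A. h x \<in> N}" by (simp add: map_zero N)
qed (auto simp: map_neg map_add map_smult cod.submoduleE[OF assms])

lemma kernel_submodule: "submodule {x \<in> carrier A. h x = \<zero>\<^bsub>B\<^esub>} R A"
  by (rule dom.submoduleI) (auto simp: map_neg map_add map_smult map_zero)

end

locale algebra_map = linear_map R A B h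
  for R :: "('c, 'r) ring_scheme" and A :: "('c, 'a, 'm) module_scheme"
    and B :: "('c, 'b, 'n) module_scheme" and h :: "'a \<Rightarrow> 'b" +
  assumes map_mult: "\<lbrakk>x \<in> carrier A; y \<in> carrier A\<rbrakk> \<Longrightarrow> h (x \<otimes>\<^bsub>A\<^esub> y) = h x \<otimes>\<^bsub>B\<^esub> h y"

lemma (in linear_map) image_closed:
  "\<zero>\<^bsub>B\<^esub> \<in> h ` carrier A"
  "\<lbrakk>x \<in> h ` carrier A; y \<in> h ` carrier A\<rbrakk> \<Longrightarrow> x \<oplus>\<^bsub>B\<^esub> y \<in> h ` carrier A"
  "\<lbrakk>c \<in> carrier R; x \<in> h ` carrier A\<rbrakk> \<Longrightarrow> c \<odot>\<^bsub>B\<^esub> x \<in> h ` carrier A"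
proof -
  show "\<zero>\<^bsub>B\<^esub> \<in> h ` carrier A" using map_zero dom.zero_closed by (metis imageI)
  show "x \<oplus>\<^bsub>B\<^esub> y \<in> h ` carrier A" if "x \<in> h ` carrier A" "y \<in> h ` carrier A"
    using that map_add dom.a_closed by (auto simp flip: map_add)
  show "c \<odot>\<^bsub>B\<^esub> x \<in> h ` carrier A" if "c \<in> carrier R" "x \<in> h ` carrier A"
    using that by (auto simp flip: map_smult)
qed

text \<open>The structure in which a polynomial can be evaluated; matrix algebras enter at this level.\<close>

locale mult_closed_module = module R A
  for R :: "('c, 'r) ring_scheme" and A :: "('c, 'a, 'm) module_scheme" +
  assumes mult_closed: "\<lbrakk>x \<in> carrier A; y \<in> carrier A\<rbrakk> \<Longrightarrow> x \<otimes>\<^bsub>A\<^esub> y \<in> carrier A"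
begin

lemma word_prod_closed:
  assumes "b \<in> UNIV \<rightarrow> carrier A" "w \<noteq> []" shows "word_prod A b w \<in> carrier A"
  using assms(2)
proof (induction w rule: induct_list012)
  case (3 x y ys)
  then show ?case using assms(1) by (auto intro!: mult_closed)
qed (use assms(1) in auto)

end

lemma (in assoc_algebra) mult_zero:
  assumes "x \<in> carrier A"
  shows "\<zero>\<^bsub>A\<^esub> \<otimes>\<^bsub>A\<^esub> x = \<zero>\<^bsub>A\<^esub>" "x \<otimes>\<^bsub>A\<^esub> \<zero>\<^bsub>A\<^esub> = \<zero>\<^bsub>A\<^esub>"
  using smult_mult_l[of "\<zero>\<^bsub>R\<^esub>" "\<zero>\<^bsub>A\<^esub>" x] smult_mult_r[of "\<zero>\<^bsub>R\<^esub>" x "\<zero>\<^bsub>A\<^esub>"] assms m_closed by auto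

lemma (in assoc_algebra) mult_closed_module: "mult_closed_module R A"
  by unfold_locales (rule m_closed)

lemma (in algebra_map) image_mult:
  assumes "mult_closed_module R A" "x \<in> h ` carrier A" "y \<in> h ` carrier A"
  shows "x \<otimes>\<^bsub>B\<^esub> y \<in> h ` carrier A"
  using assms mult_closed_module.mult_closed[OF assms(1)] by (auto simp flip: map_mult)

lemma (in algebra_map) map_word_prod:
  assumes "mult_closed_module R A" "b \<in> UNIV \<rightarrow> carrier A" "w \<noteq> []"
  shows "h (word_prod A b w) = word_prod B (h \<circ> b) w"
proof -
  interpret mult_closed_module R A by fact
  show ?thesis using assms(3)
  proof (induction w rule: induct_list012)
    case (3 x y ys)
    have "b x \<in> carrier A" using assms(2) by auto
    then show ?case
      using 3 word_prod_closed[OF assms(2), of "y # ys"] by (simp add: map_mult)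
  qed auto
qed

lemma free_nonunital_carrierD:
  assumes "f \<in> carrier (free_nonunital_alg R)"
  shows "f w \<in> carrier R" "w \<in> supp R f \<Longrightarrow> w \<noteq> []"
  using assms by (auto simp: free_nonunital_alg_def monoid_alg_def)

lemma (in algebra_map) map_eval_alg:
  assumes "mult_closed_module R A" "b \<in> UNIV \<rightarrow> carrier A" "f \<in> carrier (free_nonunital_alg R)"
  shows "h (eval_alg R A b f) = eval_alg R B (h \<circ> b) f"
proof -
  interpret mult_closed_module R A by fact
  note w = free_nonunital_carrierD[OF assms(3)]
  have wp: "word_prod A b w \<in> carrier A" "h (word_prod A b w) = word_prod B (h \<circ> b) w"
    if "w \<in> supp R f" for w
    using word_prod_closed[OF assms(2)] map_word_prod[OF assms(1,2)] w(2)[OF that] by auto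
  have "h (eval_alg R A b f) = (\<Oplus>\<^bsub>B\<^esub>v\<in>supp R f. h (f v \<odot>\<^bsub>A\<^esub> word_prod A b v))"
    unfolding eval_alg_def by (rule map_finsum) (auto simp: w wp)
  also have "\<dots> = eval_alg R B (h \<circ> b) f"
    unfolding eval_alg_def
    by (rule cod.finsum_cong') (auto simp: w wp map_smult simp flip: wp(2) intro!: cod.smult_closed map_closed)
  finally show ?thesis .
qed

lemma (in mult_closed_module) eval_alg_closed:
  assumes "b \<in> UNIV \<rightarrow> carrier A" "f \<in> carrier (free_nonunital_alg R)"
  shows "eval_alg R A b f \<in> carrier A"
  unfolding eval_alg_def using free_nonunital_carrierD[OF assms(2)] word_prod_closed[OF assms(1)]
  by (auto intro!: finsum_closed)

text \<open>
  A substitution in the image lifts to a substitution in \<open>A\<close>, and evaluation commutes with \<open>h\<close>.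
\<close>

lemma (in algebra_map) identities_surj:
  assumes "mult_closed_module R A" "carrier B \<subseteq> h ` carrier A"
  shows "identities R A \<subseteq> identities R B"
proof
  fix f assume f: "f \<in> identities R A"
  then have fc: "f \<in> carrier (free_nonunital_alg R)" by (simp add: identities_def)
  have "eval_alg R B b f = \<zero>\<^bsub>B\<^esub>" if b: "b \<in> UNIV \<rightarrow> carrier B" for b
  proof -
    have "\<forall>x. \<exists>a. a \<in> carrier A \<and> h a = b x"
    proof
      fix x
      have "b x \<in> h ` carrier A" using subsetD[OF assms(2) Pi_mem[OF b UNIV_I]] .
      then show "\<exists>a. a \<in> carrier A \<and> h a = b x" unfolding image_iff by metis
    qed
    then have "\<exists>a. \<forall>x. a x \<in> carrier A \<and> h (a x) = b x" by (rule choice)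
    then obtain a where a: "a \<in> UNIV \<rightarrow> carrier A" "h \<circ> a = b" by (auto simp: fun_eq_iff)
    then have "eval_alg R B b f = h (eval_alg R A a f)"
      by (simp add: map_eval_alg[OF assms(1) a(1) fc])
    also have "\<dots> = \<zero>\<^bsub>B\<^esub>" using f a(1) by (simp add: identities_def map_zero)
    finally show ?thesis .
  qed
  with fc show "f \<in> identities R B" by (simp add: identities_def)
qed

lemma (in algebra_map) identities_inj:
  assumes "mult_closed_module R A" "inj_on h (carrier A)"
  shows "identities R B \<subseteq> identities R A"
proof
  fix f assume f: "f \<in> identities R B"
  then have fc: "f \<in> carrier (free_nonunital_alg R)" by (simp add: identities_def)
  interpret mult_closed_module R A by fact
  have "eval_alg R A b f = \<zero>\<^bsub>A\<^esub>" if b: "b \<in> UNIV \<rightarrow> carrier A" for b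
  proof -
    have "h \<circ> b \<in> UNIV \<rightarrow> carrier B" using b by (auto simp: Pi_iff intro: map_closed)
    then have "h (eval_alg R A b f) = h \<zero>\<^bsub>A\<^esub>"
      using f by (simp add: map_eval_alg[OF assms(1) b fc] identities_def map_zero)
    then show ?thesis
      using assms(2) eval_alg_closed[OF b fc] by (auto dest: inj_onD)
  qed
  with fc show "f \<in> identities R A" by (simp add: identities_def)
qed

section \<open>Matrix algebras are functorial\<close>

lemma mat_alg_simps:
  "carrier (mat_alg n B) = ({..<n} \<times> {..<n} \<rightarrow>\<^sub>E carrier B)"
  "f \<otimes>\<^bsub>mat_alg n B\<^esub> g = (\<lambda>(i, j)\<in>{..<n} \<times> {..<n}. \<Oplus>\<^bsub>B\<^esub>k\<in>{..<n}. f (i, k) \<otimes>\<^bsub>B\<^esub> g (k, j))"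
  "\<zero>\<^bsub>mat_alg n B\<^esub> = (\<lambda>p\<in>{..<n} \<times> {..<n}. \<zero>\<^bsub>B\<^esub>)"
  "f \<oplus>\<^bsub>mat_alg n B\<^esub> g = (\<lambda>p\<in>{..<n} \<times> {..<n}. f p \<oplus>\<^bsub>B\<^esub> g p)"
  "c \<odot>\<^bsub>mat_alg n B\<^esub> f = (\<lambda>p\<in>{..<n} \<times> {..<n}. c \<odot>\<^bsub>B\<^esub> f p)"
  by (simp_all add: mat_alg_def Let_def)

lemma (in mult_closed_module) mat_alg: "mult_closed_module R (mat_alg n A)"
proof -
  have "abelian_group (mat_alg n A)"
  proof (rule abelian_groupI)
    fix x assume x: "x \<in> carrier (mat_alg n A)"
    let ?y = "\<lambda>p\<in>{..<n} \<times> {..<n}. \<ominus>\<^bsub>A\<^esub> x p"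
    have "?y \<in> carrier (mat_alg n A)" using x by (auto simp: mat_alg_simps PiE_iff)
    moreover have "?y \<oplus>\<^bsub>mat_alg n A\<^esub> x = \<zero>\<^bsub>mat_alg n A\<^esub>"
      using x by (auto simp: mat_alg_simps PiE_iff fun_eq_iff M.l_neg)
    ultimately show "\<exists>y\<in>carrier (mat_alg n A). y \<oplus>\<^bsub>mat_alg n A\<^esub> x = \<zero>\<^bsub>mat_alg n A\<^esub>" by blast
    show "\<zero>\<^bsub>mat_alg n A\<^esub> \<oplus>\<^bsub>mat_alg n A\<^esub> x = x"
      using x by (auto simp: mat_alg_simps PiE_iff fun_eq_iff extensional_def)
  qed (auto simp: mat_alg_simps PiE_iff fun_eq_iff M.a_ac)
  then have "module R (mat_alg n A)"
    by (intro moduleI R.is_cring)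
       (auto simp: mat_alg_simps PiE_iff fun_eq_iff smult_l_distr smult_r_distr smult_assoc1 extensional_def)
  moreover have "f \<otimes>\<^bsub>mat_alg n A\<^esub> g \<in> carrier (mat_alg n A)"
    if "f \<in> carrier (mat_alg n A)" "g \<in> carrier (mat_alg n A)" for f g
    using that by (auto simp: mat_alg_simps PiE_iff intro!: M.finsum_closed mult_closed)
  ultimately show ?thesis
    by (simp add: mult_closed_module_def mult_closed_module_axioms_def)
qed

definition mat_map :: "nat \<Rightarrow> ('a \<Rightarrow> 'b) \<Rightarrow> (nat \<times> nat \<Rightarrow> 'a) \<Rightarrow> (nat \<times> nat \<Rightarrow> 'b)" where
  "mat_map n h f = (\<lambda>p\<in>{..<n} \<times> {..<n}. h (f p))"

lemma (in algebra_map) mat_map: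
  assumes "mult_closed_module R A" "mult_closed_module R B"
  shows "algebra_map R (mat_alg n A) (mat_alg n B) (mat_map n h)"
proof -
  interpret A: mult_closed_module R A by fact
  interpret B: mult_closed_module R B by fact
  interpret MA: mult_closed_module R "mat_alg n A" by (rule A.mat_alg)
  interpret MB: mult_closed_module R "mat_alg n B" by (rule B.mat_alg)
  show ?thesis
  proof unfold_locales
    fix f g assume fg: "f \<in> carrier (mat_alg n A)" "g \<in> carrier (mat_alg n A)"
    show "mat_map n h (f \<otimes>\<^bsub>mat_alg n A\<^esub> g) = mat_map n h f \<otimes>\<^bsub>mat_alg n B\<^esub> mat_map n h g"
    proof (rule ext)
      fix p :: "nat \<times> nat"
      obtain i j where p: "p = (i, j)" by fastforce
      show "mat_map n h (f \<otimes>\<^bsub>mat_alg n A\<^esub> g) p = (mat_map n h f \<otimes>\<^bsub>mat_alg n B\<^esub> mat_map n h g) p"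
      proof (cases "i < n \<and> j < n")
        case True
        have "h (\<Oplus>\<^bsub>A\<^esub>k\<in>{..<n}. f (i, k) \<otimes>\<^bsub>A\<^esub> g (k, j)) =
              (\<Oplus>\<^bsub>B\<^esub>k\<in>{..<n}. h (f (i, k) \<otimes>\<^bsub>A\<^esub> g (k, j)))"
          using fg True by (intro map_finsum) (auto simp: mat_alg_simps PiE_iff intro!: A.mult_closed)
        also have "\<dots> = (\<Oplus>\<^bsub>B\<^esub>k\<in>{..<n}. h (f (i, k)) \<otimes>\<^bsub>B\<^esub> h (g (k, j)))"
          using fg True by (intro cod.finsum_cong')
            (auto simp: mat_alg_simps PiE_iff map_mult intro!: B.mult_closed map_closed)
        also have "\<dots> = (\<Oplus>\<^bsub>B\<^esub>k\<in>{..<n}. mat_map n h f (i, k) \<otimes>\<^bsub>B\<^esub> mat_map n h g (k, j))"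
          using fg True by (intro cod.finsum_cong')
            (auto simp: mat_alg_simps PiE_iff mat_map_def intro!: B.mult_closed map_closed)
        finally show ?thesis using True by (simp add: p mat_map_def mat_alg_simps)
      qed (auto simp: p mat_map_def mat_alg_simps)
    qed
  qed (auto simp: mat_map_def mat_alg_simps PiE_iff fun_eq_iff map_add map_smult intro: map_closed)
qed

lemma mat_map_surj:
  assumes "carrier B \<subseteq> h ` carrier A"
  shows "carrier (mat_alg n B) \<subseteq> mat_map n h ` carrier (mat_alg n A)"
proof
  fix g assume g: "g \<in> carrier (mat_alg n B)"
  define f where "f = (\<lambda>p\<in>{..<n} \<times> {..<n}. SOME x. x \<in> carrier A \<and> h x = g p)"
  have "f p \<in> carrier A \<and> h (f p) = g p" if "p \<in> {..<n} \<times> {..<n}" for p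
  proof -
    have "g p \<in> carrier B" using g that by (auto simp: mat_alg_simps PiE_iff)
    then have "\<exists>x. x \<in> carrier A \<and> h x = g p" using assms unfolding image_iff subset_iff by metis
    from someI_ex[OF this] show ?thesis using that by (simp add: f_def)
  qed
  then have "f \<in> carrier (mat_alg n A)" "mat_map n h f = g"
    using g by (auto simp: mat_alg_simps f_def mat_map_def PiE_iff fun_eq_iff extensional_def)
  then show "g \<in> mat_map n h ` carrier (mat_alg n A)" by blast
qed

lemma mat_map_inj:
  assumes "inj_on h (carrier A)"
  shows "inj_on (mat_map n h) (carrier (mat_alg n A))"
proof (rule inj_onI)
  fix f g assume fg: "f \<in> carrier (mat_alg n A)" "g \<in> carrier (mat_alg n A)"
    and eq: "mat_map n h f = mat_map n h g"
  show "f = g"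
  proof (rule PiE_ext)
    fix p assume p: "p \<in> {..<n} \<times> {..<n}"
    then have "h (f p) = h (g p)" using fun_cong[OF eq, of p] by (simp add: mat_map_def)
    then show "f p = g p" using assms fg p by (auto simp: mat_alg_simps PiE_iff dest: inj_onD)
  qed (use fg in \<open>auto simp: mat_alg_simps\<close>)
qed


section \<open>Semigroup algebras and their universal property\<close>

locale semigroup_algebra = cring R for R :: "('c, 'r) ring_scheme" (structure) +
  fixes M :: "('m, 's) monoid_scheme"
  assumes semigroup_closed: "\<lbrakk>u \<in> carrier M; v \<in> carrier M\<rbrakk> \<Longrightarrow> u \<otimes>\<^bsub>M\<^esub> v \<in> carrier M"
    and semigroup_assoc: "\<lbrakk>u \<in> carrier M; v \<in> carrier M; w \<in> carrier M\<rbrakk> \<Longrightarrow>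
      (u \<otimes>\<^bsub>M\<^esub> v) \<otimes>\<^bsub>M\<^esub> w = u \<otimes>\<^bsub>M\<^esub> (v \<otimes>\<^bsub>M\<^esub> w)"
begin

abbreviation F where "F \<equiv> monoid_alg R M"

lemma F_simps:
  "\<zero>\<^bsub>F\<^esub> = (\<lambda>w. \<zero>)" "f \<oplus>\<^bsub>F\<^esub> g = (\<lambda>w. f w \<oplus> g w)" "c \<odot>\<^bsub>F\<^esub> f = (\<lambda>w. c \<otimes> f w)"
  "\<one>\<^bsub>F\<^esub> = delta R \<one>\<^bsub>M\<^esub>"
  by (simp_all add: monoid_alg_def)

lemma F_carrier:
  "f \<in> carrier F \<longleftrightarrow> (\<forall>w. f w \<in> carrier R) \<and> finite (supp R f) \<and> supp R f \<subseteq> carrier M"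
  by (simp add: monoid_alg_def)

lemma coeff_closed: "f \<in> carrier F \<Longrightarrow> f w \<in> carrier R"
  by (simp add: F_carrier)

lemma supp_finite: "f \<in> carrier F \<Longrightarrow> finite (supp R f)"
  by (simp add: F_carrier)

lemma supp_carrier: "f \<in> carrier F \<Longrightarrow> supp R f \<subseteq> carrier M"
  by (simp add: F_carrier)

lemma F_carrierI:
  assumes "\<And>w. f w \<in> carrier R" "finite X" "X \<subseteq> carrier M" "\<And>w. w \<notin> X \<Longrightarrow> f w = \<zero>"
  shows "f \<in> carrier F"
proof -
  have "supp R f \<subseteq> X" using assms(4) by (auto simp: supp_def)
  then show ?thesis using assms by (auto simp: F_carrier intro: finite_subset)
qed

lemma supp_zeroD: "w \<notin> supp R f \<Longrightarrow> f w = \<zero>"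
  by (simp add: supp_def)

lemma F_zero_closed: "\<zero>\<^bsub>F\<^esub> \<in> carrier F"
  by (simp add: F_carrier F_simps supp_def)

lemma F_add_closed: "\<lbrakk>f \<in> carrier F; g \<in> carrier F\<rbrakk> \<Longrightarrow> f \<oplus>\<^bsub>F\<^esub> g \<in> carrier F"
  using supp_finite[of f] supp_finite[of g] supp_carrier[of f] supp_carrier[of g]
  by (intro F_carrierI[of _ "supp R f \<union> supp R g"]) (auto simp: F_simps supp_zeroD coeff_closed)

lemma F_smult_closed: "\<lbrakk>c \<in> carrier R; f \<in> carrier F\<rbrakk> \<Longrightarrow> c \<odot>\<^bsub>F\<^esub> f \<in> carrier F"
  using supp_finite[of f] supp_carrier[of f]
  by (intro F_carrierI[of _ "supp R f"]) (auto simp: F_simps supp_zeroD coeff_closed)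

lemma F_module: "module R F"
proof (rule moduleI)
  show "abelian_group F"
  proof (rule abelian_groupI)
    fix f assume f: "f \<in> carrier F"
    then have "(\<ominus> \<one>) \<odot>\<^bsub>F\<^esub> f \<oplus>\<^bsub>F\<^esub> f = \<zero>\<^bsub>F\<^esub>"
      by (auto simp: F_simps fun_eq_iff l_minus l_neg coeff_closed)
    moreover have "(\<ominus> \<one>) \<odot>\<^bsub>F\<^esub> f \<in> carrier F" using f by (simp add: F_smult_closed)
    ultimately show "\<exists>g\<in>carrier F. g \<oplus>\<^bsub>F\<^esub> f = \<zero>\<^bsub>F\<^esub>" by blast
  next
    fix f g h assume "f \<in> carrier F" "g \<in> carrier F" "h \<in> carrier F"
    then show "f \<oplus>\<^bsub>F\<^esub> g \<oplus>\<^bsub>F\<^esub> h = f \<oplus>\<^bsub>F\<^esub> (g \<oplus>\<^bsub>F\<^esub> h)"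
      by (auto simp: F_simps fun_eq_iff a_assoc coeff_closed)
  next
    fix f g assume "f \<in> carrier F" "g \<in> carrier F"
    then show "f \<oplus>\<^bsub>F\<^esub> g = g \<oplus>\<^bsub>F\<^esub> f" by (auto simp: F_simps fun_eq_iff a_comm coeff_closed)
  next
    fix f assume "f \<in> carrier F"
    then show "\<zero>\<^bsub>F\<^esub> \<oplus>\<^bsub>F\<^esub> f = f" by (auto simp: F_simps fun_eq_iff coeff_closed)
  qed (auto simp: F_zero_closed F_add_closed)
  show "c \<odot>\<^bsub>F\<^esub> f \<in> carrier F" if "c \<in> carrier R" "f \<in> carrier F" for c f
    using that by (rule F_smult_closed)
qed (use is_cring in \<open>auto simp: F_simps fun_eq_iff l_distr r_distr m_assoc coeff_closed\<close>)

lemma delta_closed: "u \<in> carrier M \<Longrightarrow> delta R u \<in> carrier F"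
  by (rule F_carrierI[of _ "{u}"]) (auto simp: delta_def)

text \<open>
  The sum in the convolution runs over the supports of the factors. Bilinearity compares products of
  elements with different supports, so that the supports have to be enlarged to common sets first.
\<close>

lemma mult_superset:
  assumes "f \<in> carrier F" "g \<in> carrier F" "finite X" "finite Y" "supp R f \<subseteq> X" "supp R g \<subseteq> Y"
  shows "(f \<otimes>\<^bsub>F\<^esub> g) w = (\<Oplus>p\<in>{p \<in> X \<times> Y. fst p \<otimes>\<^bsub>M\<^esub> snd p = w}. f (fst p) \<otimes> g (snd p))"
proof -
  note [simp] = coeff_closed[OF assms(1)] coeff_closed[OF assms(2)]
  have "(f \<otimes>\<^bsub>F\<^esub> g) w =
      (\<Oplus>p\<in>{p \<in> supp R f \<times> supp R g. fst p \<otimes>\<^bsub>M\<^esub> snd p = w}. f (fst p) \<otimes> g (snd p))"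
    by (simp add: monoid_alg_def)
  also have "\<dots> = (\<Oplus>p\<in>{p \<in> X \<times> Y. fst p \<otimes>\<^bsub>M\<^esub> snd p = w}. f (fst p) \<otimes> g (snd p))"
  proof (rule add.finprod_mono_neutral_cong_left)
    show "finite {p \<in> X \<times> Y. fst p \<otimes>\<^bsub>M\<^esub> snd p = w}"
      by (rule finite_subset[of _ "X \<times> Y"]) (use assms in auto)
    show "{p \<in> supp R f \<times> supp R g. fst p \<otimes>\<^bsub>M\<^esub> snd p = w} \<subseteq> {p \<in> X \<times> Y. fst p \<otimes>\<^bsub>M\<^esub> snd p = w}"
      using assms by auto
    show "f (fst p) \<otimes> g (snd p) = \<zero>"
      if "p \<in> {p \<in> X \<times> Y. fst p \<otimes>\<^bsub>M\<^esub> snd p = w} - {p \<in> supp R f \<times> supp R g. fst p \<otimes>\<^bsub>M\<^esub> snd p = w}" for p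
    proof -
      have "f (fst p) = \<zero> \<or> g (snd p) = \<zero>" using that by (cases p) (auto simp: supp_def)
      then show ?thesis using assms(1,2) by auto
    qed
  qed (use assms in auto)
  finally show ?thesis .
qed

lemma F_mult_closed:
  assumes "f \<in> carrier F" "g \<in> carrier F" shows "f \<otimes>\<^bsub>F\<^esub> g \<in> carrier F"
proof (rule F_carrierI)
  note [simp] = coeff_closed[OF assms(1)] coeff_closed[OF assms(2)]
  let ?X = "(\<lambda>p. fst p \<otimes>\<^bsub>M\<^esub> snd p) ` (supp R f \<times> supp R g)"
  note expand = mult_superset[OF assms supp_finite[OF assms(1)] supp_finite[OF assms(2)] order_refl order_refl]
  show "finite ?X" using assms by (auto intro!: finite_imageI simp: supp_finite)
  show "?X \<subseteq> carrier M"
    using supp_carrier[OF assms(1)] supp_carrier[OF assms(2)] by (auto intro!: semigroup_closed)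
  show "(f \<otimes>\<^bsub>F\<^esub> g) w \<in> carrier R" for w
    using assms by (auto simp: expand intro!: finsum_closed)
  show "(f \<otimes>\<^bsub>F\<^esub> g) w = \<zero>" if "w \<notin> ?X" for w
  proof -
    have "{p \<in> supp R f \<times> supp R g. fst p \<otimes>\<^bsub>M\<^esub> snd p = w} = {}" using that by (force simp: image_iff)
    then show ?thesis by (simp only: expand finsum_empty)
  qed
qed

lemma F_l_distr:
  assumes f: "f \<in> carrier F" and f': "f' \<in> carrier F" and g: "g \<in> carrier F"
  shows "(f \<oplus>\<^bsub>F\<^esub> f') \<otimes>\<^bsub>F\<^esub> g = f \<otimes>\<^bsub>F\<^esub> g \<oplus>\<^bsub>F\<^esub> f' \<otimes>\<^bsub>F\<^esub> g"
proof (rule ext)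
  note [simp] = coeff_closed[OF f] coeff_closed[OF f'] coeff_closed[OF g]
  fix w
  let ?X = "supp R f \<union> supp R f'" and ?Y = "supp R g"
  let ?P = "{p \<in> ?X \<times> ?Y. fst p \<otimes>\<^bsub>M\<^esub> snd p = w}"
  have fin: "finite ?X" "finite ?Y" using f f' g by (auto simp: supp_finite)
  have "((f \<oplus>\<^bsub>F\<^esub> f') \<otimes>\<^bsub>F\<^esub> g) w = (\<Oplus>p\<in>?P. (f \<oplus>\<^bsub>F\<^esub> f') (fst p) \<otimes> g (snd p))"
    by (rule mult_superset) (use f f' g fin F_add_closed in \<open>auto simp: supp_def F_simps\<close>)
  also have "\<dots> = (\<Oplus>p\<in>?P. f (fst p) \<otimes> g (snd p) \<oplus> f' (fst p) \<otimes> g (snd p))"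
    by (rule finsum_cong') (use f f' g in \<open>auto simp: F_simps l_distr\<close>)
  also have "\<dots> = (\<Oplus>p\<in>?P. f (fst p) \<otimes> g (snd p)) \<oplus> (\<Oplus>p\<in>?P. f' (fst p) \<otimes> g (snd p))"
    by (rule finsum_addf) (use f f' g in auto)
  also have "\<dots> = (f \<otimes>\<^bsub>F\<^esub> g \<oplus>\<^bsub>F\<^esub> f' \<otimes>\<^bsub>F\<^esub> g) w"
    using mult_superset[OF f g fin] mult_superset[OF f' g fin] by (simp add: F_simps)
  finally show "((f \<oplus>\<^bsub>F\<^esub> f') \<otimes>\<^bsub>F\<^esub> g) w = (f \<otimes>\<^bsub>F\<^esub> g \<oplus>\<^bsub>F\<^esub> f' \<otimes>\<^bsub>F\<^esub> g) w" .
qed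

lemma F_r_distr:
  assumes f: "f \<in> carrier F" and f': "f' \<in> carrier F" and g: "g \<in> carrier F"
  shows "g \<otimes>\<^bsub>F\<^esub> (f \<oplus>\<^bsub>F\<^esub> f') = g \<otimes>\<^bsub>F\<^esub> f \<oplus>\<^bsub>F\<^esub> g \<otimes>\<^bsub>F\<^esub> f'"
proof (rule ext)
  note [simp] = coeff_closed[OF f] coeff_closed[OF f'] coeff_closed[OF g]
  fix w
  let ?X = "supp R f \<union> supp R f'" and ?Y = "supp R g"
  let ?P = "{p \<in> ?Y \<times> ?X. fst p \<otimes>\<^bsub>M\<^esub> snd p = w}"
  have fin: "finite ?X" "finite ?Y" using f f' g by (auto simp: supp_finite)
  have "(g \<otimes>\<^bsub>F\<^esub> (f \<oplus>\<^bsub>F\<^esub> f')) w = (\<Oplus>p\<in>?P. g (fst p) \<otimes> (f \<oplus>\<^bsub>F\<^esub> f') (snd p))"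
    by (rule mult_superset) (use f f' g fin F_add_closed in \<open>auto simp: supp_def F_simps\<close>)
  also have "\<dots> = (\<Oplus>p\<in>?P. g (fst p) \<otimes> f (snd p) \<oplus> g (fst p) \<otimes> f' (snd p))"
    by (rule finsum_cong') (use f f' g in \<open>auto simp: F_simps r_distr\<close>)
  also have "\<dots> = (\<Oplus>p\<in>?P. g (fst p) \<otimes> f (snd p)) \<oplus> (\<Oplus>p\<in>?P. g (fst p) \<otimes> f' (snd p))"
    by (rule finsum_addf) (use f f' g in auto)
  also have "\<dots> = (g \<otimes>\<^bsub>F\<^esub> f \<oplus>\<^bsub>F\<^esub> g \<otimes>\<^bsub>F\<^esub> f') w"
    using mult_superset[OF g f fin(2,1)] mult_superset[OF g f' fin(2,1)] by (simp add: F_simps)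
  finally show "(g \<otimes>\<^bsub>F\<^esub> (f \<oplus>\<^bsub>F\<^esub> f')) w = (g \<otimes>\<^bsub>F\<^esub> f \<oplus>\<^bsub>F\<^esub> g \<otimes>\<^bsub>F\<^esub> f') w" .
qed

lemma F_smult_mult:
  assumes c: "c \<in> carrier R" and f: "f \<in> carrier F" and g: "g \<in> carrier F"
  shows "(c \<odot>\<^bsub>F\<^esub> f) \<otimes>\<^bsub>F\<^esub> g = c \<odot>\<^bsub>F\<^esub> (f \<otimes>\<^bsub>F\<^esub> g)" "f \<otimes>\<^bsub>F\<^esub> (c \<odot>\<^bsub>F\<^esub> g) = c \<odot>\<^bsub>F\<^esub> (f \<otimes>\<^bsub>F\<^esub> g)"
proof -
  note [simp] = coeff_closed[OF f] coeff_closed[OF g]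
  let ?P = "\<lambda>w. {p \<in> supp R f \<times> supp R g. fst p \<otimes>\<^bsub>M\<^esub> snd p = w}"
  have fin: "finite (supp R f)" "finite (supp R g)" using f g by (auto simp: supp_finite)
  have finP: "finite (?P w)" for w by (rule finite_subset[of _ "supp R f \<times> supp R g"]) (use fin in auto)
  have base: "c \<otimes> (f \<otimes>\<^bsub>F\<^esub> g) w = (\<Oplus>p\<in>?P w. c \<otimes> (f (fst p) \<otimes> g (snd p)))" for w
    using mult_superset[OF f g fin] by (simp, intro finsum_rdistr) (use finP c f g in auto)
  have "((c \<odot>\<^bsub>F\<^esub> f) \<otimes>\<^bsub>F\<^esub> g) w = c \<otimes> (f \<otimes>\<^bsub>F\<^esub> g) w" for w
  proof -
    have "((c \<odot>\<^bsub>F\<^esub> f) \<otimes>\<^bsub>F\<^esub> g) w = (\<Oplus>p\<in>?P w. (c \<odot>\<^bsub>F\<^esub> f) (fst p) \<otimes> g (snd p))"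
      by (rule mult_superset) (use c f g fin F_smult_closed in \<open>auto simp: supp_def F_simps\<close>)
    also have "\<dots> = (\<Oplus>p\<in>?P w. c \<otimes> (f (fst p) \<otimes> g (snd p)))"
      by (rule finsum_cong') (use c f g in \<open>auto simp: F_simps m_assoc\<close>)
    finally show ?thesis by (simp add: base)
  qed
  then show "(c \<odot>\<^bsub>F\<^esub> f) \<otimes>\<^bsub>F\<^esub> g = c \<odot>\<^bsub>F\<^esub> (f \<otimes>\<^bsub>F\<^esub> g)" by (auto simp: F_simps fun_eq_iff)
  have "(f \<otimes>\<^bsub>F\<^esub> (c \<odot>\<^bsub>F\<^esub> g)) w = c \<otimes> (f \<otimes>\<^bsub>F\<^esub> g) w" for w
  proof -
    have "(f \<otimes>\<^bsub>F\<^esub> (c \<odot>\<^bsub>F\<^esub> g)) w = (\<Oplus>p\<in>?P w. f (fst p) \<otimes> (c \<odot>\<^bsub>F\<^esub> g) (snd p))"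
      by (rule mult_superset) (use c f g fin F_smult_closed in \<open>auto simp: supp_def F_simps\<close>)
    also have "\<dots> = (\<Oplus>p\<in>?P w. c \<otimes> (f (fst p) \<otimes> g (snd p)))"
      by (rule finsum_cong') (use c f g in \<open>auto simp: F_simps m_lcomm\<close>)
    finally show ?thesis by (simp add: base)
  qed
  then show "f \<otimes>\<^bsub>F\<^esub> (c \<odot>\<^bsub>F\<^esub> g) = c \<odot>\<^bsub>F\<^esub> (f \<otimes>\<^bsub>F\<^esub> g)" by (auto simp: F_simps fun_eq_iff)
qed

lemma F_mult_zero:
  assumes "f \<in> carrier F" shows "\<zero>\<^bsub>F\<^esub> \<otimes>\<^bsub>F\<^esub> f = \<zero>\<^bsub>F\<^esub>" "f \<otimes>\<^bsub>F\<^esub> \<zero>\<^bsub>F\<^esub> = \<zero>\<^bsub>F\<^esub>"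
proof -
  interpret FM: module R F by (rule F_module)
  show "\<zero>\<^bsub>F\<^esub> \<otimes>\<^bsub>F\<^esub> f = \<zero>\<^bsub>F\<^esub>" "f \<otimes>\<^bsub>F\<^esub> \<zero>\<^bsub>F\<^esub> = \<zero>\<^bsub>F\<^esub>"
    using F_smult_mult[of \<zero> "\<zero>\<^bsub>F\<^esub>" f] F_smult_mult[of \<zero> f "\<zero>\<^bsub>F\<^esub>"] assms F_zero_closed F_mult_closed
    by auto
qed

lemma delta_mult:
  assumes "u \<in> carrier M" "v \<in> carrier M"
  shows "delta R u \<otimes>\<^bsub>F\<^esub> delta R v = delta R (u \<otimes>\<^bsub>M\<^esub> v)"
proof (rule ext)
  fix w
  have "(delta R u \<otimes>\<^bsub>F\<^esub> delta R v) w =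
      (\<Oplus>p\<in>{p \<in> {u} \<times> {v}. fst p \<otimes>\<^bsub>M\<^esub> snd p = w}. delta R u (fst p) \<otimes> delta R v (snd p))"
    by (rule mult_superset) (use assms delta_closed in \<open>auto simp: supp_def delta_def split: if_splits\<close>)
  also have "{p \<in> {u} \<times> {v}. fst p \<otimes>\<^bsub>M\<^esub> snd p = w} = (if u \<otimes>\<^bsub>M\<^esub> v = w then {(u, v)} else {})"
    by auto
  also have "(\<Oplus>p\<in>\<dots>. delta R u (fst p) \<otimes> delta R v (snd p)) = delta R (u \<otimes>\<^bsub>M\<^esub> v) w"
    by (auto simp: delta_def)
  finally show "(delta R u \<otimes>\<^bsub>F\<^esub> delta R v) w = delta R (u \<otimes>\<^bsub>M\<^esub> v) w" .
qed

text \<open>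
  The elements of \<open>M\<close> span \<open>R[M]\<close>. This turns (multi)linear statements about \<open>R[M]\<close> into statements
  about \<open>M\<close>; associativity of the convolution is the first instance.
\<close>

lemma monoid_alg_induct [consumes 1, case_names zero delta add smult]:
  assumes "f \<in> carrier F"
    and zero: "P \<zero>\<^bsub>F\<^esub>"
    and delta: "\<And>w. w \<in> carrier M \<Longrightarrow> P (delta R w)"
    and add: "\<And>f g. \<lbrakk>f \<in> carrier F; g \<in> carrier F; P f; P g\<rbrakk> \<Longrightarrow> P (f \<oplus>\<^bsub>F\<^esub> g)"
    and smult: "\<And>c f. \<lbrakk>c \<in> carrier R; f \<in> carrier F; P f\<rbrakk> \<Longrightarrow> P (c \<odot>\<^bsub>F\<^esub> f)"
  shows "P f"
proof -
  have "\<forall>f \<in> carrier F. supp R f \<subseteq> X \<longrightarrow> P f" if "finite X" for X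
    using that
  proof (induction X rule: finite_induct)
    case empty
    have "f = \<zero>\<^bsub>F\<^esub>" if "supp R f \<subseteq> {}" for f using that by (auto simp: supp_def F_simps)
    then show ?case using zero by blast
  next
    case (insert u X)
    show ?case
    proof (intro ballI impI)
      fix f assume f: "f \<in> carrier F" "supp R f \<subseteq> insert u X"
      \<comment> \<open>Split off the coefficient of \<open>f\<close> at \<open>u\<close>.\<close>
      define g where "g = f(u := \<zero>)"
      have g: "g \<in> carrier F" using f(1) supp_finite[of f] supp_carrier[of f]
        by (intro F_carrierI[of _ "supp R f"]) (auto simp: g_def supp_zeroD coeff_closed)
      have "supp R g \<subseteq> X" using f(2) by (auto simp: g_def supp_def)
      then have Pg: "P g" using insert.IH g by blast
      show "P f"
      proof (cases "u \<in> supp R f")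
        case True
        then have u: "u \<in> carrier M" using supp_carrier[OF f(1)] by auto
        have "f = f u \<odot>\<^bsub>F\<^esub> delta R u \<oplus>\<^bsub>F\<^esub> g"
          using coeff_closed[OF f(1)] by (auto simp: F_simps delta_def g_def fun_eq_iff)
        moreover have "P (f u \<odot>\<^bsub>F\<^esub> delta R u \<oplus>\<^bsub>F\<^esub> g)"
          using g Pg u coeff_closed[OF f(1)] by (intro add smult delta F_smult_closed delta_closed) auto
        ultimately show ?thesis by simp
      next
        case False
        then have "f = g" by (auto simp: g_def supp_zeroD coeff_closed)
        with Pg show ?thesis by simp
      qed
    qed
  qed
  then show ?thesis using assms(1) supp_finite by blast
qed

lemma F_assoc:
  assumes f: "f \<in> carrier F" and g: "g \<in> carrier F" and h: "h \<in> carrier F"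
  shows "(f \<otimes>\<^bsub>F\<^esub> g) \<otimes>\<^bsub>F\<^esub> h = f \<otimes>\<^bsub>F\<^esub> (g \<otimes>\<^bsub>F\<^esub> h)"
proof -
  note cl = F_mult_closed F_add_closed F_smult_closed delta_closed
  note bil = F_l_distr F_r_distr F_smult_mult
  have 1: "(delta R u \<otimes>\<^bsub>F\<^esub> delta R v) \<otimes>\<^bsub>F\<^esub> h = delta R u \<otimes>\<^bsub>F\<^esub> (delta R v \<otimes>\<^bsub>F\<^esub> h)"
    if "u \<in> carrier M" "v \<in> carrier M" for u v
    using h that
    by (induction h rule: monoid_alg_induct)
       (simp_all add: cl bil F_mult_zero delta_mult semigroup_closed semigroup_assoc)
  have 2: "(delta R u \<otimes>\<^bsub>F\<^esub> g) \<otimes>\<^bsub>F\<^esub> h = delta R u \<otimes>\<^bsub>F\<^esub> (g \<otimes>\<^bsub>F\<^esub> h)" if "u \<in> carrier M" for u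
    using g that h by (induction g rule: monoid_alg_induct) (simp_all add: cl bil F_mult_zero 1)
  show ?thesis
    using f g h by (induction f rule: monoid_alg_induct) (simp_all add: cl bil F_mult_zero 2)
qed

lemma monoid_alg_assoc_algebra: "assoc_algebra R F"
  by (intro assoc_algebra.intro assoc_algebra_axioms.intro F_module F_mult_closed F_assoc
      F_l_distr F_r_distr F_smult_mult)

end

sublocale semigroup_algebra \<subseteq> FA: assoc_algebra R F
  by (rule monoid_alg_assoc_algebra)

definition linear_extension ::
  "('c, 'r) ring_scheme \<Rightarrow> ('c, 'b, 'n) module_scheme \<Rightarrow> ('m \<Rightarrow> 'b) \<Rightarrow> ('m \<Rightarrow> 'c) \<Rightarrow> 'b" where
  "linear_extension R X g f = (\<Oplus>\<^bsub>X\<^esub>w \<in> supp R f. f w \<odot>\<^bsub>X\<^esub> g w)"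

context semigroup_algebra begin

lemma linear_extension_superset:
  assumes "module R X" "g \<in> carrier M \<rightarrow> carrier X" "f \<in> carrier F"
    and "finite W" "supp R f \<subseteq> W" "W \<subseteq> carrier M"
  shows "linear_extension R X g f = (\<Oplus>\<^bsub>X\<^esub>w \<in> W. f w \<odot>\<^bsub>X\<^esub> g w)"
proof -
  interpret X: module R X by fact
  have "f w \<odot>\<^bsub>X\<^esub> g w \<in> carrier X" if "w \<in> W" for w
    using that assms(2,6) coeff_closed[OF assms(3)] by (auto intro!: X.smult_closed)
  then show ?thesis unfolding linear_extension_def
    by (intro X.add.finprod_mono_neutral_cong_left) (use assms in \<open>auto simp: Pi_iff supp_zeroD subset_iff\<close>)
qed

lemma linear_extension_linear:
  assumes "module R X" and g: "g \<in> carrier M \<rightarrow> carrier X"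
  shows "linear_map R F X (linear_extension R X g)"
proof -
  interpret X: module R X by fact
  note gc = Pi_mem[OF g]
  show ?thesis
  proof unfold_locales
    fix f assume f: "f \<in> carrier F"
    note [simp] = coeff_closed[OF f]
    show "linear_extension R X g f \<in> carrier X"
      unfolding linear_extension_def using f supp_carrier[OF f] by (auto intro!: X.finsum_closed gc)
    fix c assume c: "c \<in> carrier R"
    have "linear_extension R X g (c \<odot>\<^bsub>F\<^esub> f) = (\<Oplus>\<^bsub>X\<^esub>w\<in>supp R f. (c \<odot>\<^bsub>F\<^esub> f) w \<odot>\<^bsub>X\<^esub> g w)"
      by (rule linear_extension_superset[OF assms])
         (use c f F_smult_closed supp_finite supp_carrier in \<open>auto simp: supp_def F_simps\<close>)
    also have "\<dots> = (\<Oplus>\<^bsub>X\<^esub>w\<in>supp R f. c \<odot>\<^bsub>X\<^esub> (f w \<odot>\<^bsub>X\<^esub> g w))"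
      by (rule X.finsum_cong')
         (use c f supp_carrier[OF f] gc in \<open>auto simp: F_simps X.smult_assoc1 subset_iff\<close>)
    also have "\<dots> = c \<odot>\<^bsub>X\<^esub> linear_extension R X g f"
      unfolding linear_extension_def
      by (rule X.finsum_smult_ldistr[symmetric])
         (use c f supp_carrier[OF f] gc supp_finite in \<open>auto simp: subset_iff\<close>)
    finally show "linear_extension R X g (c \<odot>\<^bsub>F\<^esub> f) = c \<odot>\<^bsub>X\<^esub> linear_extension R X g f" .
  next
    fix f f' assume f: "f \<in> carrier F" and f': "f' \<in> carrier F"
    note [simp] = coeff_closed[OF f] coeff_closed[OF f']
    let ?W = "supp R f \<union> supp R f'"
    have W: "finite ?W" "?W \<subseteq> carrier M" using f f' supp_finite supp_carrier by auto
    have "linear_extension R X g (f \<oplus>\<^bsub>F\<^esub> f') = (\<Oplus>\<^bsub>X\<^esub>w\<in>?W. (f \<oplus>\<^bsub>F\<^esub> f') w \<odot>\<^bsub>X\<^esub> g w)"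
      by (rule linear_extension_superset[OF assms])
         (use W f f' F_add_closed in \<open>auto simp: supp_def F_simps\<close>)
    also have "\<dots> = (\<Oplus>\<^bsub>X\<^esub>w\<in>?W. f w \<odot>\<^bsub>X\<^esub> g w \<oplus>\<^bsub>X\<^esub> f' w \<odot>\<^bsub>X\<^esub> g w)"
      by (rule X.finsum_cong') (use f f' W gc in \<open>auto simp: F_simps X.smult_l_distr subset_iff\<close>)
    also have "\<dots> = (\<Oplus>\<^bsub>X\<^esub>w\<in>?W. f w \<odot>\<^bsub>X\<^esub> g w) \<oplus>\<^bsub>X\<^esub> (\<Oplus>\<^bsub>X\<^esub>w\<in>?W. f' w \<odot>\<^bsub>X\<^esub> g w)"
      by (rule X.finsum_addf) (use f f' W gc in \<open>auto simp: subset_iff\<close>)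
    also have "\<dots> = linear_extension R X g f \<oplus>\<^bsub>X\<^esub> linear_extension R X g f'"
      using linear_extension_superset[OF assms f W(1) _ W(2)]
        linear_extension_superset[OF assms f' W(1) _ W(2)] by simp
    finally show "linear_extension R X g (f \<oplus>\<^bsub>F\<^esub> f') =
      linear_extension R X g f \<oplus>\<^bsub>X\<^esub> linear_extension R X g f'" .
  qed
qed

lemma linear_extension_delta:
  assumes "module R X" and g: "g \<in> carrier M \<rightarrow> carrier X" and u: "u \<in> carrier M"
  shows "linear_extension R X g (delta R u) = g u"
proof -
  interpret X: module R X by fact
  have "linear_extension R X g (delta R u) = (\<Oplus>\<^bsub>X\<^esub>w\<in>{u}. delta R u w \<odot>\<^bsub>X\<^esub> g w)"
    by (rule linear_extension_superset)
       (use assms delta_closed in \<open>auto simp: supp_def delta_def split: if_splits\<close>)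
  also have "\<dots> = g u" using Pi_mem[OF g u] by (simp add: delta_def)
  finally show ?thesis .
qed

text \<open>
  The universal property of \<open>R[M]\<close>. Both sides of the multiplicativity claim are bilinear, and on \<open>M\<close>
  they agree by assumption.
\<close>

lemma linear_extension_algebra_map:
  assumes "assoc_algebra R X" and g: "g \<in> carrier M \<rightarrow> carrier X"
    and mult: "\<And>u v. \<lbrakk>u \<in> carrier M; v \<in> carrier M\<rbrakk> \<Longrightarrow> g (u \<otimes>\<^bsub>M\<^esub> v) = g u \<otimes>\<^bsub>X\<^esub> g v"
  shows "algebra_map R F X (linear_extension R X g)"
proof -
  interpret X: assoc_algebra R X by fact
  interpret L: linear_map R F X "linear_extension R X g"
    by (rule linear_extension_linear[OF X.module_axioms g])
  let ?L = "linear_extension R X g"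
  note simps = X.mult_zero F_mult_zero L.map_zero L.map_add L.map_smult L.map_closed
    F_mult_closed F_add_closed F_smult_closed F_l_distr F_r_distr F_smult_mult
    X.l_distr X.r_distr X.smult_mult_l X.smult_mult_r X.m_closed delta_closed
  have 1: "?L (delta R u \<otimes>\<^bsub>F\<^esub> f) = ?L (delta R u) \<otimes>\<^bsub>X\<^esub> ?L f" if "u \<in> carrier M" "f \<in> carrier F" for u f
    using that(2,1)
  proof (induction f rule: monoid_alg_induct)
    case (delta w)
    then show ?case
      by (simp add: delta_mult linear_extension_delta[OF X.module_axioms g] semigroup_closed mult)
  qed (simp_all add: simps)
  have "?L (f \<otimes>\<^bsub>F\<^esub> h) = ?L f \<otimes>\<^bsub>X\<^esub> ?L h" if "f \<in> carrier F" "h \<in> carrier F" for f h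
    using that by (induction f rule: monoid_alg_induct) (simp_all add: simps 1)
  then show ?thesis by unfold_locales
qed

end


section \<open>Quotients by two-sided ideals\<close>

text \<open>
  In an algebra without unit an ideal need not be closed under scalars, so this is demanded. The
  tensor product of two algebras is a quotient of this kind.
\<close>

locale algebra_ideal = assoc_algebra R B
  for R :: "('c, 'r) ring_scheme" and B :: "('c, 'b, 'm) module_scheme" (structure) +
  fixes I :: "'b set"
  assumes ideal_submodule: "submodule I R B"
    and ideal_l: "\<lbrakk>x \<in> carrier B; i \<in> I\<rbrakk> \<Longrightarrow> x \<otimes> i \<in> I"
    and ideal_r: "\<lbrakk>x \<in> carrier B; i \<in> I\<rbrakk> \<Longrightarrow> i \<otimes> x \<in> I"
begin

abbreviation Q where "Q \<equiv> quot_alg B I"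
abbreviation cls where "cls x \<equiv> I +>\<^bsub>B\<^esub> x"

lemma ideal_subgroup: "abelian_subgroup I B"
  by (intro abelian_subgroupI3 additive_subgroup.intro submodule.axioms(1)[OF ideal_submodule]
      M.abelian_group_axioms)

lemma cls_eqI:
  assumes "x \<in> carrier B" "y \<in> cls x" shows "cls y = cls x"
  using M.a_repr_independence[OF assms(2,1) submodule.axioms(1)[OF ideal_submodule]] by simp

lemma cls_eq_iff:
  assumes "x \<in> carrier B" "y \<in> carrier B"
  shows "cls x = cls y \<longleftrightarrow> x \<ominus> y \<in> I"
proof -
  interpret I: abelian_subgroup I B by (rule ideal_subgroup)
  show ?thesis
    using I.a_rcos_module[OF assms(2,1)] cls_eqI[OF assms(2), of x] I.a_rcos_self[OF assms(1)]
    by (auto simp: a_minus_def)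
qed

lemma cls_memD:
  assumes "x \<in> carrier B" "y \<in> cls x" shows "y \<in> carrier B" "cls y = cls x"
  using cls_eqI[OF assms] abelian_subgroup.a_elemrcos_carrier[OF ideal_subgroup assms] by auto

lemma cls_self: "x \<in> carrier B \<Longrightarrow> x \<in> cls x"
  using abelian_subgroup.a_rcos_self[OF ideal_subgroup] by blast

text \<open>
  Products and scalar multiples of cosets are unions over representatives in which every
  representative contributes the same coset.
\<close>

lemma cls_Union:
  assumes x: "x \<in> carrier B"
    and "\<And>y. \<lbrakk>y \<in> carrier B; cls y = cls x\<rbrakk> \<Longrightarrow> g y = z"
  shows "(\<Union>y\<in>cls x. g y) = z"
  using assms cls_memD[OF x] cls_self[OF x] by blast

lemma quot_simps:
  "carrier Q = (\<lambda>x. cls x) ` carrier B" "\<zero>\<^bsub>Q\<^esub> = I" "\<one>\<^bsub>Q\<^esub> = cls \<one>"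
  "X \<oplus>\<^bsub>Q\<^esub> Y = X <+>\<^bsub>B\<^esub> Y" "X \<otimes>\<^bsub>Q\<^esub> Y = rcoset_mult B I X Y"
  "c \<odot>\<^bsub>Q\<^esub> X = (\<Union>x\<in>X. cls (c \<odot> x))"
  by (auto simp: quot_alg_def ring.defs module.defs FactRing_def A_RCOSETS_def'
      a_r_coset_def RCOSETS_def)

lemma cls_closed: "x \<in> carrier B \<Longrightarrow> cls x \<in> carrier Q"
  by (simp add: quot_simps)

lemma cls_add: "\<lbrakk>x \<in> carrier B; y \<in> carrier B\<rbrakk> \<Longrightarrow> cls x \<oplus>\<^bsub>Q\<^esub> cls y = cls (x \<oplus> y)"
  using abelian_subgroup.a_rcos_sum[OF ideal_subgroup] by (simp add: quot_simps)

lemma cls_zero: "cls \<zero> = \<zero>\<^bsub>Q\<^esub>"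
  using abelian_subgroup.a_rcos_const[OF ideal_subgroup]
    subgroup.one_closed[OF submodule.axioms(1)[OF ideal_submodule]] by (simp add: quot_simps)

lemma cls_mult:
  assumes x: "x \<in> carrier B" and y: "y \<in> carrier B"
  shows "cls x \<otimes>\<^bsub>Q\<^esub> cls y = cls (x \<otimes> y)"
  unfolding quot_simps rcoset_mult_def
proof (rule cls_Union[OF x], rule cls_Union[OF y])
  fix a b assume a: "a \<in> carrier B" "cls a = cls x" and b: "b \<in> carrier B" "cls b = cls y"
  \<comment> \<open>This element is \<open>a b - x y\<close>.\<close>
  have "(a \<ominus> x) \<otimes> b \<oplus> x \<otimes> (b \<ominus> y) \<in> I"
    using a b x y by (intro submoduleE(5)[OF ideal_submodule] ideal_l ideal_r) (auto simp: cls_eq_iff)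
  moreover have "(a \<ominus> x) \<otimes> b = a \<otimes> b \<ominus> x \<otimes> b"
  proof -
    have "(a \<ominus> x) \<otimes> b \<oplus> x \<otimes> b = a \<otimes> b"
      using a b x by (simp add: l_distr[symmetric] a_minus_def M.a_assoc M.l_neg)
    then show ?thesis using a b x m_closed
      by (metis M.add.inv_solve_right M.minus_closed a_minus_def)
  qed
  moreover have "x \<otimes> (b \<ominus> y) = x \<otimes> b \<ominus> x \<otimes> y"
  proof -
    have "x \<otimes> (b \<ominus> y) \<oplus> x \<otimes> y = x \<otimes> b"
      using y b x by (simp add: r_distr[symmetric] a_minus_def M.a_assoc M.l_neg)
    then show ?thesis using y b x m_closed
      by (metis M.add.inv_solve_right M.minus_closed a_minus_def)
  qed
  moreover have "(a \<otimes> b \<ominus> x \<otimes> b) \<oplus> (x \<otimes> b \<ominus> x \<otimes> y) = a \<otimes> b \<ominus> x \<otimes> y"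
    using a b x y m_closed by (simp add: a_minus_def M.a_assoc M.r_neg2 M.r_neg1)
  ultimately show "cls (a \<otimes> b) = cls (x \<otimes> y)"
    using a b x y by (simp add: cls_eq_iff m_closed)
qed

lemma cls_smult:
  assumes c: "c \<in> carrier R" and x: "x \<in> carrier B"
  shows "c \<odot>\<^bsub>Q\<^esub> cls x = cls (c \<odot> x)"
  unfolding quot_simps
proof (rule cls_Union[OF x])
  fix a assume a: "a \<in> carrier B" "cls a = cls x"
  then have "c \<odot> (a \<ominus> x) \<in> I"
    using x c by (intro submoduleE(4)[OF ideal_submodule]) (auto simp: cls_eq_iff)
  also have "c \<odot> (a \<ominus> x) = c \<odot> a \<ominus> c \<odot> x"
    using a x c by (simp add: a_minus_def smult_r_distr smult_r_minus)
  finally show "cls (c \<odot> a) = cls (c \<odot> x)" using a c x by (simp add: cls_eq_iff)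
qed

lemma cls_cases:
  assumes "X \<in> carrier Q" obtains x where "x \<in> carrier B" "X = cls x"
  using assms by (auto simp: quot_simps)

lemma quot_assoc_algebra: "assoc_algebra R Q"
proof -
  note cls_simps = cls_closed cls_add cls_zero[symmetric] cls_mult cls_smult m_closed
  have "abelian_group Q"
  proof (rule abelian_groupI)
    fix X assume "X \<in> carrier Q"
    then obtain x where x: "x \<in> carrier B" "X = cls x" by (rule cls_cases)
    then have "cls (\<ominus> x) \<oplus>\<^bsub>Q\<^esub> X = \<zero>\<^bsub>Q\<^esub>" by (simp add: cls_simps M.l_neg)
    with x show "\<exists>Y\<in>carrier Q. Y \<oplus>\<^bsub>Q\<^esub> X = \<zero>\<^bsub>Q\<^esub>" using cls_closed[of "\<ominus> x"] by auto
  qed (auto elim!: cls_cases simp: cls_simps M.a_ac)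
  then have "module R Q"
    by (intro moduleI R.is_cring)
       (auto elim!: cls_cases simp: cls_simps smult_l_distr smult_r_distr smult_assoc1)
  then show ?thesis
    by (intro assoc_algebra.intro assoc_algebra_axioms.intro)
       (auto elim!: cls_cases simp: cls_simps m_assoc l_distr r_distr smult_mult_l smult_mult_r)
qed

lemma cls_algebra_map: "algebra_map R B Q (\<lambda>x. cls x)"
proof -
  interpret Q: assoc_algebra R Q by (rule quot_assoc_algebra)
  show ?thesis by unfold_locales (simp_all add: cls_closed cls_add cls_mult cls_smult)
qed

lemma cls_eq_zero_iff: "x \<in> carrier B \<Longrightarrow> cls x = \<zero>\<^bsub>Q\<^esub> \<longleftrightarrow> x \<in> I"
  using cls_eq_iff[of x \<zero>] M.minus_equality[of \<zero> \<zero>] by (simp add: cls_zero a_minus_def)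

end

text \<open>
  The map induced by \<open>T\<close> on cosets, meaningful if \<open>T\<close> is constant on each of them.
\<close>

definition quot_map :: "('b \<Rightarrow> 'x) \<Rightarrow> 'b set \<Rightarrow> 'x" where
  "quot_map T Y = T (SOME y. y \<in> Y)"

context algebra_ideal begin

lemma quot_map_cls:
  assumes "linear_map R B X T" "\<And>i. i \<in> I \<Longrightarrow> T i = \<zero>\<^bsub>X\<^esub>" and x: "x \<in> carrier B"
  shows "quot_map T (cls x) = T x"
proof -
  interpret T: linear_map R B X T by fact
  define y where "y = (SOME y. y \<in> cls x)"
  have "y \<in> cls x" unfolding y_def using cls_self[OF x] by (rule someI)
  then have y: "y \<in> carrier B" "y \<ominus> x \<in> I" 
    using x cls_memD[OF x] cls_eq_iff[of y x] by auto
  then have "T y \<ominus>\<^bsub>X\<^esub> T x = \<zero>\<^bsub>X\<^esub>" using x assms(2)[OF y(2)] by (simp add: T.map_diff)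
  then have "T y = T x" 
    using x y T.map_closed T.cod.minus_equality[of "T y" "\<ominus>\<^bsub>X\<^esub> T x"] by (simp add: a_minus_def)
  then show ?thesis by (simp add: quot_map_def y_def)
qed

lemma quot_map_linear:
  assumes "linear_map R B X T" "\<And>i. i \<in> I \<Longrightarrow> T i = \<zero>\<^bsub>X\<^esub>"
  shows "linear_map R Q X (quot_map T)"
proof -
  interpret T: linear_map R B X T by fact
  interpret Q: assoc_algebra R Q by (rule quot_assoc_algebra)
  show ?thesis
    by unfold_locales
       (auto elim!: cls_cases simp: cls_add cls_smult quot_map_cls[OF assms] T.map_add T.map_smult T.map_closed)
qed

lemma quot_map_algebra_map:
  assumes "algebra_map R B X T" "\<And>i. i \<in> I \<Longrightarrow> T i = \<zero>\<^bsub>X\<^esub>"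
  shows "algebra_map R Q X (quot_map T)"
proof -
  interpret T: algebra_map R B X T by fact
  interpret L: linear_map R Q X "quot_map T" by (rule quot_map_linear[OF T.linear_map_axioms assms(2)])
  show ?thesis
    by unfold_locales
       (auto elim!: cls_cases simp: cls_mult quot_map_cls[OF T.linear_map_axioms assms(2)] T.map_mult m_closed)
qed

end

section \<open>Unital algebras\<close>

locale unital_algebra = assoc_algebra R A
  for R :: "('c, 'r) ring_scheme" and A :: "('c, 'a, 'm) module_scheme" (structure) +
  assumes unit_closed: "\<one> \<in> carrier A"
    and unit_l: "x \<in> carrier A \<Longrightarrow> \<one> \<otimes> x = x"
    and unit_r: "x \<in> carrier A \<Longrightarrow> x \<otimes> \<one> = x"
begin

lemma is_ring: "ring A"
  by (intro ringI monoidI M.abelian_group_axioms)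
     (simp_all add: unit_closed unit_l unit_r m_closed m_assoc l_distr r_distr)

lemma smult_eq_mult:
  assumes "c \<in> carrier R" "x \<in> carrier A"
  shows "c \<odot> x = (c \<odot> \<one>) \<otimes> x"
  using assms by (simp add: smult_mult_l unit_closed unit_l)

lemma ideal_is_algebra_ideal:
  assumes "ideal I A" shows "algebra_ideal R A I"
proof -
  interpret ideal I A by fact
  have "submodule I R A"
  proof (rule submoduleI)
    show "c \<odot> x \<in> I" if "c \<in> carrier R" "x \<in> I" for c x
      using that I_l_closed[of x "c \<odot> \<one>"] a_Hcarr[of x] smult_eq_mult[of c x]
      by (simp add: unit_closed)
  qed (use a_subset in auto)
  then show ?thesis
    by (intro algebra_ideal.intro algebra_ideal_axioms.intro assoc_algebra_axioms)
       (auto intro: I_l_closed I_r_closed)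
qed

lemma quot_unital_algebra:
  assumes "ideal I A" shows "unital_algebra R (quot_alg A I)"
proof -
  interpret algebra_ideal R A I by (rule ideal_is_algebra_ideal) fact
  interpret Q: assoc_algebra R Q by (rule quot_assoc_algebra)
  show ?thesis
    by unfold_locales (auto elim!: cls_cases simp: quot_simps(3) cls_closed cls_mult unit_closed unit_l unit_r)
qed

end

locale unital_map = algebra_map R A B h
  for R :: "('c, 'r) ring_scheme" and A :: "('c, 'a, 'm) module_scheme"
    and B :: "('c, 'b, 'n) module_scheme" and h :: "'a \<Rightarrow> 'b" +
  assumes map_one: "h \<one>\<^bsub>A\<^esub> = \<one>\<^bsub>B\<^esub>"
begin

lemma kernel_ideal:
  assumes "unital_algebra R A" "unital_algebra R B"
  shows "ideal {x \<in> carrier A. h x = \<zero>\<^bsub>B\<^esub>} A"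
proof -
  interpret A: unital_algebra R A by fact
  interpret B: unital_algebra R B by fact
  interpret RB: ring B by (rule B.is_ring)
  show ?thesis
    by (intro idealI A.is_ring submodule.axioms(1)[OF kernel_submodule])
       (auto simp: map_mult map_closed A.m_closed)
qed

lemma genideal_in_kernel:
  assumes "unital_algebra R A" "unital_algebra R B" "X \<subseteq> carrier A" "\<And>x. x \<in> X \<Longrightarrow> h x = \<zero>\<^bsub>B\<^esub>"
    and "i \<in> Idl\<^bsub>A\<^esub> X"
  shows "h i = \<zero>\<^bsub>B\<^esub>"
proof -
  interpret ring A using assms(1) by (rule unital_algebra.is_ring)
  have "Idl\<^bsub>A\<^esub> X \<subseteq> {x \<in> carrier A. h x = \<zero>\<^bsub>B\<^esub>}"
    using assms(3,4) by (intro genideal_minimal kernel_ideal[OF assms(1,2)]) auto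
  then show ?thesis using assms(5) by auto
qed

text \<open>
  The universal property of a presentation: a homomorphism that respects the relations \<open>X\<close> factors
  through the quotient by the ideal that they generate.
\<close>

lemma quot_genideal_map:
  assumes "unital_algebra R A" "unital_algebra R B" "X \<subseteq> carrier A" "\<And>x. x \<in> X \<Longrightarrow> h x = \<zero>\<^bsub>B\<^esub>"
  shows "unital_map R (quot_alg A (Idl\<^bsub>A\<^esub> X)) B (quot_map h)"
    and "x \<in> carrier A \<Longrightarrow> quot_map h (Idl\<^bsub>A\<^esub> X +>\<^bsub>A\<^esub> x) = h x"
proof -
  interpret A: unital_algebra R A by fact
  interpret ring A by (rule A.is_ring)
  interpret J: algebra_ideal R A "Idl\<^bsub>A\<^esub> X"
    by (intro A.ideal_is_algebra_ideal genideal_ideal assms)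
  note ker = genideal_in_kernel[OF assms]
  show *: "quot_map h (Idl\<^bsub>A\<^esub> X +>\<^bsub>A\<^esub> x) = h x" if "x \<in> carrier A" for x
    using that by (intro J.quot_map_cls[OF linear_map_axioms] ker)
  interpret Qm: algebra_map R "quot_alg A (Idl\<^bsub>A\<^esub> X)" B "quot_map h"
    by (intro J.quot_map_algebra_map[OF algebra_map_axioms] ker)
  show "unital_map R (quot_alg A (Idl\<^bsub>A\<^esub> X)) B (quot_map h)"
    by unfold_locales (simp add: J.quot_simps(3) * map_one)
qed

end

section \<open>Change of scalars\<close>

definition rescale :: "('d, 'b, 'm) module_scheme \<Rightarrow> ('c \<Rightarrow> 'b \<Rightarrow> 'b) \<Rightarrow> ('c, 'b) module" where
  "rescale B s = ring.extend (ring.truncate B) (module.fields s)"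

lemma rescale_simps [simp]:
  "carrier (rescale B s) = carrier B" "monoid.mult (rescale B s) = monoid.mult B"
  "one (rescale B s) = one B" "zero (rescale B s) = zero B" "add (rescale B s) = add B"
  "c \<odot>\<^bsub>rescale B s\<^esub> x = s c x"
  by (simp_all add: rescale_def ring.defs module.defs)

text \<open>
  A ring homomorphism \<open>\<psi>\<close> from \<open>R\<close> to the centre of \<open>B\<close> makes \<open>B\<close> an \<open>R\<close>-algebra. This is used twice:
  to view the Grassmann algebra over \<open>C[\<epsilon>]\<close> as an algebra over \<open>C\<close>, and to view an algebra over \<open>C\<close>
  as one over \<open>C[\<epsilon>]\<close> after values for \<open>\<theta>\<close> and the \<open>\<epsilon>\<^sub>i\<close> have been chosen.
\<close>

lemma rescale_unital_algebra:
  assumes "cring R" "ring B" "\<psi> \<in> ring_hom R B"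
    and central: "\<And>c x. \<lbrakk>c \<in> carrier R; x \<in> carrier B\<rbrakk> \<Longrightarrow> \<psi> c \<otimes>\<^bsub>B\<^esub> x = x \<otimes>\<^bsub>B\<^esub> \<psi> c"
    and s: "\<And>c x. \<lbrakk>c \<in> carrier R; x \<in> carrier B\<rbrakk> \<Longrightarrow> s c x = \<psi> c \<otimes>\<^bsub>B\<^esub> x"
  shows "unital_algebra R (rescale B s)"
proof -
  interpret R: cring R by fact
  interpret B: ring B by fact
  note psi = ring_hom_closed[OF assms(3)] ring_hom_mult[OF assms(3)] ring_hom_add[OF assms(3)]
    ring_hom_one[OF assms(3)]
  have "abelian_group (rescale B s)"
  proof (rule abelian_groupI)
    fix x assume x: "x \<in> carrier (rescale B s)"
    then show "\<exists>y\<in>carrier (rescale B s). y \<oplus>\<^bsub>rescale B s\<^esub> x = \<zero>\<^bsub>rescale B s\<^esub>"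
      by (intro bexI[of _ "\<ominus>\<^bsub>B\<^esub> x"]) (auto simp: B.l_neg)
  qed (auto simp: B.a_ac)
  then have "module R (rescale B s)"
    by (intro moduleI assms(1)) (auto simp: s psi B.l_distr B.r_distr B.m_assoc)
  moreover have "x \<otimes>\<^bsub>B\<^esub> (\<psi> c \<otimes>\<^bsub>B\<^esub> y) = \<psi> c \<otimes>\<^bsub>B\<^esub> (x \<otimes>\<^bsub>B\<^esub> y)"
    if "c \<in> carrier R" "x \<in> carrier B" "y \<in> carrier B" for c x y
    using that by (metis B.m_assoc central psi(1))
  ultimately show ?thesis
    by (intro unital_algebra.intro unital_algebra_axioms.intro assoc_algebra.intro
        assoc_algebra_axioms.intro)
       (auto simp: s psi B.l_distr B.r_distr B.m_assoc)
qed

lemma (in unital_algebra) unit_smult_ring_hom: "(\<lambda>c. c \<odot> \<one>) \<in> ring_hom R A"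
  by (rule ring_hom_memI)
     (auto simp: unit_closed smult_l_distr smult_assoc1 smult_mult_l unit_l)

lemma (in unital_algebra) unit_smult_central:
  assumes "c \<in> carrier R" "x \<in> carrier A"
  shows "(c \<odot> \<one>) \<otimes> x = x \<otimes> (c \<odot> \<one>)"
  using assms by (simp add: smult_mult_l smult_mult_r unit_closed unit_l unit_r)


section \<open>Tensor products are functorial\<close>

context module begin

lemma submodule_generated_minimal:
  assumes "submodule N R M" "X \<subseteq> N" shows "submodule_generated R M X \<subseteq> N"
  using assms by (auto simp: submodule_generated_def)

lemma submodule_generated_superset: "X \<subseteq> submodule_generated R M X"
  by (auto simp: submodule_generated_def)

lemma submodule_generated_submodule:
  assumes "X \<subseteq> carrier M" shows "submodule (submodule_generated R M X) R M"
proof (rule submoduleI)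
  show "submodule_generated R M X \<subseteq> carrier M"
    using assms carrier_is_submodule by (intro submodule_generated_minimal)
  have "\<zero>\<^bsub>M\<^esub> \<in> N" if "submodule N R M" for N
    using subgroup.one_closed[OF submodule.axioms(1)[OF that]] by simp
  then show "\<zero>\<^bsub>M\<^esub> \<in> submodule_generated R M X" by (auto simp: submodule_generated_def)
qed (auto simp: submodule_generated_def submoduleE)

end

text \<open>
  The pure tensor \<open>a \<otimes> b\<close>.
\<close>

definition tens where
  "tens R A B a b =
     submodule_generated R (monoid_alg R (A \<times>\<times> B)) (tensor_relations R A B)
       +>\<^bsub>monoid_alg R (A \<times>\<times> B)\<^esub> delta R (a, b)"

locale tensor_product = A: assoc_algebra R A + B: assoc_algebra R B
  for R :: "('c, 'r) ring_scheme" and A :: "('c, 'a, 'm) module_scheme"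
    and B :: "('c, 'b, 'n) module_scheme"

sublocale tensor_product \<subseteq> semigroup_algebra R "A \<times>\<times> B"
  by unfold_locales (auto simp: A.m_closed B.m_closed A.m_assoc B.m_assoc)

context tensor_product begin

abbreviation d where "d \<equiv> delta R"
abbreviation N where "N \<equiv> submodule_generated R F (tensor_relations R A B)"

lemma d_closed: "\<lbrakk>a \<in> carrier A; b \<in> carrier B\<rbrakk> \<Longrightarrow> d (a, b) \<in> carrier F"
  by (simp add: delta_closed)

lemma d_mult:
  "\<lbrakk>a \<in> carrier A; b \<in> carrier B; a' \<in> carrier A; b' \<in> carrier B\<rbrakk>
    \<Longrightarrow> d (a, b) \<otimes>\<^bsub>F\<^esub> d (a', b') = d (a \<otimes>\<^bsub>A\<^esub> a', b \<otimes>\<^bsub>B\<^esub> b')"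
  by (simp add: delta_mult)

lemma tensor_relation_cases [consumes 1, case_names add_l add_r smult_l smult_r]:
  assumes "r \<in> tensor_relations R A B"
  obtains x x' y where "x \<in> carrier A" "x' \<in> carrier A" "y \<in> carrier B"
      "r = d (x \<oplus>\<^bsub>A\<^esub> x', y) \<ominus>\<^bsub>F\<^esub> (d (x, y) \<oplus>\<^bsub>F\<^esub> d (x', y))"
    | x y y' where "x \<in> carrier A" "y \<in> carrier B" "y' \<in> carrier B"
      "r = d (x, y \<oplus>\<^bsub>B\<^esub> y') \<ominus>\<^bsub>F\<^esub> (d (x, y) \<oplus>\<^bsub>F\<^esub> d (x, y'))"
    | c x y where "c \<in> carrier R" "x \<in> carrier A" "y \<in> carrier B"
      "r = d (c \<odot>\<^bsub>A\<^esub> x, y) \<ominus>\<^bsub>F\<^esub> c \<odot>\<^bsub>F\<^esub> d (x, y)"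
    | c x y where "c \<in> carrier R" "x \<in> carrier A" "y \<in> carrier B"
      "r = d (x, c \<odot>\<^bsub>B\<^esub> y) \<ominus>\<^bsub>F\<^esub> c \<odot>\<^bsub>F\<^esub> d (x, y)"
  using assms unfolding tensor_relations_def Let_def
  by (elim UnE CollectE exE conjE)
     (erule that(1) that(2) that(3) that(4); assumption)+

lemma tensor_relationI:
  "\<lbrakk>x \<in> carrier A; x' \<in> carrier A; y \<in> carrier B\<rbrakk> \<Longrightarrow>
      d (x \<oplus>\<^bsub>A\<^esub> x', y) \<ominus>\<^bsub>F\<^esub> (d (x, y) \<oplus>\<^bsub>F\<^esub> d (x', y)) \<in> tensor_relations R A B"
  "\<lbrakk>x \<in> carrier A; y \<in> carrier B; y' \<in> carrier B\<rbrakk> \<Longrightarrow>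
      d (x, y \<oplus>\<^bsub>B\<^esub> y') \<ominus>\<^bsub>F\<^esub> (d (x, y) \<oplus>\<^bsub>F\<^esub> d (x, y')) \<in> tensor_relations R A B"
  "\<lbrakk>c \<in> carrier R; x \<in> carrier A; y \<in> carrier B\<rbrakk> \<Longrightarrow>
      d (c \<odot>\<^bsub>A\<^esub> x, y) \<ominus>\<^bsub>F\<^esub> c \<odot>\<^bsub>F\<^esub> d (x, y) \<in> tensor_relations R A B"
  "\<lbrakk>c \<in> carrier R; x \<in> carrier A; y \<in> carrier B\<rbrakk> \<Longrightarrow>
      d (x, c \<odot>\<^bsub>B\<^esub> y) \<ominus>\<^bsub>F\<^esub> c \<odot>\<^bsub>F\<^esub> d (x, y) \<in> tensor_relations R A B"
  unfolding tensor_relations_def Let_def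
  subgoal by (intro UnI1 CollectI exI[of _ x] exI[of _ x'] exI[of _ y] conjI refl)
  subgoal by (rule UnI1, rule UnI1, rule UnI2)
    (intro CollectI exI[of _ x] exI[of _ y] exI[of _ y'] conjI refl)
  subgoal by (rule UnI1, rule UnI2)
    (intro CollectI exI[of _ c] exI[of _ x] exI[of _ y] conjI refl)
  subgoal by (rule UnI2) (intro CollectI exI[of _ c] exI[of _ x] exI[of _ y] conjI refl)
  done

lemma tensor_relations_carrier: "tensor_relations R A B \<subseteq> carrier F"
proof
  fix r assume "r \<in> tensor_relations R A B"
  then show "r \<in> carrier F"
    by (cases rule: tensor_relation_cases) (auto intro!: FA.M.minus_closed d_closed)
qed

lemma N_submodule: "submodule N R F"
  by (rule FA.submodule_generated_submodule[OF tensor_relations_carrier])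

text \<open>
  Multiplication by a basis element is linear and maps bilinearity relations to bilinearity
  relations, so it preserves the submodule that they generate.
\<close>

lemma N_absorbs_d:
  assumes a: "a \<in> carrier A" and b: "b \<in> carrier B" and i: "i \<in> N"
  shows "d (a, b) \<otimes>\<^bsub>F\<^esub> i \<in> N" "i \<otimes>\<^bsub>F\<^esub> d (a, b) \<in> N"
proof -
  note rel = subsetD[OF FA.submodule_generated_superset tensor_relationI(1)]
    subsetD[OF FA.submodule_generated_superset tensor_relationI(2)]
    subsetD[OF FA.submodule_generated_superset tensor_relationI(3)]
    subsetD[OF FA.submodule_generated_superset tensor_relationI(4)]
  have dab: "d (a, b) \<in> carrier F" using a b by (rule d_closed)
  interpret L: linear_map R F F "\<lambda>r. d (a, b) \<otimes>\<^bsub>F\<^esub> r"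
    by unfold_locales (simp_all add: dab F_mult_closed F_r_distr F_smult_mult)
  interpret R: linear_map R F F "\<lambda>r. r \<otimes>\<^bsub>F\<^esub> d (a, b)"
    by unfold_locales (simp_all add: dab F_mult_closed F_l_distr F_smult_mult)
  note simps = L.map_diff L.map_add L.map_smult R.map_diff R.map_add R.map_smult d_closed d_mult
     A.m_closed B.m_closed
  have "tensor_relations R A B \<subseteq> {r \<in> carrier F. d (a, b) \<otimes>\<^bsub>F\<^esub> r \<in> N}"
  proof
    fix r assume r: "r \<in> tensor_relations R A B"
    then have "d (a, b) \<otimes>\<^bsub>F\<^esub> r \<in> N"
      by (cases rule: tensor_relation_cases)
         (use a b in \<open>auto simp: simps A.r_distr B.r_distr A.smult_mult_r B.smult_mult_r intro!: rel\<close>)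
    then show "r \<in> {r \<in> carrier F. d (a, b) \<otimes>\<^bsub>F\<^esub> r \<in> N}"
      using r tensor_relations_carrier by auto
  qed
  from FA.submodule_generated_minimal[OF L.preimage_submodule[OF N_submodule] this]
  show "d (a, b) \<otimes>\<^bsub>F\<^esub> i \<in> N" using i by auto
  have "tensor_relations R A B \<subseteq> {r \<in> carrier F. r \<otimes>\<^bsub>F\<^esub> d (a, b) \<in> N}"
  proof
    fix r assume r: "r \<in> tensor_relations R A B"
    then have "r \<otimes>\<^bsub>F\<^esub> d (a, b) \<in> N"
      by (cases rule: tensor_relation_cases)
         (use a b in \<open>auto simp: simps A.l_distr B.l_distr A.smult_mult_l B.smult_mult_l intro!: rel\<close>)
    then show "r \<in> {r \<in> carrier F. r \<otimes>\<^bsub>F\<^esub> d (a, b) \<in> N}"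
      using r tensor_relations_carrier by auto
  qed
  from FA.submodule_generated_minimal[OF R.preimage_submodule[OF N_submodule] this]
  show "i \<otimes>\<^bsub>F\<^esub> d (a, b) \<in> N" using i by auto
qed

lemma N_algebra_ideal: "algebra_ideal R F N"
proof -
  note N = FA.submoduleE[OF N_submodule]
  have zero: "\<zero>\<^bsub>F\<^esub> \<in> N" 
    using subgroup.one_closed[OF submodule.axioms(1)[OF N_submodule]] by simp
  have "f \<otimes>\<^bsub>F\<^esub> i \<in> N \<and> i \<otimes>\<^bsub>F\<^esub> f \<in> N" if f: "f \<in> carrier F" and i: "i \<in> N" for f i
  proof -
    have ic: "i \<in> carrier F" using i N(1) by blast
    show ?thesis using f
      by (induction f rule: monoid_alg_induct)
         (use i in \<open>auto simp: F_mult_zero zero ic F_l_distr F_r_distr F_smult_mult N_absorbs_d N(4,5)\<close>)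
  qed
  then show ?thesis
    by (intro algebra_ideal.intro algebra_ideal_axioms.intro monoid_alg_assoc_algebra N_submodule) auto
qed

end

sublocale tensor_product \<subseteq> NI: algebra_ideal R F N
  by (rule N_algebra_ideal)

context tensor_product begin

abbreviation T where "T \<equiv> tensor_alg R A B"

lemma T_eq: "T = NI.Q"
  by (simp add: tensor_alg_def Let_def)

lemma T_assoc_algebra: "assoc_algebra R T"
  unfolding T_eq by (rule NI.quot_assoc_algebra)

end

sublocale tensor_product \<subseteq> TA: assoc_algebra R T
  by (rule T_assoc_algebra)

context tensor_product begin

lemma tens_cls: "tens R A B a b = NI.cls (d (a, b))"
  by (simp add: tens_def)

lemma tens_closed: "\<lbrakk>a \<in> carrier A; b \<in> carrier B\<rbrakk> \<Longrightarrow> tens R A B a b \<in> carrier T"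
  by (simp add: tens_cls T_eq NI.cls_closed d_closed)

text \<open>
  These are the relations that were divided out.
\<close>

lemma tens_bilinear:
  "\<lbrakk>x \<in> carrier A; x' \<in> carrier A; y \<in> carrier B\<rbrakk> \<Longrightarrow>
      tens R A B (x \<oplus>\<^bsub>A\<^esub> x') y = tens R A B x y \<oplus>\<^bsub>T\<^esub> tens R A B x' y"
  "\<lbrakk>x \<in> carrier A; y \<in> carrier B; y' \<in> carrier B\<rbrakk> \<Longrightarrow>
      tens R A B x (y \<oplus>\<^bsub>B\<^esub> y') = tens R A B x y \<oplus>\<^bsub>T\<^esub> tens R A B x y'"
  "\<lbrakk>c \<in> carrier R; x \<in> carrier A; y \<in> carrier B\<rbrakk> \<Longrightarrow>
      tens R A B (c \<odot>\<^bsub>A\<^esub> x) y = c \<odot>\<^bsub>T\<^esub> tens R A B x y"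
  "\<lbrakk>c \<in> carrier R; x \<in> carrier A; y \<in> carrier B\<rbrakk> \<Longrightarrow>
      tens R A B x (c \<odot>\<^bsub>B\<^esub> y) = c \<odot>\<^bsub>T\<^esub> tens R A B x y"
  by (simp_all add: tens_cls T_eq NI.cls_add NI.cls_smult d_closed NI.cls_eq_iff
      subsetD[OF FA.submodule_generated_superset tensor_relationI(1)]
      subsetD[OF FA.submodule_generated_superset tensor_relationI(2)]
      subsetD[OF FA.submodule_generated_superset tensor_relationI(3)]
      subsetD[OF FA.submodule_generated_superset tensor_relationI(4)])

lemma tens_mult:
  "\<lbrakk>a \<in> carrier A; b \<in> carrier B; a' \<in> carrier A; b' \<in> carrier B\<rbrakk> \<Longrightarrow>
    tens R A B a b \<otimes>\<^bsub>T\<^esub> tens R A B a' b' = tens R A B (a \<otimes>\<^bsub>A\<^esub> a') (b \<otimes>\<^bsub>B\<^esub> b')"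
  by (simp add: tens_cls T_eq NI.cls_mult d_closed d_mult)

lemma tensor_induct [consumes 1, case_names zero tens add smult]:
  assumes "X \<in> carrier T"
    and zero: "P \<zero>\<^bsub>T\<^esub>"
    and tens: "\<And>a b. \<lbrakk>a \<in> carrier A; b \<in> carrier B\<rbrakk> \<Longrightarrow> P (tens R A B a b)"
    and add: "\<And>X Y. \<lbrakk>X \<in> carrier T; Y \<in> carrier T; P X; P Y\<rbrakk> \<Longrightarrow> P (X \<oplus>\<^bsub>T\<^esub> Y)"
    and smult: "\<And>c X. \<lbrakk>c \<in> carrier R; X \<in> carrier T; P X\<rbrakk> \<Longrightarrow> P (c \<odot>\<^bsub>T\<^esub> X)"
  shows "P X"
proof -
  obtain f where f: "f \<in> carrier F" "X = NI.cls f" using assms(1) unfolding T_eq by (rule NI.cls_cases)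
  have "P (NI.cls f)" using f(1)
  proof (induction f rule: monoid_alg_induct)
    case (delta w) then show ?case using tens by (cases w) (simp add: tens_cls)
  next
    case (add f g)
    then show ?case using assms(4)[of "NI.cls f" "NI.cls g"] by (simp add: T_eq NI.cls_closed NI.cls_add)
  next
    case (smult c f)
    then show ?case using assms(5)[of c "NI.cls f"] by (simp add: T_eq NI.cls_closed NI.cls_smult)
  qed (use zero in \<open>simp add: T_eq NI.cls_zero\<close>)
  with f show ?thesis by simp
qed

end

definition tensor_map where
  "tensor_map R A B' h =
     quot_map (linear_extension R (tensor_alg R A B') (\<lambda>(a, b). tens R A B' a (h b)))"

text \<open>
  The map \<open>h\<close> is only assumed to be linear, because the retraction in \<open>tensor_map_inj\<close> is not
  multiplicative.
\<close>

locale tensor_functor = S: tensor_product R A B + S': tensor_product R A B' + linear_map R B B' h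
  for R :: "('c, 'r) ring_scheme" and A :: "('c, 'a, 'm) module_scheme"
    and B :: "('c, 'b, 'n) module_scheme" and B' :: "('c, 'd, 'k) module_scheme" and h
begin

abbreviation g where "g \<equiv> \<lambda>(a, b). tens R A B' a (h b)"
abbreviation L where "L \<equiv> linear_extension R S'.T g"

lemma g_closed: "g \<in> carrier (A \<times>\<times> B) \<rightarrow> carrier S'.T"
  by (auto simp: S'.tens_closed map_closed)

lemma L_linear: "linear_map R S.F S'.T L"
  by (rule S.linear_extension_linear[OF S'.TA.module_axioms g_closed])

lemma L_d: "\<lbrakk>a \<in> carrier A; b \<in> carrier B\<rbrakk> \<Longrightarrow> L (delta R (a, b)) = tens R A B' a (h b)"
  using S.linear_extension_delta[OF S'.TA.module_axioms g_closed, of "(a, b)"] by simp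

lemma L_kills: assumes "i \<in> S.N" shows "L i = \<zero>\<^bsub>S'.T\<^esub>"
proof -
  interpret L: linear_map R S.F S'.T L by (rule L_linear)
  have self: "X \<ominus>\<^bsub>S'.T\<^esub> X = \<zero>\<^bsub>S'.T\<^esub>" if "X \<in> carrier S'.T" for X
    using that by (simp add: a_minus_def S'.TA.M.r_neg)
  have "tensor_relations R A B \<subseteq> {r \<in> carrier S.F. L r = \<zero>\<^bsub>S'.T\<^esub>}"
  proof
    fix r assume r: "r \<in> tensor_relations R A B"
    then have "L r = \<zero>\<^bsub>S'.T\<^esub>"
      by (cases rule: S.tensor_relation_cases)
         (simp_all add: L.map_diff L.map_add L.map_smult S.d_closed L_d map_closed map_add map_smult
           S'.tens_bilinear S'.tens_closed self)
    then show "r \<in> {r \<in> carrier S.F. L r = \<zero>\<^bsub>S'.T\<^esub>}"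
      using r S.tensor_relations_carrier by auto
  qed
  then have "S.N \<subseteq> {r \<in> carrier S.F. L r = \<zero>\<^bsub>S'.T\<^esub>}"
    by (rule S.FA.submodule_generated_minimal[OF L.kernel_submodule])
  then show ?thesis using assms by auto
qed

abbreviation Th where "Th \<equiv> tensor_map R A B' h"

lemma tensor_map_linear: "linear_map R S.T S'.T Th"
  unfolding tensor_map_def S.T_eq by (rule S.NI.quot_map_linear[OF L_linear L_kills])

lemma tensor_map_tens:
  assumes "a \<in> carrier A" "b \<in> carrier B"
  shows "Th (tens R A B a b) = tens R A B' a (h b)"
  unfolding tensor_map_def S.tens_cls
  using assms by (simp add: S.NI.quot_map_cls[OF L_linear L_kills] S.d_closed L_d)

lemma tensor_map_algebra_map:
  assumes "algebra_map R B B' h" shows "algebra_map R S.T S'.T Th"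
proof -
  interpret h: algebra_map R B B' h by fact
  have "algebra_map R S.F S'.T L"
    by (rule S.linear_extension_algebra_map[OF S'.T_assoc_algebra g_closed])
       (auto simp: map_closed h.map_mult S'.tens_mult)
  then show ?thesis
    unfolding tensor_map_def S.T_eq by (rule S.NI.quot_map_algebra_map[OF _ L_kills])
qed

lemma tensor_map_surj:
  assumes "carrier B' \<subseteq> h ` carrier B" shows "carrier S'.T \<subseteq> Th ` carrier S.T"
proof
  interpret Th: linear_map R S.T S'.T Th by (rule tensor_map_linear)
  fix X assume "X \<in> carrier S'.T"
  then show "X \<in> Th ` carrier S.T"
  proof (induction X rule: S'.tensor_induct)
    case zero
    then show ?case using Th.map_zero by (metis S.TA.M.zero_closed imageI)
  next
    case (tens a b)
    then obtain c where "c \<in> carrier B" "b = h c" using assms by auto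
    with tens show ?case by (metis S.tens_closed imageI tensor_map_tens)
  next
    case (add X Y)
    then obtain x y where "x \<in> carrier S.T" "y \<in> carrier S.T" "X = Th x" "Y = Th y" by auto
    then have "X \<oplus>\<^bsub>S'.T\<^esub> Y = Th (x \<oplus>\<^bsub>S.T\<^esub> y)" "x \<oplus>\<^bsub>S.T\<^esub> y \<in> carrier S.T"
      by (simp_all add: Th.map_add)
    then show ?case by blast
  next
    case (smult c X)
    then obtain x where "x \<in> carrier S.T" "X = Th x" by auto
    with smult have "c \<odot>\<^bsub>S'.T\<^esub> X = Th (c \<odot>\<^bsub>S.T\<^esub> x)" "c \<odot>\<^bsub>S.T\<^esub> x \<in> carrier S.T"
      by (simp_all add: Th.map_smult)
    then show ?case by blast
  qed
qed

text \<open>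
  In general \<open>A \<otimes> _\<close> does not preserve injectivity. It does for split injections, since the
  retraction can be tensored with \<open>A\<close> as well.
\<close>

lemma tensor_map_inj:
  assumes "linear_map R B' B r" "\<And>b. b \<in> carrier B \<Longrightarrow> r (h b) = b"
  shows "inj_on Th (carrier S.T)"
proof -
  interpret r: linear_map R B' B r by fact
  interpret r: tensor_functor R A B' B r by unfold_locales
  interpret Th: linear_map R S.T S'.T Th by (rule tensor_map_linear)
  interpret Tr: linear_map R S'.T S.T "tensor_map R A B r" by (rule r.tensor_map_linear)
  have "tensor_map R A B r (Th X) = X" if "X \<in> carrier S.T" for X
    using that
    by (induction X rule: S.tensor_induct)
       (simp_all add: Th.map_zero Tr.map_zero tensor_map_tens r.tensor_map_tens map_closed assms(2)
         Th.map_add Tr.map_add Th.map_smult Tr.map_smult Th.map_closed)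
  then show ?thesis by (metis inj_onI)
qed

end


section \<open>Monoid algebras of monoids, and the free algebra\<close>

locale monoid_algebra = semigroup_algebra R M
  for R :: "('c, 'r) ring_scheme" (structure) and M :: "('m, 's) monoid_scheme" +
  assumes neutral_closed: "\<one>\<^bsub>M\<^esub> \<in> carrier M"
    and neutral_l: "u \<in> carrier M \<Longrightarrow> \<one>\<^bsub>M\<^esub> \<otimes>\<^bsub>M\<^esub> u = u"
    and neutral_r: "u \<in> carrier M \<Longrightarrow> u \<otimes>\<^bsub>M\<^esub> \<one>\<^bsub>M\<^esub> = u"
begin

lemma F_unital_algebra: "unital_algebra R F"
proof -
  have d: "delta R \<one>\<^bsub>M\<^esub> \<in> carrier F" by (rule delta_closed[OF neutral_closed])
  have "\<one>\<^bsub>F\<^esub> \<otimes>\<^bsub>F\<^esub> f = f \<and> f \<otimes>\<^bsub>F\<^esub> \<one>\<^bsub>F\<^esub> = f" if "f \<in> carrier F" for f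
    using that unfolding F_simps(4)
    by (induction f rule: monoid_alg_induct)
       (simp_all add: F_mult_zero d delta_mult neutral_closed neutral_l neutral_r F_l_distr F_r_distr F_smult_mult)
  then show ?thesis
    by (intro unital_algebra.intro unital_algebra_axioms.intro monoid_alg_assoc_algebra)
       (simp_all add: F_simps(4) d)
qed

lemma F_mult_comm:
  assumes comm: "\<And>u v. \<lbrakk>u \<in> carrier M; v \<in> carrier M\<rbrakk> \<Longrightarrow> u \<otimes>\<^bsub>M\<^esub> v = v \<otimes>\<^bsub>M\<^esub> u"
    and f: "f \<in> carrier F" and g: "g \<in> carrier F"
  shows "f \<otimes>\<^bsub>F\<^esub> g = g \<otimes>\<^bsub>F\<^esub> f"
proof -
  interpret RF: ring F using F_unital_algebra by (rule unital_algebra.is_ring)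
  have 1: "f \<otimes>\<^bsub>F\<^esub> delta R v = delta R v \<otimes>\<^bsub>F\<^esub> f" if "v \<in> carrier M" for v
    using f that
    by (induction f rule: monoid_alg_induct)
       (simp_all add: delta_closed delta_mult F_l_distr F_r_distr F_smult_mult comm)
  show ?thesis using g f
    by (induction g rule: monoid_alg_induct) (simp_all add: 1 F_l_distr F_r_distr F_smult_mult)
qed

lemma linear_extension_unital_map:
  assumes "unital_algebra R X" and g: "g \<in> carrier M \<rightarrow> carrier X"
    and mult: "\<And>u v. \<lbrakk>u \<in> carrier M; v \<in> carrier M\<rbrakk> \<Longrightarrow> g (u \<otimes>\<^bsub>M\<^esub> v) = g u \<otimes>\<^bsub>X\<^esub> g v"
    and one: "g \<one>\<^bsub>M\<^esub> = \<one>\<^bsub>X\<^esub>"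
  shows "unital_map R F X (linear_extension R X g)"
proof -
  interpret X: unital_algebra R X by fact
  show ?thesis
    using linear_extension_algebra_map[OF X.assoc_algebra_axioms g mult]
      linear_extension_delta[OF X.module_axioms g neutral_closed]
    by (intro unital_map.intro unital_map_axioms.intro) (simp_all add: F_simps(4) one)
qed

end

lemma free_monoid_algebra:
  "cring R \<Longrightarrow> monoid_algebra R \<lparr>carrier = UNIV, monoid.mult = (@), one = []\<rparr>"
  by (simp add: monoid_algebra_def monoid_algebra_axioms_def semigroup_algebra_def
      semigroup_algebra_axioms_def)

lemma poly_monoid_algebra:
  "cring R \<Longrightarrow> monoid_algebra R \<lparr>carrier = UNIV, monoid.mult = (+), one = {#}\<rparr>"
  by (simp add: monoid_algebra_def monoid_algebra_axioms_def semigroup_algebra_def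
      semigroup_algebra_axioms_def add.assoc)

definition word_value :: "('b, 'm) ring_scheme \<Rightarrow> ('x \<Rightarrow> 'b) \<Rightarrow> 'x list \<Rightarrow> 'b" where
  "word_value B \<gamma> w = foldr (\<lambda>x y. \<gamma> x \<otimes>\<^bsub>B\<^esub> y) w \<one>\<^bsub>B\<^esub>"

lemma word_value_simps [simp]:
  "word_value B \<gamma> [] = \<one>\<^bsub>B\<^esub>" "word_value B \<gamma> (x # w) = \<gamma> x \<otimes>\<^bsub>B\<^esub> word_value B \<gamma> w"
  by (simp_all add: word_value_def)

lemma (in unital_algebra) word_value_closed:
  "(\<And>x. \<gamma> x \<in> carrier A) \<Longrightarrow> word_value A \<gamma> w \<in> carrier A"
  by (induction w) (simp_all add: unit_closed m_closed)

lemma (in unital_algebra) word_value_append: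
  assumes "\<And>x. \<gamma> x \<in> carrier A"
  shows "word_value A \<gamma> (v @ w) = word_value A \<gamma> v \<otimes> word_value A \<gamma> w"
  by (induction v) (simp_all add: assms word_value_closed unit_l m_assoc)

definition free_map ::
  "('c, 'r) ring_scheme \<Rightarrow> ('c, 'b, 'm) module_scheme \<Rightarrow> ('x \<Rightarrow> 'b) \<Rightarrow> ('x list \<Rightarrow> 'c) \<Rightarrow> 'b" where
  "free_map R B \<gamma> = linear_extension R B (word_value B \<gamma>)"

locale coefficient_ring = cring R for R :: "('c, 'r) ring_scheme" (structure)

sublocale coefficient_ring \<subseteq> W: monoid_algebra R "\<lparr>carrier = UNIV, monoid.mult = (@), one = []\<rparr>"
  rewrites "monoid_alg R \<lparr>carrier = UNIV, monoid.mult = (@), one = []\<rparr> = free_alg R"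
  by (rule free_monoid_algebra[OF is_cring]) (simp add: free_alg_def)

context coefficient_ring begin

lemma free_unital_algebra: "unital_algebra R (free_alg R)"
  by (rule W.F_unital_algebra)

lemma word_closed: "delta R w \<in> carrier (free_alg R)"
  by (rule W.delta_closed) simp

lemma word_mult: "delta R u \<otimes>\<^bsub>free_alg R\<^esub> delta R v = delta R (u @ v)"
  using W.delta_mult[of u v] by simp

lemma free_map_unital_map:
  assumes "unital_algebra R B" "\<And>x. \<gamma> x \<in> carrier B"
  shows "unital_map R (free_alg R) B (free_map R B \<gamma>)"
  unfolding free_map_def
  by (rule W.linear_extension_unital_map)
     (auto simp: assms(1) unital_algebra.word_value_closed[OF assms(1)]
       unital_algebra.word_value_append[OF assms(1)] assms(2))

lemma free_map_word:
  assumes "unital_algebra R B" "\<And>x. \<gamma> x \<in> carrier B"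
  shows "free_map R B \<gamma> (delta R w) = word_value B \<gamma> w"
proof -
  interpret B: unital_algebra R B by fact
  show ?thesis unfolding free_map_def
    by (rule W.linear_extension_delta[OF B.module_axioms]) (use assms B.word_value_closed in auto)
qed

lemma free_map_generator:
  assumes "unital_algebra R B" "\<And>x. \<gamma> x \<in> carrier B"
  shows "free_map R B \<gamma> (delta R [x]) = \<gamma> x"
  using assms by (simp add: free_map_word unital_algebra.unit_r)

end

text \<open>
  A quotient of a free algebra is spanned by the words in its generators, so every subset with the
  following closure properties contains all of it. It serves to prove surjectivity.
\<close>

lemma (in coefficient_ring) quot_free_alg_generated:
  assumes "ideal I (free_alg R)" and Q: "Q = quot_alg (free_alg R) I"
    and zero: "\<zero>\<^bsub>Q\<^esub> \<in> T" and one: "\<one>\<^bsub>Q\<^esub> \<in> T"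
    and gen: "\<And>x X. \<lbrakk>X \<in> carrier Q; X \<in> T\<rbrakk> \<Longrightarrow> (I +>\<^bsub>free_alg R\<^esub> delta R [x]) \<otimes>\<^bsub>Q\<^esub> X \<in> T"
    and add: "\<And>X Y. \<lbrakk>X \<in> T; Y \<in> T\<rbrakk> \<Longrightarrow> X \<oplus>\<^bsub>Q\<^esub> Y \<in> T"
    and smult: "\<And>c X. \<lbrakk>c \<in> carrier R; X \<in> carrier Q; X \<in> T\<rbrakk> \<Longrightarrow> c \<odot>\<^bsub>Q\<^esub> X \<in> T"
  shows "carrier Q \<subseteq> T"
proof
  interpret I: algebra_ideal R "free_alg R" I
    by (rule unital_algebra.ideal_is_algebra_ideal[OF free_unital_algebra assms(1)])
  fix X assume "X \<in> carrier Q"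
  then obtain f where f: "f \<in> carrier (free_alg R)" "X = I.cls f" unfolding Q by (rule I.cls_cases)
  have word: "I.cls (delta R w) \<in> T" for w
  proof (induction w)
    case Nil
    show ?case using one by (simp add: Q I.quot_simps(3) W.F_simps)
  next
    case (Cons x w)
    have "I.cls (delta R (x # w)) = I.cls (delta R [x]) \<otimes>\<^bsub>Q\<^esub> I.cls (delta R w)"
      by (simp add: Q I.cls_mult word_closed word_mult)
    then show ?case using gen[OF _ Cons.IH] by (simp add: Q I.cls_closed word_closed)
  qed
  have "I.cls f \<in> T" using f(1)
  proof (induction f rule: W.monoid_alg_induct)
    case zero then show ?case using assms(3) by (simp add: Q I.cls_zero)
  next
    case (add f g) then show ?case using assms(6)[of "I.cls f" "I.cls g"] by (simp add: Q I.cls_add)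
  next
    case (smult c f)
    then show ?case using assms(7)[of c "I.cls f"] by (simp add: Q I.cls_smult I.cls_closed)
  qed (rule word)
  with f show "X \<in> T" by simp
qed

section \<open>The free supercommutative algebra\<close>

definition sgn_pow :: "('c, 'r) ring_scheme \<Rightarrow> nat \<Rightarrow> 'c" where
  "sgn_pow R k = (\<ominus>\<^bsub>R\<^esub> \<one>\<^bsub>R\<^esub>) [^]\<^bsub>R\<^esub> k"

context cring begin

lemma sgn_pow_closed: "sgn_pow R k \<in> carrier R"
  by (simp add: sgn_pow_def)

lemma sgn_pow_add: "sgn_pow R (j + k) = sgn_pow R j \<otimes> sgn_pow R k"
  by (simp add: sgn_pow_def nat_pow_mult)

lemma sgn_pow_simps: "sgn_pow R 0 = \<one>" "sgn_pow R (Suc 0) = \<ominus> \<one>"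
  by (simp_all add: sgn_pow_def)

text \<open>
  The degree of a word is reduced modulo \<open>2\<close>, but signs are easier to multiply with the total number
  of odd letters in the exponent.
\<close>

lemma sgn_pow_parity: "sgn_pow R k = sgn_pow R (k mod 2)"
proof -
  have "sgn_pow R (2 * j) = \<one>" for j
  proof (induction j)
    case (Suc j)
    have "sgn_pow R (2 * Suc j) = sgn_pow R (2 * j) \<otimes> (sgn_pow R 1 \<otimes> sgn_pow R 1)"
      by (simp flip: sgn_pow_add)
    then show ?case using Suc by (simp add: sgn_pow_simps l_minus)
  qed (simp add: sgn_pow_simps)
  then show ?thesis
    using sgn_pow_add[of "2 * (k div 2)" "k mod 2"] by (simp add: sgn_pow_closed)
qed

end

lemma supercommutator_sign:
  assumes "cring R"
  shows "sgn_pow R (word_degree u * word_degree v) =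
    sgn_pow R (sum_list (map svar_degree u) * sum_list (map svar_degree v))"
  using cring.sgn_pow_parity[OF assms, of "word_degree u * word_degree v"]
    cring.sgn_pow_parity[OF assms, of "sum_list (map svar_degree u) * sum_list (map svar_degree v)"]
  by (simp add: word_degree_def mod_mult_eq)

text \<open>
  Supercommutation of the letters extends to words: moving one word past another costs one sign for
  each pair of odd letters that cross.
\<close>

lemma (in unital_algebra) word_value_supercommute:
  assumes g: "\<And>x. \<gamma> x \<in> carrier A"
    and comm: "\<And>x y. \<gamma> x \<otimes> \<gamma> y = sgn_pow R (svar_degree x * svar_degree y) \<odot> (\<gamma> y \<otimes> \<gamma> x)"
  shows "word_value A \<gamma> u \<otimes> word_value A \<gamma> v =
    sgn_pow R (word_degree u * word_degree v) \<odot> (word_value A \<gamma> v \<otimes> word_value A \<gamma> u)"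
proof -
  let ?W = "word_value A \<gamma>" and ?n = "\<lambda>w. sum_list (map svar_degree w)"
  note cl = g word_value_closed[of \<gamma>, OF g] m_closed unit_closed smult_closed R.sgn_pow_closed
  have 1: "\<gamma> x \<otimes> ?W v = sgn_pow R (svar_degree x * ?n v) \<odot> (?W v \<otimes> \<gamma> x)" for x v
  proof (induction v)
    case Nil
    show ?case by (simp add: cl unit_l unit_r R.sgn_pow_simps)
  next
    case (Cons y v)
    have "\<gamma> x \<otimes> ?W (y # v) = (\<gamma> x \<otimes> \<gamma> y) \<otimes> ?W v" by (simp add: cl m_assoc)
    also have "\<dots> = sgn_pow R (svar_degree x * svar_degree y) \<odot> (\<gamma> y \<otimes> (\<gamma> x \<otimes> ?W v))"
      by (subst comm) (simp add: cl smult_mult_l m_assoc)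
    also have "\<dots> = sgn_pow R (svar_degree x * svar_degree y) \<odot>
        (sgn_pow R (svar_degree x * ?n v) \<odot> ((\<gamma> y \<otimes> ?W v) \<otimes> \<gamma> x))"
      by (simp add: Cons.IH cl smult_mult_r m_assoc)
    also have "\<dots> = sgn_pow R (svar_degree x * ?n (y # v)) \<odot> (?W (y # v) \<otimes> \<gamma> x)"
      by (simp add: cl distrib_left R.sgn_pow_add smult_assoc1)
    finally show ?case .
  qed
  have "?W u \<otimes> ?W v = sgn_pow R (?n u * ?n v) \<odot> (?W v \<otimes> ?W u)"
  proof (induction u)
    case Nil
    show ?case by (simp add: cl unit_l unit_r R.sgn_pow_simps)
  next
    case (Cons x u)
    have "?W (x # u) \<otimes> ?W v = \<gamma> x \<otimes> (?W u \<otimes> ?W v)" by (simp add: cl m_assoc)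
    also have "\<dots> = sgn_pow R (?n u * ?n v) \<odot> ((\<gamma> x \<otimes> ?W v) \<otimes> ?W u)"
      by (simp add: Cons.IH cl smult_mult_r m_assoc)
    also have "\<dots> = sgn_pow R (?n u * ?n v) \<odot> (sgn_pow R (svar_degree x * ?n v) \<odot> (?W v \<otimes> ?W (x # u)))"
      by (subst 1) (simp add: cl smult_mult_l m_assoc)
    also have "\<dots> = sgn_pow R (?n (x # u) * ?n v) \<odot> (?W v \<otimes> ?W (x # u))"
      by (simp add: cl distrib_right R.sgn_pow_add smult_assoc1 R.m_comm[of "sgn_pow R (?n u * ?n v)"]
          flip: smult_assoc1)
    finally show ?case .
  qed
  then show ?thesis by (simp add: supercommutator_sign[OF R.is_cring])
qed

context coefficient_ring begin

abbreviation Fs :: "('c, svar list \<Rightarrow> 'c) module" where "Fs \<equiv> free_alg R"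
abbreviation hp where "hp \<equiv> homogeneous_part R"

lemma homogeneous_part_linear: "linear_map R Fs Fs (hp d)"
proof -
  interpret F: unital_algebra R Fs by (rule free_unital_algebra)
  show ?thesis
  proof unfold_locales
    fix f :: "svar list \<Rightarrow> 'c" assume f: "f \<in> carrier Fs"
    show "hp d f \<in> carrier Fs"
      by (rule W.F_carrierI[of _ "supp R f"])
         (auto simp: homogeneous_part_def W.coeff_closed[OF f] W.supp_finite[OF f] W.supp_zeroD)
  qed (auto simp: homogeneous_part_def W.F_simps fun_eq_iff)
qed

lemma homogeneous_part_word: "hp d (delta R w) = (if word_degree w = d then delta R w else \<zero>\<^bsub>Fs\<^esub>)"
  by (auto simp: homogeneous_part_def delta_def fun_eq_iff W.F_simps)

definition superterm where
  "superterm d e a b = hp d a \<otimes>\<^bsub>Fs\<^esub> hp e b \<ominus>\<^bsub>Fs\<^esub> sgn_pow R (d * e) \<odot>\<^bsub>Fs\<^esub> (hp e b \<otimes>\<^bsub>Fs\<^esub> hp d a)"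

lemma superterm_closed:
  assumes "a \<in> carrier Fs" "b \<in> carrier Fs" shows "superterm d e a b \<in> carrier Fs"
proof -
  interpret F: unital_algebra R Fs by (rule free_unital_algebra)
  show ?thesis
    using assms linear_map.map_closed[OF homogeneous_part_linear]
    by (simp add: superterm_def W.FA.m_closed sgn_pow_closed)
qed

lemma supercommutator_expand:
  assumes "a \<in> carrier Fs" "b \<in> carrier Fs"
  shows "supercommutator R a b =
    (superterm 0 0 a b \<oplus>\<^bsub>Fs\<^esub> superterm 0 1 a b) \<oplus>\<^bsub>Fs\<^esub> (superterm 1 0 a b \<oplus>\<^bsub>Fs\<^esub> superterm 1 1 a b)"
proof -
  interpret F: unital_algebra R Fs by (rule free_unital_algebra)
  have cl: "superterm d e a b \<in> carrier Fs" for d e using superterm_closed[OF assms] .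
  have "supercommutator R a b = (\<Oplus>\<^bsub>Fs\<^esub>d\<in>{0, 1}. \<Oplus>\<^bsub>Fs\<^esub>e\<in>{0, 1}. superterm d e a b)"
    by (simp add: supercommutator_def Let_def sgn_pow_def superterm_def)
  also have "\<dots> = (superterm 0 0 a b \<oplus>\<^bsub>Fs\<^esub> superterm 0 1 a b) \<oplus>\<^bsub>Fs\<^esub> (superterm 1 0 a b \<oplus>\<^bsub>Fs\<^esub> superterm 1 1 a b)"
    by (simp add: cl W.FA.M.a_ac)
  finally show ?thesis .
qed

abbreviation supercommutators where
  "supercommutators \<equiv> {supercommutator R a b | a b. a \<in> carrier Fs \<and> b \<in> carrier Fs}"

lemma supercommutators_carrier: "supercommutators \<subseteq> carrier Fs"
proof -
  interpret F: unital_algebra R Fs by (rule free_unital_algebra)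
  show ?thesis by (auto simp: supercommutator_expand superterm_closed)
qed

lemma supercommutator_words:
  "supercommutator R (delta R u) (delta R v) =
     delta R (u @ v) \<ominus>\<^bsub>Fs\<^esub> sgn_pow R (word_degree u * word_degree v) \<odot>\<^bsub>Fs\<^esub> delta R (v @ u)"
proof -
  interpret F: unital_algebra R Fs by (rule free_unital_algebra)
  interpret RF: ring Fs by (rule F.is_ring)
  have zero: "\<zero>\<^bsub>Fs\<^esub> \<ominus>\<^bsub>Fs\<^esub> \<zero>\<^bsub>Fs\<^esub> = \<zero>\<^bsub>Fs\<^esub>" by (simp add: a_minus_def)
  have "superterm d e (delta R u) (delta R v) = (if word_degree u = d \<and> word_degree v = e
      then delta R (u @ v) \<ominus>\<^bsub>Fs\<^esub> sgn_pow R (d * e) \<odot>\<^bsub>Fs\<^esub> delta R (v @ u) else \<zero>\<^bsub>Fs\<^esub>)" for d e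
    by (auto simp: superterm_def homogeneous_part_word word_closed word_mult sgn_pow_closed zero)
  moreover have "word_degree u \<in> {0, 1}" "word_degree v \<in> {0, 1}"
    by (auto simp: word_degree_def)
  ultimately show ?thesis
    by (auto simp: supercommutator_expand word_closed sgn_pow_closed)
qed

abbreviation S where "S \<equiv> free_supercomm_alg R"

lemma S_eq: "S = quot_alg Fs (Idl\<^bsub>Fs\<^esub> supercommutators)"
  by (simp add: free_supercomm_alg_def Let_def)

lemma supercommutator_ideal: "ideal (Idl\<^bsub>Fs\<^esub> supercommutators) Fs"
  by (intro ring.genideal_ideal unital_algebra.is_ring[OF free_unital_algebra] supercommutators_carrier)

lemma S_unital_algebra: "unital_algebra R S"
  unfolding S_eq
  by (rule unital_algebra.quot_unital_algebra[OF free_unital_algebra supercommutator_ideal])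

definition s_gen :: "svar \<Rightarrow> (svar list \<Rightarrow> 'c) set" where
  "s_gen x = Idl\<^bsub>Fs\<^esub> supercommutators +>\<^bsub>Fs\<^esub> delta R [x]"

lemma s_gen_closed: "s_gen x \<in> carrier S"
proof -
  interpret I: algebra_ideal R Fs "Idl\<^bsub>Fs\<^esub> supercommutators"
    by (rule unital_algebra.ideal_is_algebra_ideal[OF free_unital_algebra supercommutator_ideal])
  show ?thesis unfolding S_eq s_gen_def by (rule I.cls_closed[OF word_closed])
qed

lemma s_gen_supercommute:
  "s_gen x \<otimes>\<^bsub>S\<^esub> s_gen y = sgn_pow R (svar_degree x * svar_degree y) \<odot>\<^bsub>S\<^esub> (s_gen y \<otimes>\<^bsub>S\<^esub> s_gen x)"
proof -
  interpret F: unital_algebra R Fs by (rule free_unital_algebra)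
  interpret RF: ring Fs by (rule F.is_ring)
  interpret I: algebra_ideal R Fs "Idl\<^bsub>Fs\<^esub> supercommutators"
    by (rule unital_algebra.ideal_is_algebra_ideal[OF free_unital_algebra supercommutator_ideal])
  have deg: "word_degree [x] = svar_degree x" for x by (cases x) (auto simp: word_degree_def)
  have "supercommutator R (delta R [x]) (delta R [y]) \<in> supercommutators"
    using word_closed by blast
  then have "delta R [x, y] \<ominus>\<^bsub>Fs\<^esub> sgn_pow R (svar_degree x * svar_degree y) \<odot>\<^bsub>Fs\<^esub> delta R [y, x]
      \<in> Idl\<^bsub>Fs\<^esub> supercommutators"
    using subsetD[OF RF.genideal_self[OF supercommutators_carrier]]
    by (simp add: supercommutator_words deg)
  then show ?thesis
    unfolding S_eq s_gen_def
    by (simp add: I.cls_mult I.cls_smult word_closed word_mult I.cls_eq_iff sgn_pow_closed)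
qed

definition s_map :: "('c, 'b, 'm) module_scheme \<Rightarrow> (svar \<Rightarrow> 'b) \<Rightarrow> (svar list \<Rightarrow> 'c) set \<Rightarrow> 'b" where
  "s_map B \<gamma> = quot_map (free_map R B \<gamma>)"

text \<open>
  The universal property of \<open>S\<close>: it suffices to check supercommutation on the images of the
  generators. The supercommutator is a sum of four terms, one for each pair of degrees, and the map
  kills each of them: this is a bilinear statement, so it reduces to words.
\<close>

lemma s_map_unital_map:
  assumes "unital_algebra R B" and g: "\<And>x. \<gamma> x \<in> carrier B"
    and comm: "\<And>x y. \<gamma> x \<otimes>\<^bsub>B\<^esub> \<gamma> y = sgn_pow R (svar_degree x * svar_degree y) \<odot>\<^bsub>B\<^esub> (\<gamma> y \<otimes>\<^bsub>B\<^esub> \<gamma> x)"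
  shows "unital_map R S B (s_map B \<gamma>)" "s_map B \<gamma> (s_gen x) = \<gamma> x"
proof -
  interpret F: unital_algebra R Fs by (rule free_unital_algebra)
  interpret B: unital_algebra R B by fact
  interpret RB: ring B by (rule B.is_ring)
  let ?h = "free_map R B \<gamma>"
  interpret h: unital_map R Fs B ?h by (rule free_map_unital_map[OF assms(1) g])
  note word = free_map_word[OF assms(1), of \<gamma>, OF g]
  have super: "?h (hp d a) \<otimes>\<^bsub>B\<^esub> ?h (hp e b) = sgn_pow R (d * e) \<odot>\<^bsub>B\<^esub> (?h (hp e b) \<otimes>\<^bsub>B\<^esub> ?h (hp d a))"
    if a: "a \<in> carrier Fs" and b: "b \<in> carrier Fs" for a b d e
  proof -
    interpret D: linear_map R Fs Fs "hp d" by (rule homogeneous_part_linear)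
    interpret E: linear_map R Fs Fs "hp e" by (rule homogeneous_part_linear)
    note simps = D.map_zero D.map_add D.map_smult D.map_closed E.map_zero E.map_add E.map_smult E.map_closed
      h.map_zero h.map_add h.map_smult h.map_closed RB.l_distr RB.r_distr B.smult_mult_l B.smult_mult_r
      B.smult_r_distr sgn_pow_closed B.smult_assoc1[symmetric] m_comm
    have 1: "?h (hp d (delta R u)) \<otimes>\<^bsub>B\<^esub> ?h (hp e b) =
        sgn_pow R (d * e) \<odot>\<^bsub>B\<^esub> (?h (hp e b) \<otimes>\<^bsub>B\<^esub> ?h (hp d (delta R u)))" for u
      using b
    proof (induction b rule: W.monoid_alg_induct)
      case (delta v)
      show ?case
        using B.word_value_supercommute[OF g comm, of u v] B.word_value_closed[of \<gamma>, OF g]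
        by (auto simp: homogeneous_part_word word h.map_zero sgn_pow_closed)
    qed (simp_all add: simps word_closed)
    show ?thesis using a b
      by (induction a rule: W.monoid_alg_induct) (simp_all add: simps 1)
  qed
  have kill: "?h c = \<zero>\<^bsub>B\<^esub>" if c: "c \<in> supercommutators" for c
  proof -
    obtain a b where ab: "a \<in> carrier Fs" "b \<in> carrier Fs" "c = supercommutator R a b" using c by blast
    have "?h (superterm d e a b) = \<zero>\<^bsub>B\<^esub>" for d e
    proof -
      have cl: "hp d a \<in> carrier Fs" "hp e b \<in> carrier Fs"
        using ab linear_map.map_closed[OF homogeneous_part_linear] by auto
      then have "?h (superterm d e a b) = ?h (hp d a) \<otimes>\<^bsub>B\<^esub> ?h (hp e b)
          \<ominus>\<^bsub>B\<^esub> sgn_pow R (d * e) \<odot>\<^bsub>B\<^esub> (?h (hp e b) \<otimes>\<^bsub>B\<^esub> ?h (hp d a))"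
        by (simp add: superterm_def h.map_diff h.map_mult h.map_smult W.FA.m_closed sgn_pow_closed)
      then show ?thesis using cl ab super[OF ab(1,2), of d e]
        by (simp add: a_minus_def B.M.r_neg h.map_closed sgn_pow_closed B.m_closed)
    qed
    then show ?thesis using ab by (simp add: supercommutator_expand superterm_closed h.map_add)
  qed
  show "unital_map R S B (s_map B \<gamma>)"
    unfolding S_eq s_map_def
    by (rule h.quot_genideal_map(1)[OF free_unital_algebra assms(1) supercommutators_carrier kill])
  show "s_map B \<gamma> (s_gen x) = \<gamma> x"
    unfolding s_map_def s_gen_def
    by (rule trans[OF h.quot_genideal_map(2)[OF free_unital_algebra assms(1) supercommutators_carrier kill]])
       (simp_all add: word_closed free_map_generator[OF assms(1) g])
qed

end


section \<open>The generalized Grassmann algebra\<close>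

locale coefficient_ring_with_half = C?: coefficient_ring R for R :: "('c, 'r) ring_scheme" (structure) +
  assumes two_unit: "\<one> \<oplus> \<one> \<in> Units R"

sublocale coefficient_ring_with_half \<subseteq> P: monoid_algebra R "\<lparr>carrier = UNIV :: evar multiset set, monoid.mult = (+), one = {#}\<rparr>"
  rewrites "monoid_alg R \<lparr>carrier = UNIV :: evar multiset set, monoid.mult = (+), one = {#}\<rparr> = poly_alg R"
  by (rule poly_monoid_algebra[OF C.is_cring]) (simp add: poly_alg_def)

context coefficient_ring_with_half begin

abbreviation P :: "('c, evar multiset \<Rightarrow> 'c) module" where "P \<equiv> poly_alg R"
abbreviation J where "J \<equiv> eps_ideal R"
abbreviation E where "E \<equiv> eps_alg R"

lemma P_unital_algebra: "unital_algebra R P"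
  by (rule P.F_unital_algebra)

definition eps_relations where
  "eps_relations =
     {delta R {#Theta#} \<otimes>\<^bsub>P\<^esub> delta R {#Theta#} \<ominus>\<^bsub>P\<^esub> (\<one>\<^bsub>P\<^esub> \<oplus>\<^bsub>P\<^esub> \<one>\<^bsub>P\<^esub>)} \<union>
     {delta R {#Eps i#} \<otimes>\<^bsub>P\<^esub> delta R {#Eps i#} \<ominus>\<^bsub>P\<^esub> delta R {#Theta#} \<otimes>\<^bsub>P\<^esub> delta R {#Eps i#} | i. True}"

lemma J_eq: "J = Idl\<^bsub>P\<^esub> eps_relations"
  by (simp add: eps_ideal_def Let_def eps_relations_def)

lemma monomial_closed: "delta R m \<in> carrier P"
  by (rule P.delta_closed) simp

lemma monomial_mult: "delta R m \<otimes>\<^bsub>P\<^esub> delta R n = delta R (m + n)"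
  using P.delta_mult[of m n] by simp

lemma P_one: "\<one>\<^bsub>P\<^esub> = delta R {#}"
  by (simp add: P.F_simps)

lemma eps_relations_carrier: "eps_relations \<subseteq> carrier P"
  by (auto simp: eps_relations_def P_one monomial_closed monomial_mult)

lemma J_ideal: "ideal J P"
  unfolding J_eq
  by (intro ring.genideal_ideal unital_algebra.is_ring[OF P_unital_algebra] eps_relations_carrier)

lemma J_algebra_ideal: "algebra_ideal R P J"
  by (rule unital_algebra.ideal_is_algebra_ideal[OF P_unital_algebra J_ideal])

lemma E_unital_algebra: "unital_algebra R E"
  unfolding eps_alg_def
  by (rule unital_algebra.quot_unital_algebra[OF P_unital_algebra J_ideal])

lemma E_cring: "cring E"
proof -
  interpret J: algebra_ideal R P J by (rule J_algebra_ideal)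
  interpret ring E by (rule unital_algebra.is_ring[OF E_unital_algebra])
  have "X \<otimes>\<^bsub>E\<^esub> Y = Y \<otimes>\<^bsub>E\<^esub> X" if XY: "X \<in> carrier E" "Y \<in> carrier E" for X Y
  proof -
    obtain f where f: "f \<in> carrier P" "X = J.cls f"
      using XY(1) unfolding eps_alg_def by (rule J.cls_cases)
    obtain g where g: "g \<in> carrier P" "Y = J.cls g"
      using XY(2) unfolding eps_alg_def by (rule J.cls_cases)
    have "f \<otimes>\<^bsub>P\<^esub> g = g \<otimes>\<^bsub>P\<^esub> f"
      using f g by (intro P.F_mult_comm) (auto simp: add.commute)
    then show ?thesis using f g by (simp add: eps_alg_def J.cls_mult)
  qed
  then show ?thesis
    by (intro cring.intro ring_axioms comm_monoid.intro comm_monoid_axioms.intro monoid_axioms) auto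
qed

end

sublocale coefficient_ring_with_half \<subseteq> E: coefficient_ring "eps_alg R"
  by (intro coefficient_ring.intro E_cring)

sublocale coefficient_ring_with_half \<subseteq> EA: unital_algebra R "eps_alg R"
  by (rule E_unital_algebra)

context coefficient_ring_with_half begin

definition theta where "theta = J +>\<^bsub>P\<^esub> delta R {#Theta#}"

lemma theta_closed: "theta \<in> carrier E" and eps_closed: "eps R i \<in> carrier E"
  using algebra_ideal.cls_closed[OF J_algebra_ideal] monomial_closed
  by (auto simp: theta_def eps_def eps_alg_def)

lemma theta_sq: "theta \<otimes>\<^bsub>E\<^esub> theta = \<one>\<^bsub>E\<^esub> \<oplus>\<^bsub>E\<^esub> \<one>\<^bsub>E\<^esub>"
  and eps_sq: "eps R i \<otimes>\<^bsub>E\<^esub> eps R i = theta \<otimes>\<^bsub>E\<^esub> eps R i"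
proof -
  interpret J: algebra_ideal R P J by (rule J_algebra_ideal)
  have sub: "eps_relations \<subseteq> J"
    unfolding J_eq
    by (intro ring.genideal_self unital_algebra.is_ring[OF P_unital_algebra] eps_relations_carrier)
  have "delta R {#Theta#} \<otimes>\<^bsub>P\<^esub> delta R {#Theta#} \<ominus>\<^bsub>P\<^esub> (\<one>\<^bsub>P\<^esub> \<oplus>\<^bsub>P\<^esub> \<one>\<^bsub>P\<^esub>) \<in> J"
    using sub by (auto simp: eps_relations_def)
  then show "theta \<otimes>\<^bsub>E\<^esub> theta = \<one>\<^bsub>E\<^esub> \<oplus>\<^bsub>E\<^esub> \<one>\<^bsub>E\<^esub>"
    unfolding theta_def eps_alg_def J.quot_simps(3)
    by (simp add: J.cls_mult J.cls_add J.cls_eq_iff monomial_closed P_one monomial_mult)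
  have "delta R {#Eps i#} \<otimes>\<^bsub>P\<^esub> delta R {#Eps i#} \<ominus>\<^bsub>P\<^esub> delta R {#Theta#} \<otimes>\<^bsub>P\<^esub> delta R {#Eps i#} \<in> J"
    using sub unfolding eps_relations_def by blast
  then show "eps R i \<otimes>\<^bsub>E\<^esub> eps R i = theta \<otimes>\<^bsub>E\<^esub> eps R i"
    unfolding theta_def eps_alg_def eps_def
    by (simp add: J.cls_mult J.cls_eq_iff monomial_closed monomial_mult)
qed

definition half where "half = inv\<^bsub>R\<^esub> (\<one> \<oplus> \<one>)"

lemma half_closed: "half \<in> carrier R" and half_two: "half \<otimes> (\<one> \<oplus> \<one>) = \<one>"
  using two_unit by (auto simp: half_def)

lemma E_double: "x \<in> carrier E \<Longrightarrow> (\<one>\<^bsub>E\<^esub> \<oplus>\<^bsub>E\<^esub> \<one>\<^bsub>E\<^esub>) \<otimes>\<^bsub>E\<^esub> x = (\<one> \<oplus> \<one>) \<odot>\<^bsub>E\<^esub> x"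
  by (simp add: E.l_distr EA.smult_l_distr)

lemma half_double: "x \<in> carrier E \<Longrightarrow> half \<odot>\<^bsub>E\<^esub> ((\<one> \<oplus> \<one>) \<odot>\<^bsub>E\<^esub> x) = x"
  by (simp add: EA.smult_assoc1[symmetric] half_closed half_two)

text \<open>
  Dividing by \<open>\<theta>\<close> amounts to multiplying by \<open>\<theta>/2\<close>, so this is \<open>\<theta>\<^sup>-\<^sup>1 \<epsilon>\<^sub>i\<close>.
\<close>

definition idem where "idem i = half \<odot>\<^bsub>E\<^esub> (theta \<otimes>\<^bsub>E\<^esub> eps R i)"

lemma idem_closed: "idem i \<in> carrier E"
  by (simp add: idem_def half_closed theta_closed eps_closed)

lemma idem_mult: "idem i \<otimes>\<^bsub>E\<^esub> idem j = half \<odot>\<^bsub>E\<^esub> (eps R i \<otimes>\<^bsub>E\<^esub> eps R j)"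
proof -
  have "idem i \<otimes>\<^bsub>E\<^esub> idem j =
      half \<odot>\<^bsub>E\<^esub> (half \<odot>\<^bsub>E\<^esub> ((theta \<otimes>\<^bsub>E\<^esub> theta) \<otimes>\<^bsub>E\<^esub> (eps R i \<otimes>\<^bsub>E\<^esub> eps R j)))"
    by (simp add: idem_def EA.smult_mult_l EA.smult_mult_r half_closed theta_closed eps_closed E.m_ac)
  then show ?thesis
    by (simp add: theta_sq E_double half_double theta_closed eps_closed)
qed

lemma idem_idem: "idem i \<otimes>\<^bsub>E\<^esub> idem i = idem i"
  by (simp add: idem_mult eps_sq) (simp add: idem_def)

lemma eps_eps: "eps R i \<otimes>\<^bsub>E\<^esub> eps R j = idem i \<otimes>\<^bsub>E\<^esub> idem j \<oplus>\<^bsub>E\<^esub> idem i \<otimes>\<^bsub>E\<^esub> idem j"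
proof -
  let ?x = "eps R i \<otimes>\<^bsub>E\<^esub> eps R j"
  have "half \<odot>\<^bsub>E\<^esub> ?x \<oplus>\<^bsub>E\<^esub> half \<odot>\<^bsub>E\<^esub> ?x = half \<odot>\<^bsub>E\<^esub> ((\<one> \<oplus> \<one>) \<odot>\<^bsub>E\<^esub> ?x)"
    by (simp add: EA.smult_l_distr EA.smult_r_distr half_closed eps_closed)
  then show ?thesis by (simp add: idem_mult half_double eps_closed)
qed

lemma eps_eq: "eps R i = theta \<otimes>\<^bsub>E\<^esub> idem i"
proof -
  have "theta \<otimes>\<^bsub>E\<^esub> idem i = half \<odot>\<^bsub>E\<^esub> ((theta \<otimes>\<^bsub>E\<^esub> theta) \<otimes>\<^bsub>E\<^esub> eps R i)"
    by (simp add: idem_def EA.smult_mult_r half_closed theta_closed eps_closed E.m_assoc)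
  then show ?thesis by (simp add: theta_sq E_double half_double eps_closed)
qed

abbreviation Fe :: "((evar multiset \<Rightarrow> 'c) set, nat list \<Rightarrow> (evar multiset \<Rightarrow> 'c) set) module"
  where "Fe \<equiv> free_alg E"
abbreviation G0 where "G0 \<equiv> grassmann_over_eps R"
abbreviation G where "G \<equiv> grassmann_alg R"

definition grassmann_relations where
  "grassmann_relations =
    {(delta E [i] \<otimes>\<^bsub>Fe\<^esub> delta E [j] \<ominus>\<^bsub>Fe\<^esub> delta E [j] \<otimes>\<^bsub>Fe\<^esub> delta E [i])
       \<ominus>\<^bsub>Fe\<^esub> (eps R i \<otimes>\<^bsub>E\<^esub> eps R j) \<odot>\<^bsub>Fe\<^esub> (delta E [i] \<otimes>\<^bsub>Fe\<^esub> delta E [j]) | i j. True}"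

abbreviation K where "K \<equiv> Idl\<^bsub>Fe\<^esub> grassmann_relations"

lemma G0_eq: "G0 = quot_alg Fe K"
  by (simp add: grassmann_over_eps_def Let_def grassmann_relations_def)

lemma G_eq: "G = rescale G0 (\<lambda>c x. (c \<odot>\<^bsub>E\<^esub> \<one>\<^bsub>E\<^esub>) \<odot>\<^bsub>G0\<^esub> x)"
  by (simp add: grassmann_alg_def rescale_def)

lemma grassmann_relations_carrier: "grassmann_relations \<subseteq> carrier Fe"
  by (auto simp: grassmann_relations_def E.word_mult E.word_closed eps_closed)

lemma K_ideal: "ideal K Fe"
  by (intro ring.genideal_ideal unital_algebra.is_ring[OF E.free_unital_algebra]
      grassmann_relations_carrier)

lemma K_algebra_ideal: "algebra_ideal E Fe K"
  by (rule unital_algebra.ideal_is_algebra_ideal[OF E.free_unital_algebra K_ideal])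

lemma G0_unital_algebra: "unital_algebra E G0"
  unfolding G0_eq by (rule unital_algebra.quot_unital_algebra[OF E.free_unital_algebra K_ideal])

end

sublocale coefficient_ring_with_half \<subseteq> G0: unital_algebra "eps_alg R" "grassmann_over_eps R"
  by (rule G0_unital_algebra)

context coefficient_ring_with_half begin

definition e_gen where "e_gen i = K +>\<^bsub>Fe\<^esub> delta E [i]"

lemma e_gen_closed: "e_gen i \<in> carrier G0"
  using algebra_ideal.cls_closed[OF K_algebra_ideal] E.word_closed by (auto simp: G0_eq e_gen_def)

text \<open>
  The defining relation, rewritten as \<open>e\<^sub>j e\<^sub>i = (1 - 2 p\<^sub>i p\<^sub>j) e\<^sub>i e\<^sub>j\<close>.
\<close>

lemma e_gen_relation:
  "e_gen j \<otimes>\<^bsub>G0\<^esub> e_gen i = e_gen i \<otimes>\<^bsub>G0\<^esub> e_gen j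
     \<ominus>\<^bsub>G0\<^esub> (idem i \<otimes>\<^bsub>E\<^esub> idem j \<oplus>\<^bsub>E\<^esub> idem i \<otimes>\<^bsub>E\<^esub> idem j) \<odot>\<^bsub>G0\<^esub> (e_gen i \<otimes>\<^bsub>G0\<^esub> e_gen j)"
proof -
  interpret K: algebra_ideal E Fe K by (rule K_algebra_ideal)
  interpret cl: algebra_map E Fe K.Q "\<lambda>x. K.cls x" by (rule K.cls_algebra_map)
  let ?r = "(delta E [i] \<otimes>\<^bsub>Fe\<^esub> delta E [j] \<ominus>\<^bsub>Fe\<^esub> delta E [j] \<otimes>\<^bsub>Fe\<^esub> delta E [i])
       \<ominus>\<^bsub>Fe\<^esub> (eps R i \<otimes>\<^bsub>E\<^esub> eps R j) \<odot>\<^bsub>Fe\<^esub> (delta E [i] \<otimes>\<^bsub>Fe\<^esub> delta E [j])"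
  have "grassmann_relations \<subseteq> K"
    by (intro ring.genideal_self unital_algebra.is_ring[OF E.free_unital_algebra]
        grassmann_relations_carrier)
  moreover have r: "?r \<in> grassmann_relations" unfolding grassmann_relations_def by blast
  ultimately have "K.cls ?r = \<zero>\<^bsub>K.Q\<^esub>"
    using grassmann_relations_carrier by (subst K.cls_eq_zero_iff) auto
  moreover have "K.cls ?r = (e_gen i \<otimes>\<^bsub>K.Q\<^esub> e_gen j \<ominus>\<^bsub>K.Q\<^esub> e_gen j \<otimes>\<^bsub>K.Q\<^esub> e_gen i)
      \<ominus>\<^bsub>K.Q\<^esub> (eps R i \<otimes>\<^bsub>E\<^esub> eps R j) \<odot>\<^bsub>K.Q\<^esub> (e_gen i \<otimes>\<^bsub>K.Q\<^esub> e_gen j)"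
    by (simp add: e_gen_def cl.map_diff cl.map_mult[symmetric] cl.map_smult E.word_closed E.word_mult
        eps_closed)
  ultimately have rel: "(e_gen i \<otimes>\<^bsub>G0\<^esub> e_gen j \<ominus>\<^bsub>G0\<^esub> e_gen j \<otimes>\<^bsub>G0\<^esub> e_gen i)
      \<ominus>\<^bsub>G0\<^esub> (eps R i \<otimes>\<^bsub>E\<^esub> eps R j) \<odot>\<^bsub>G0\<^esub> (e_gen i \<otimes>\<^bsub>G0\<^esub> e_gen j) = \<zero>\<^bsub>G0\<^esub>"
    by (simp add: G0_eq)
  \<comment> \<open>The relation has the form \<open>(u - v) - w = 0\<close>; it is to be solved for \<open>v\<close>.\<close>
  have solve: "v = u \<ominus>\<^bsub>G0\<^esub> w"
    if "(u \<ominus>\<^bsub>G0\<^esub> v) \<ominus>\<^bsub>G0\<^esub> w = \<zero>\<^bsub>G0\<^esub>" "u \<in> carrier G0" "v \<in> carrier G0" "w \<in> carrier G0" for u v w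
  proof -
    interpret ring G0 by (rule G0.is_ring)
    have "v = v \<oplus>\<^bsub>G0\<^esub> ((u \<ominus>\<^bsub>G0\<^esub> v) \<ominus>\<^bsub>G0\<^esub> w)" using that by simp
    also have "\<dots> = u \<ominus>\<^bsub>G0\<^esub> w" using that(2-4) by algebra
    finally show ?thesis .
  qed
  show ?thesis unfolding eps_eps[symmetric]
    by (rule solve[OF rel]) (simp_all add: e_gen_closed G0.m_closed eps_closed)
qed

text \<open>
  The images of the generators of \<open>S\<close> in the Grassmann algebra. The even generators have to cover
  three kinds of central elements: number \<open>0\<close> goes to \<open>\<theta>\<close>, the other ones alternate between the even
  parts \<open>(1 - p\<^sub>i) e\<^sub>i\<close> and the idempotents \<open>p\<^sub>i\<close>.
\<close>

definition s_image :: "svar \<Rightarrow> (nat list \<Rightarrow> (evar multiset \<Rightarrow> 'c) set) set" where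
  "s_image x = (case x of
     Odd_gen i \<Rightarrow> idem i \<odot>\<^bsub>G0\<^esub> e_gen i
   | Even_gen k \<Rightarrow> (case k of
       0 \<Rightarrow> theta \<odot>\<^bsub>G0\<^esub> \<one>\<^bsub>G0\<^esub>
     | Suc n \<Rightarrow> (let i = n div 2 in
         if even n then (\<one>\<^bsub>E\<^esub> \<ominus>\<^bsub>E\<^esub> idem i) \<odot>\<^bsub>G0\<^esub> e_gen i else idem i \<odot>\<^bsub>G0\<^esub> \<one>\<^bsub>G0\<^esub>)))"

lemma s_image_simps:
  "s_image (Odd_gen i) = idem i \<odot>\<^bsub>G0\<^esub> e_gen i"
  "s_image (Even_gen 0) = theta \<odot>\<^bsub>G0\<^esub> \<one>\<^bsub>G0\<^esub>"
  "s_image (Even_gen (Suc (2 * i))) = (\<one>\<^bsub>E\<^esub> \<ominus>\<^bsub>E\<^esub> idem i) \<odot>\<^bsub>G0\<^esub> e_gen i"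
  "s_image (Even_gen (Suc (Suc (2 * i)))) = idem i \<odot>\<^bsub>G0\<^esub> \<one>\<^bsub>G0\<^esub>"
  by (simp_all add: s_image_def Let_def)

lemma s_image_cases:
  obtains (odd) i where "x = Odd_gen i" "s_image x = idem i \<odot>\<^bsub>G0\<^esub> e_gen i"
  | (even) i where "svar_degree x = 0" "s_image x = (\<one>\<^bsub>E\<^esub> \<ominus>\<^bsub>E\<^esub> idem i) \<odot>\<^bsub>G0\<^esub> e_gen i"
  | (scalar) c where "svar_degree x = 0" "c \<in> carrier E" "s_image x = c \<odot>\<^bsub>G0\<^esub> \<one>\<^bsub>G0\<^esub>"
proof (cases x)
  case (Even_gen k)
  show ?thesis
  proof (cases k)
    case 0
    then show ?thesis using Even_gen scalar[of theta] by (simp add: s_image_simps theta_closed)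
  next
    case (Suc n)
    show ?thesis
    proof (cases "even n")
      case True
      then show ?thesis using Even_gen Suc even[of "n div 2"] by (simp add: s_image_def Let_def)
    next
      case False
      then show ?thesis using Even_gen Suc scalar[of "idem (n div 2)"]
        by (simp add: s_image_def Let_def idem_closed)
    qed
  qed
qed (use odd in \<open>simp add: s_image_def\<close>)

lemma s_image_closed: "s_image x \<in> carrier G0"
  by (cases x rule: s_image_cases) (simp_all add: e_gen_closed idem_closed G0.unit_closed)

lemma G0_smult_smult:
  "\<lbrakk>c \<in> carrier E; d \<in> carrier E; x \<in> carrier G0; y \<in> carrier G0\<rbrakk> \<Longrightarrow>
     (c \<odot>\<^bsub>G0\<^esub> x) \<otimes>\<^bsub>G0\<^esub> (d \<odot>\<^bsub>G0\<^esub> y) = (c \<otimes>\<^bsub>E\<^esub> d) \<odot>\<^bsub>G0\<^esub> (x \<otimes>\<^bsub>G0\<^esub> y)"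
  by (simp add: G0.smult_mult_l G0.smult_mult_r G0.m_closed)
     (simp add: G0.smult_assoc1[symmetric] G0.m_closed E.m_comm)

text \<open>
  The sign in the relation disappears on the even part, as \<open>(1 - p\<^sub>i) p\<^sub>i = 0\<close>.
\<close>

lemma even_part_central:
  "((\<one>\<^bsub>E\<^esub> \<ominus>\<^bsub>E\<^esub> idem i) \<odot>\<^bsub>G0\<^esub> e_gen i) \<otimes>\<^bsub>G0\<^esub> e_gen j = e_gen j \<otimes>\<^bsub>G0\<^esub> ((\<one>\<^bsub>E\<^esub> \<ominus>\<^bsub>E\<^esub> idem i) \<odot>\<^bsub>G0\<^esub> e_gen i)"
proof -
  let ?q = "\<one>\<^bsub>E\<^esub> \<ominus>\<^bsub>E\<^esub> idem i" and ?u = "e_gen i \<otimes>\<^bsub>G0\<^esub> e_gen j"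
  let ?s = "idem i \<otimes>\<^bsub>E\<^esub> idem j \<oplus>\<^bsub>E\<^esub> idem i \<otimes>\<^bsub>E\<^esub> idem j"
  have cl: "?q \<in> carrier E" "?s \<in> carrier E" "?u \<in> carrier G0"
    by (simp_all add: idem_closed e_gen_closed G0.m_closed)
  have "?q \<otimes>\<^bsub>E\<^esub> idem i = idem i \<ominus>\<^bsub>E\<^esub> idem i \<otimes>\<^bsub>E\<^esub> idem i"
    using idem_closed[of i] by algebra
  then have "?q \<otimes>\<^bsub>E\<^esub> idem i = \<zero>\<^bsub>E\<^esub>" using idem_closed by (simp add: idem_idem E.r_neg a_minus_def)
  moreover have "?q \<otimes>\<^bsub>E\<^esub> ?s = (?q \<otimes>\<^bsub>E\<^esub> idem i) \<otimes>\<^bsub>E\<^esub> (idem j \<oplus>\<^bsub>E\<^esub> idem j)"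
    using idem_closed[of i] idem_closed[of j] by algebra
  ultimately have qs: "?q \<otimes>\<^bsub>E\<^esub> ?s = \<zero>\<^bsub>E\<^esub>" using idem_closed by simp
  have "e_gen j \<otimes>\<^bsub>G0\<^esub> (?q \<odot>\<^bsub>G0\<^esub> e_gen i) = ?q \<odot>\<^bsub>G0\<^esub> (e_gen j \<otimes>\<^bsub>G0\<^esub> e_gen i)"
    using cl by (simp add: G0.smult_mult_r e_gen_closed)
  also have "\<dots> = ?q \<odot>\<^bsub>G0\<^esub> (?u \<ominus>\<^bsub>G0\<^esub> ?s \<odot>\<^bsub>G0\<^esub> ?u)" by (simp only: e_gen_relation[of j i])
  also have "\<dots> = ?q \<odot>\<^bsub>G0\<^esub> ?u \<ominus>\<^bsub>G0\<^esub> (?q \<otimes>\<^bsub>E\<^esub> ?s) \<odot>\<^bsub>G0\<^esub> ?u"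
    using cl by (simp add: a_minus_def G0.smult_r_distr G0.smult_r_minus G0.smult_assoc1)
  also have "\<dots> = ?q \<odot>\<^bsub>G0\<^esub> ?u \<ominus>\<^bsub>G0\<^esub> \<zero>\<^bsub>G0\<^esub>"
    using cl by (simp only: qs G0.smult_l_null)
  also have "\<dots> = ?q \<odot>\<^bsub>G0\<^esub> ?u"
    using cl G0.M.minus_equality[of "\<zero>\<^bsub>G0\<^esub>" "\<zero>\<^bsub>G0\<^esub>"] by (simp add: a_minus_def)
  finally show ?thesis using cl by (simp add: G0.smult_mult_l e_gen_closed)
qed

text \<open>
  On the odd parts the factor \<open>1 - 2 p\<^sub>i p\<^sub>j\<close> acts as \<open>-1\<close>, as \<open>p\<^sub>i p\<^sub>j\<close> is idempotent.
\<close>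

lemma odd_parts_anticommute:
  "(idem i \<odot>\<^bsub>G0\<^esub> e_gen i) \<otimes>\<^bsub>G0\<^esub> (idem j \<odot>\<^bsub>G0\<^esub> e_gen j) =
     \<ominus>\<^bsub>G0\<^esub> ((idem j \<odot>\<^bsub>G0\<^esub> e_gen j) \<otimes>\<^bsub>G0\<^esub> (idem i \<odot>\<^bsub>G0\<^esub> e_gen i))"
proof -
  let ?p = "idem i \<otimes>\<^bsub>E\<^esub> idem j" and ?u = "e_gen i \<otimes>\<^bsub>G0\<^esub> e_gen j"
  have cl: "?p \<in> carrier E" "?u \<in> carrier G0"
    by (simp_all add: idem_closed e_gen_closed G0.m_closed)
  have "?p \<otimes>\<^bsub>E\<^esub> ?p = (idem i \<otimes>\<^bsub>E\<^esub> idem i) \<otimes>\<^bsub>E\<^esub> (idem j \<otimes>\<^bsub>E\<^esub> idem j)"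
    using idem_closed by (simp add: E.m_ac)
  then have pp: "?p \<otimes>\<^bsub>E\<^esub> ?p = ?p" by (simp add: idem_idem)
  have "(idem j \<odot>\<^bsub>G0\<^esub> e_gen j) \<otimes>\<^bsub>G0\<^esub> (idem i \<odot>\<^bsub>G0\<^esub> e_gen i) = ?p \<odot>\<^bsub>G0\<^esub> (e_gen j \<otimes>\<^bsub>G0\<^esub> e_gen i)"
    by (simp add: G0_smult_smult idem_closed e_gen_closed E.m_comm)
  also have "\<dots> = ?p \<odot>\<^bsub>G0\<^esub> (?u \<ominus>\<^bsub>G0\<^esub> (?p \<oplus>\<^bsub>E\<^esub> ?p) \<odot>\<^bsub>G0\<^esub> ?u)" by (simp only: e_gen_relation[of j i])
  also have "\<dots> = ?p \<odot>\<^bsub>G0\<^esub> ?u \<ominus>\<^bsub>G0\<^esub> (?p \<odot>\<^bsub>G0\<^esub> ?u \<oplus>\<^bsub>G0\<^esub> ?p \<odot>\<^bsub>G0\<^esub> ?u)"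
    using cl by (simp add: a_minus_def G0.smult_r_distr G0.smult_r_minus G0.smult_l_distr pp
        flip: G0.smult_assoc1)
  also have "\<dots> = \<ominus>\<^bsub>G0\<^esub> (?p \<odot>\<^bsub>G0\<^esub> ?u)"
  proof -
    interpret ring G0 by (rule G0.is_ring)
    have x: "?p \<odot>\<^bsub>G0\<^esub> ?u \<in> carrier G0" using cl by simp
    have "y \<ominus>\<^bsub>G0\<^esub> (y \<oplus>\<^bsub>G0\<^esub> y) = \<ominus>\<^bsub>G0\<^esub> y" if "y \<in> carrier G0" for y using that by algebra
    from this[OF x] show ?thesis .
  qed
  finally show ?thesis using cl by (simp add: G0_smult_smult idem_closed e_gen_closed)
qed

lemma G_unital_algebra: "unital_algebra R G"
  unfolding G_eq
proof (rule rescale_unital_algebra[OF C.is_cring G0.is_ring])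
  show "(\<lambda>c. (c \<odot>\<^bsub>E\<^esub> \<one>\<^bsub>E\<^esub>) \<odot>\<^bsub>G0\<^esub> \<one>\<^bsub>G0\<^esub>) \<in> ring_hom R G0"
    using ring_hom_trans[OF EA.unit_smult_ring_hom G0.unit_smult_ring_hom] by (simp add: comp_def)
  show "(c \<odot>\<^bsub>E\<^esub> \<one>\<^bsub>E\<^esub>) \<odot>\<^bsub>G0\<^esub> \<one>\<^bsub>G0\<^esub> \<otimes>\<^bsub>G0\<^esub> x = x \<otimes>\<^bsub>G0\<^esub> ((c \<odot>\<^bsub>E\<^esub> \<one>\<^bsub>E\<^esub>) \<odot>\<^bsub>G0\<^esub> \<one>\<^bsub>G0\<^esub>)"
    if "c \<in> carrier R" "x \<in> carrier G0" for c x
    using that by (intro G0.unit_smult_central) (simp_all add: EA.unit_closed)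
  show "(c \<odot>\<^bsub>E\<^esub> \<one>\<^bsub>E\<^esub>) \<odot>\<^bsub>G0\<^esub> x = (c \<odot>\<^bsub>E\<^esub> \<one>\<^bsub>E\<^esub>) \<odot>\<^bsub>G0\<^esub> \<one>\<^bsub>G0\<^esub> \<otimes>\<^bsub>G0\<^esub> x"
    if "c \<in> carrier R" "x \<in> carrier G0" for c x
    using that by (intro G0.smult_eq_mult) (simp_all add: EA.unit_closed)
qed

end

sublocale coefficient_ring_with_half \<subseteq> G: unital_algebra R "grassmann_alg R"
  by (rule G_unital_algebra)

context coefficient_ring_with_half begin

lemma G_simps:
  "carrier G = carrier G0" "monoid.mult G = monoid.mult G0" "one G = one G0" "zero G = zero G0"
  "add G = add G0" "c \<odot>\<^bsub>G\<^esub> x = (c \<odot>\<^bsub>E\<^esub> \<one>\<^bsub>E\<^esub>) \<odot>\<^bsub>G0\<^esub> x"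
  by (simp_all add: G_eq)

lemma G_uminus: "\<ominus>\<^bsub>G\<^esub> x = \<ominus>\<^bsub>G0\<^esub> x"
  by (simp add: a_inv_def m_inv_def G_simps)

lemma s_image_even_central:
  assumes "svar_degree x = 0"
  shows "s_image x \<otimes>\<^bsub>G0\<^esub> s_image y = s_image y \<otimes>\<^bsub>G0\<^esub> s_image x"
proof (cases x rule: s_image_cases)
  case (even i)
  let ?w = "(\<one>\<^bsub>E\<^esub> \<ominus>\<^bsub>E\<^esub> idem i) \<odot>\<^bsub>G0\<^esub> e_gen i"
  have w: "?w \<in> carrier G0" by (simp add: idem_closed e_gen_closed)
  have comm: "?w \<otimes>\<^bsub>G0\<^esub> (c \<odot>\<^bsub>G0\<^esub> z) = (c \<odot>\<^bsub>G0\<^esub> z) \<otimes>\<^bsub>G0\<^esub> ?w"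
    if "?w \<otimes>\<^bsub>G0\<^esub> z = z \<otimes>\<^bsub>G0\<^esub> ?w" "c \<in> carrier E" "z \<in> carrier G0" for c z
    using G0.smult_mult_r[OF that(2) w that(3)] G0.smult_mult_l[OF that(2,3) w] that(1) by simp
  have "?w \<otimes>\<^bsub>G0\<^esub> s_image y = s_image y \<otimes>\<^bsub>G0\<^esub> ?w"
  proof (cases y rule: s_image_cases)
    case (odd j)
    show ?thesis unfolding odd(2) by (rule comm[OF even_part_central idem_closed e_gen_closed])
  next
    case (even j)
    show ?thesis unfolding even(2)
      by (rule comm[OF even_part_central _ e_gen_closed]) (simp add: idem_closed)
  next
    case (scalar c)
    show ?thesis unfolding scalar(3)
      by (rule comm[OF _ scalar(2) G0.unit_closed]) (simp add: w G0.unit_l G0.unit_r)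
  qed
  then show ?thesis by (simp add: even)
next
  case (scalar c)
  then show ?thesis by (simp add: G0.unit_smult_central s_image_closed)
qed (use assms in auto)

lemma s_image_supercommute:
  "s_image x \<otimes>\<^bsub>G\<^esub> s_image y = sgn_pow R (svar_degree x * svar_degree y) \<odot>\<^bsub>G\<^esub> (s_image y \<otimes>\<^bsub>G\<^esub> s_image x)"
proof -
  have cl: "s_image y \<otimes>\<^bsub>G\<^esub> s_image x \<in> carrier G" by (simp add: G_simps s_image_closed G0.m_closed)
  consider "svar_degree x = 0" | "svar_degree y = 0" | i j where "x = Odd_gen i" "y = Odd_gen j"
    by (cases x; cases y) auto
  then show ?thesis
  proof cases
    case 1
    then show ?thesis using s_image_even_central[OF 1, of y] cl
      by (simp add: C.sgn_pow_simps) (simp add: G_simps)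
  next
    case 2
    then show ?thesis using s_image_even_central[OF 2, of x] cl
      by (simp add: C.sgn_pow_simps) (simp add: G_simps)
  next
    case 3
    then show ?thesis using odd_parts_anticommute[of i j] cl
      by (simp add: C.sgn_pow_simps G.smult_l_minus) (simp add: G_uminus G_simps(2) s_image_simps)
  qed
qed

abbreviation S_to_G where "S_to_G \<equiv> C.s_map G s_image"

lemma S_to_G: "unital_map R C.S G S_to_G" "S_to_G (C.s_gen x) = s_image x"
proof -
  have closed: "s_image x \<in> carrier G" for x by (simp add: G_simps(1) s_image_closed)
  show "unital_map R C.S G S_to_G"
    by (rule C.s_map_unital_map(1)[OF G_unital_algebra closed s_image_supercommute])
  show "S_to_G (C.s_gen x) = s_image x"
    by (rule C.s_map_unital_map(2)[OF G_unital_algebra closed s_image_supercommute])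
qed

text \<open>
  The image is a subalgebra over \<open>C\<close>. It contains the scalars \<open>\<theta>\<close> and \<open>\<epsilon>\<^sub>i = \<theta> p\<^sub>i\<close>, hence is closed
  under multiplication by all of \<open>C[\<epsilon>]\<close>, and it contains each \<open>e\<^sub>i\<close> as the sum of its two parts.
\<close>

lemma S_to_G_surj: "carrier G \<subseteq> S_to_G ` carrier C.S"
proof -
  interpret S: unital_algebra R C.S by (rule C.S_unital_algebra)
  interpret h: unital_map R C.S G S_to_G by (rule S_to_G)
  let ?I = "S_to_G ` carrier C.S"
  have mult: "x \<otimes>\<^bsub>G0\<^esub> y \<in> ?I" if "x \<in> ?I" "y \<in> ?I" for x y
    using h.image_mult[OF S.mult_closed_module that] by (simp add: G_simps)
  have add: "x \<oplus>\<^bsub>G0\<^esub> y \<in> ?I" if "x \<in> ?I" "y \<in> ?I" for x y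
    using h.image_closed(2)[OF that] by (simp add: G_simps)
  have zero: "\<zero>\<^bsub>G0\<^esub> \<in> ?I" using h.image_closed(1) by (simp add: G_simps)
  have one: "\<one>\<^bsub>G0\<^esub> \<in> ?I" using h.map_one S.unit_closed by (metis imageI G_simps(3))
  have gen: "s_image x \<in> ?I" for x using S_to_G(2) C.s_gen_closed by (metis imageI)
  have idem: "idem i \<odot>\<^bsub>G0\<^esub> \<one>\<^bsub>G0\<^esub> \<in> ?I" for i using gen[of "Even_gen (Suc (Suc (2 * i)))"] by (simp add: s_image_simps)
  have theta: "theta \<odot>\<^bsub>G0\<^esub> \<one>\<^bsub>G0\<^esub> \<in> ?I" using gen[of "Even_gen 0"] by (simp add: s_image_simps)
  have smult1: "(c \<otimes>\<^bsub>E\<^esub> d) \<odot>\<^bsub>G0\<^esub> \<one>\<^bsub>G0\<^esub> \<in> ?I"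
    if "c \<odot>\<^bsub>G0\<^esub> \<one>\<^bsub>G0\<^esub> \<in> ?I" "d \<odot>\<^bsub>G0\<^esub> \<one>\<^bsub>G0\<^esub> \<in> ?I" "c \<in> carrier E" "d \<in> carrier E" for c d
    using mult[OF that(1,2)] that(3,4) by (simp add: G0_smult_smult G0.unit_closed G0.unit_l)
  have eps: "eps R i \<odot>\<^bsub>G0\<^esub> \<one>\<^bsub>G0\<^esub> \<in> ?I" for i
    unfolding eps_eq by (rule smult1[OF theta idem theta_closed idem_closed])
  have e: "e_gen i \<in> ?I" for i
  proof -
    have "(\<one>\<^bsub>E\<^esub> \<ominus>\<^bsub>E\<^esub> idem i) \<oplus>\<^bsub>E\<^esub> idem i = \<one>\<^bsub>E\<^esub>" using idem_closed[of i] by algebra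
    then have "e_gen i = (\<one>\<^bsub>E\<^esub> \<ominus>\<^bsub>E\<^esub> idem i) \<odot>\<^bsub>G0\<^esub> e_gen i \<oplus>\<^bsub>G0\<^esub> idem i \<odot>\<^bsub>G0\<^esub> e_gen i"
      by (simp add: G0.smult_l_distr[symmetric] idem_closed e_gen_closed)
    moreover have "\<dots> \<in> ?I"
      using add[OF gen[of "Even_gen (Suc (2 * i))"] gen[of "Odd_gen i"]] by (simp add: s_image_simps)
    ultimately show ?thesis by simp
  qed
  have scalar: "c \<odot>\<^bsub>G0\<^esub> \<one>\<^bsub>G0\<^esub> \<in> ?I" if c: "c \<in> carrier E" for c
  proof -
    interpret J: algebra_ideal R P J by (rule J_algebra_ideal)
    have E: "E = J.Q" by (simp add: eps_alg_def)
    obtain f where f: "f \<in> carrier P" "c = J.cls f" using c unfolding E by (rule J.cls_cases)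
    have var: "J.cls (delta R {#x#}) \<odot>\<^bsub>G0\<^esub> \<one>\<^bsub>G0\<^esub> \<in> ?I" for x
      using theta eps by (cases x) (simp_all add: theta_def eps_def)
    have mon: "J.cls (delta R m) \<odot>\<^bsub>G0\<^esub> \<one>\<^bsub>G0\<^esub> \<in> ?I" for m
    proof (induction m)
      case empty
      have "J.cls (delta R {#}) = \<one>\<^bsub>E\<^esub>" by (simp add: E J.quot_simps(3) P_one)
      then show ?case using one by (simp add: G0.unit_closed)
    next
      case (add x m)
      have "J.cls (delta R (add_mset x m)) = J.cls (delta R {#x#}) \<otimes>\<^bsub>E\<^esub> J.cls (delta R m)"
        by (simp add: E J.cls_mult monomial_closed monomial_mult)
      then show ?case using smult1[OF var add.IH] by (simp add: E J.cls_closed monomial_closed)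
    qed
    have "J.cls f \<odot>\<^bsub>G0\<^esub> \<one>\<^bsub>G0\<^esub> \<in> ?I" using f(1)
    proof (induction f rule: P.monoid_alg_induct)
      case zero
      then show ?case using \<open>\<zero>\<^bsub>G0\<^esub> \<in> ?I\<close> by (simp add: J.cls_zero E[symmetric] G0.unit_closed)
    next
      case (delta m) show ?case by (rule mon)
    next
      case (add f g)
      have "J.cls (f \<oplus>\<^bsub>P\<^esub> g) = J.cls f \<oplus>\<^bsub>E\<^esub> J.cls g" using add by (simp add: E J.cls_add)
      moreover have "J.cls f \<in> carrier E" "J.cls g \<in> carrier E" using add by (simp_all add: E J.cls_closed)
      ultimately show ?case using add.IH \<open>\<And>x y. x \<in> ?I \<Longrightarrow> y \<in> ?I \<Longrightarrow> x \<oplus>\<^bsub>G0\<^esub> y \<in> ?I\<close>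
        by (simp add: G0.smult_l_distr G0.unit_closed)
    next
      case (smult k f)
      have fE: "J.cls f \<in> carrier E" using smult by (simp add: E J.cls_closed)
      have "J.cls (k \<odot>\<^bsub>P\<^esub> f) = k \<odot>\<^bsub>E\<^esub> J.cls f" using smult by (simp add: E J.cls_smult)
      also have "\<dots> = (k \<odot>\<^bsub>E\<^esub> \<one>\<^bsub>E\<^esub>) \<otimes>\<^bsub>E\<^esub> J.cls f" by (rule EA.smult_eq_mult[OF smult(1) fE])
      finally have "J.cls (k \<odot>\<^bsub>P\<^esub> f) \<odot>\<^bsub>G0\<^esub> \<one>\<^bsub>G0\<^esub> = k \<odot>\<^bsub>G\<^esub> (J.cls f \<odot>\<^bsub>G0\<^esub> \<one>\<^bsub>G0\<^esub>)"
        using smult fE by (simp add: G_simps G0.smult_assoc1 G0.unit_closed EA.unit_closed)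
      then show ?case using h.image_closed(3)[OF smult(1,3)] by simp
    qed
    then show ?thesis by (simp add: f)
  qed
  have "carrier G0 \<subseteq> ?I"
  proof (rule E.quot_free_alg_generated[OF K_ideal G0_eq zero one _ add])
    show "(K +>\<^bsub>Fe\<^esub> delta E [x]) \<otimes>\<^bsub>G0\<^esub> X \<in> ?I" if "X \<in> carrier G0" "X \<in> ?I" for x X
      using mult[OF e that(2)] by (simp add: e_gen_def)
    show "c \<odot>\<^bsub>G0\<^esub> X \<in> ?I" if "c \<in> carrier E" "X \<in> carrier G0" "X \<in> ?I" for c X
      using mult[OF scalar[OF that(1)] that(3)] G0.smult_eq_mult[OF that(1,2)] by simp
  qed
  then show ?thesis by (simp add: G_simps)
qed

end


section \<open>Adjoining a square root of two\<close>

text \<open>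
  \<open>B \<otimes> C[\<theta>]/(\<theta>\<^sup>2 - 2)\<close>, with the pair \<open>(a, b)\<close> standing for \<open>a + \<theta> b\<close>.
\<close>

definition sqrt2_ext :: "('c, 'b, 'm) module_scheme \<Rightarrow> ('c, 'b \<times> 'b) module" where
  "sqrt2_ext B = \<lparr>carrier = carrier B \<times> carrier B,
     monoid.mult = (\<lambda>(a, b) (c, d). (a \<otimes>\<^bsub>B\<^esub> c \<oplus>\<^bsub>B\<^esub> (b \<otimes>\<^bsub>B\<^esub> d \<oplus>\<^bsub>B\<^esub> b \<otimes>\<^bsub>B\<^esub> d),
                                 a \<otimes>\<^bsub>B\<^esub> d \<oplus>\<^bsub>B\<^esub> b \<otimes>\<^bsub>B\<^esub> c)),
     one = (\<one>\<^bsub>B\<^esub>, \<zero>\<^bsub>B\<^esub>),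
     zero = (\<zero>\<^bsub>B\<^esub>, \<zero>\<^bsub>B\<^esub>),
     add = (\<lambda>(a, b) (c, d). (a \<oplus>\<^bsub>B\<^esub> c, b \<oplus>\<^bsub>B\<^esub> d)),
     smult = (\<lambda>k (a, b). (k \<odot>\<^bsub>B\<^esub> a, k \<odot>\<^bsub>B\<^esub> b))\<rparr>"

lemma sqrt2_ext_simps [simp]:
  "carrier (sqrt2_ext B) = carrier B \<times> carrier B"
  "(a, b) \<otimes>\<^bsub>sqrt2_ext B\<^esub> (c, d) =
     (a \<otimes>\<^bsub>B\<^esub> c \<oplus>\<^bsub>B\<^esub> (b \<otimes>\<^bsub>B\<^esub> d \<oplus>\<^bsub>B\<^esub> b \<otimes>\<^bsub>B\<^esub> d), a \<otimes>\<^bsub>B\<^esub> d \<oplus>\<^bsub>B\<^esub> b \<otimes>\<^bsub>B\<^esub> c)"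
  "\<one>\<^bsub>sqrt2_ext B\<^esub> = (\<one>\<^bsub>B\<^esub>, \<zero>\<^bsub>B\<^esub>)" "\<zero>\<^bsub>sqrt2_ext B\<^esub> = (\<zero>\<^bsub>B\<^esub>, \<zero>\<^bsub>B\<^esub>)"
  "(a, b) \<oplus>\<^bsub>sqrt2_ext B\<^esub> (c, d) = (a \<oplus>\<^bsub>B\<^esub> c, b \<oplus>\<^bsub>B\<^esub> d)"
  "k \<odot>\<^bsub>sqrt2_ext B\<^esub> (a, b) = (k \<odot>\<^bsub>B\<^esub> a, k \<odot>\<^bsub>B\<^esub> b)"
  by (simp_all add: sqrt2_ext_def)

context unital_algebra begin

abbreviation D where "D \<equiv> sqrt2_ext A"

lemma sqrt2_ext_unital_algebra: "unital_algebra R D"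
proof -
  interpret ring A by (rule is_ring)
  have "abelian_group D"
  proof (rule abelian_groupI)
    fix x assume "x \<in> carrier D"
    then show "\<exists>y\<in>carrier D. y \<oplus>\<^bsub>D\<^esub> x = \<zero>\<^bsub>D\<^esub>"
      by (cases x) (auto intro!: bexI[of _ "(\<ominus> fst x, \<ominus> snd x)"] simp: M.l_neg)
  qed (auto simp: M.a_ac)
  then have "module R D"
    by (intro moduleI R.is_cring) (auto simp: smult_l_distr smult_r_distr smult_assoc1)
  then show ?thesis
  proof (intro unital_algebra.intro unital_algebra_axioms.intro assoc_algebra.intro assoc_algebra_axioms.intro)
    fix x y z assume "x \<in> carrier D" "y \<in> carrier D" "z \<in> carrier D"
    then obtain a a' b b' c c' where
      "x = (a, a')" "y = (b, b')" "z = (c, c')" and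
      [simp]: "a \<in> carrier A" "a' \<in> carrier A" "b \<in> carrier A" "b' \<in> carrier A"
        "c \<in> carrier A" "c' \<in> carrier A" by auto
    note xyz = this(1-3)
    show "(x \<otimes>\<^bsub>D\<^esub> y) \<otimes>\<^bsub>D\<^esub> z = x \<otimes>\<^bsub>D\<^esub> (y \<otimes>\<^bsub>D\<^esub> z)"
      by (simp add: xyz l_distr r_distr m_assoc M.a_ac)
    show "(x \<oplus>\<^bsub>D\<^esub> y) \<otimes>\<^bsub>D\<^esub> z = x \<otimes>\<^bsub>D\<^esub> z \<oplus>\<^bsub>D\<^esub> y \<otimes>\<^bsub>D\<^esub> z"
      by (simp add: xyz l_distr r_distr M.a_ac)
    show "z \<otimes>\<^bsub>D\<^esub> (x \<oplus>\<^bsub>D\<^esub> y) = z \<otimes>\<^bsub>D\<^esub> x \<oplus>\<^bsub>D\<^esub> z \<otimes>\<^bsub>D\<^esub> y"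
      by (simp add: xyz l_distr r_distr M.a_ac)
  qed (auto simp: smult_mult_l smult_mult_r smult_r_distr)
qed

lemma sqrt2_embed: "unital_map R A D (\<lambda>a. (a, \<zero>))"
proof -
  interpret ring A by (rule is_ring)
  interpret D: unital_algebra R D by (rule sqrt2_ext_unital_algebra)
  show ?thesis by unfold_locales auto
qed

lemma sqrt2_fst: "linear_map R D A fst"
proof -
  interpret D: unital_algebra R D by (rule sqrt2_ext_unital_algebra)
  show ?thesis by unfold_locales auto
qed

abbreviation sqrt2 where "sqrt2 \<equiv> (\<zero>, \<one>)"

lemma sqrt2_closed: "sqrt2 \<in> carrier D"
  by (simp add: unit_closed)

lemma sqrt2_sq: "sqrt2 \<otimes>\<^bsub>D\<^esub> sqrt2 = \<one>\<^bsub>D\<^esub> \<oplus>\<^bsub>D\<^esub> \<one>\<^bsub>D\<^esub>"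
proof -
  interpret ring A by (rule is_ring)
  show ?thesis by simp
qed

lemma sqrt2_central: "x \<in> carrier D \<Longrightarrow> sqrt2 \<otimes>\<^bsub>D\<^esub> x = x \<otimes>\<^bsub>D\<^esub> sqrt2"
proof -
  interpret ring A by (rule is_ring)
  show "x \<in> carrier D \<Longrightarrow> sqrt2 \<otimes>\<^bsub>D\<^esub> x = x \<otimes>\<^bsub>D\<^esub> sqrt2" by (cases x) auto
qed

end

section \<open>Specializing the parities\<close>

context coefficient_ring_with_half begin

abbreviation SS where "SS \<equiv> C.S"
abbreviation D where "D \<equiv> sqrt2_ext SS"

end

sublocale coefficient_ring_with_half \<subseteq> SA: unital_algebra R "free_supercomm_alg R"
  by (rule C.S_unital_algebra)

sublocale coefficient_ring_with_half \<subseteq> DA: unital_algebra R "sqrt2_ext (free_supercomm_alg R)"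
  by (rule SA.sqrt2_ext_unital_algebra)

context coefficient_ring_with_half begin

abbreviation root where "root \<equiv> SA.sqrt2"

text \<open>
  The value of a monomial in \<open>\<theta>\<close> and the \<open>\<epsilon>\<^sub>i\<close> under \<open>\<theta> \<mapsto> \<surd>2\<close>, \<open>\<epsilon>\<^sub>i \<mapsto> 0\<close> for even \<open>i\<close> and \<open>\<epsilon>\<^sub>i \<mapsto> \<surd>2\<close> for
  odd \<open>i\<close>. As \<open>\<epsilon>\<^sub>i = \<theta> p\<^sub>i\<close>, this is the specialization of \<open>p\<^sub>i\<close> to \<open>0\<close> or \<open>1\<close>.
\<close>

definition monomial_value :: "evar multiset \<Rightarrow> (svar list \<Rightarrow> 'c) set \<times> (svar list \<Rightarrow> 'c) set" where
  "monomial_value m =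
     (if \<exists>i. even i \<and> Eps i \<in># m then \<zero>\<^bsub>D\<^esub> else root [^]\<^bsub>D\<^esub> size m)"

lemma monomial_value_closed: "monomial_value m \<in> carrier D"
proof -
  interpret D: ring D by (rule DA.is_ring)
  show ?thesis unfolding monomial_value_def using DA.M.zero_closed D.nat_pow_closed[OF SA.sqrt2_closed] by presburger
qed

lemma monomial_value_mult: "monomial_value (m + n) = monomial_value m \<otimes>\<^bsub>D\<^esub> monomial_value n"
proof -
  interpret D: ring D by (rule DA.is_ring)
  let ?even = "\<lambda>m. \<exists>i. even i \<and> Eps i \<in># m"
  consider "?even m" | "?even n" | "\<not> ?even m" "\<not> ?even n" by blast
  then show ?thesis
  proof cases
    case 1
    then have "monomial_value m = \<zero>\<^bsub>D\<^esub>" "monomial_value (m + n) = \<zero>\<^bsub>D\<^esub>"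
      unfolding monomial_value_def by auto
    then show ?thesis using D.l_null[OF monomial_value_closed] by metis
  next
    case 2
    then have "monomial_value n = \<zero>\<^bsub>D\<^esub>" "monomial_value (m + n) = \<zero>\<^bsub>D\<^esub>"
      unfolding monomial_value_def by auto
    then show ?thesis using D.r_null[OF monomial_value_closed] by metis
  next
    case 3
    then have "\<not> ?even (m + n)" by auto
    with 3 show ?thesis
      by (simp only: monomial_value_def D.nat_pow_mult[OF SA.sqrt2_closed] size_union if_False)
  qed
qed

definition poly_eval where "poly_eval = linear_extension R D monomial_value"

lemma poly_eval_unital_map: "unital_map R P D poly_eval"
  unfolding poly_eval_def
proof (rule P.linear_extension_unital_map[OF DA.unital_algebra_axioms])
  interpret D: ring D by (rule DA.is_ring)
  show "monomial_value \<one>\<^bsub>\<lparr>carrier = UNIV, monoid.mult = (+), one = {#}\<rparr>\<^esub> = \<one>\<^bsub>D\<^esub>"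
    by (simp add: monomial_value_def del: sqrt2_ext_simps)
qed (simp_all add: monomial_value_mult monomial_value_closed del: sqrt2_ext_simps)

lemma poly_eval_monomial: "poly_eval (delta R m) = monomial_value m"
  unfolding poly_eval_def
  by (rule P.linear_extension_delta[OF DA.module_axioms]) (use monomial_value_closed in auto)

definition scalar_value where "scalar_value = quot_map poly_eval"

text \<open>
  Both kinds of relations of \<open>C[\<epsilon>]\<close> hold for the chosen values: \<open>\<theta>\<^sup>2 = 2\<close> by construction, and
  \<open>x\<^sup>2 = \<theta> x\<close> for \<open>x = 0\<close> and for \<open>x = \<theta>\<close>.
\<close>

lemma scalar_value_unital_map: "unital_map R E D scalar_value"
  and scalar_value_cls: "f \<in> carrier P \<Longrightarrow> scalar_value (J +>\<^bsub>P\<^esub> f) = poly_eval f"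
proof -
  interpret D: ring D by (rule DA.is_ring)
  interpret h: unital_map R P D poly_eval by (rule poly_eval_unital_map)
  have root: "root \<otimes>\<^bsub>D\<^esub> root = \<one>\<^bsub>D\<^esub> \<oplus>\<^bsub>D\<^esub> \<one>\<^bsub>D\<^esub>" by (rule SA.sqrt2_sq)
  have theta: "monomial_value {#Theta#} = root"
    using D.l_one[OF SA.sqrt2_closed] by (simp add: monomial_value_def del: sqrt2_ext_simps)
  have eps: "monomial_value {#Eps i#} = (if even i then \<zero>\<^bsub>D\<^esub> else root)" for i
    using D.l_one[OF SA.sqrt2_closed] by (simp add: monomial_value_def del: sqrt2_ext_simps)
  have self: "x \<ominus>\<^bsub>D\<^esub> x = \<zero>\<^bsub>D\<^esub>" if "x \<in> carrier D" for x
    using that unfolding a_minus_def by (rule DA.M.r_neg)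
  have kill: "poly_eval r = \<zero>\<^bsub>D\<^esub>" if "r \<in> eps_relations" for r
  proof -
    from that consider
        "r = delta R {#Theta#} \<otimes>\<^bsub>P\<^esub> delta R {#Theta#} \<ominus>\<^bsub>P\<^esub> (\<one>\<^bsub>P\<^esub> \<oplus>\<^bsub>P\<^esub> \<one>\<^bsub>P\<^esub>)"
      | i where "r = delta R {#Eps i#} \<otimes>\<^bsub>P\<^esub> delta R {#Eps i#} \<ominus>\<^bsub>P\<^esub> delta R {#Theta#} \<otimes>\<^bsub>P\<^esub> delta R {#Eps i#}"
      unfolding eps_relations_def by blast
    then show ?thesis
    proof cases
      case 1
      have "poly_eval r = root \<otimes>\<^bsub>D\<^esub> root \<ominus>\<^bsub>D\<^esub> (\<one>\<^bsub>D\<^esub> \<oplus>\<^bsub>D\<^esub> \<one>\<^bsub>D\<^esub>)"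
        unfolding 1 using monomial_closed unital_algebra.unit_closed[OF P_unital_algebra] P.F_mult_closed
        by (simp add: h.map_diff h.map_add h.map_mult h.map_one poly_eval_monomial theta
            del: sqrt2_ext_simps)
      then show ?thesis unfolding root self[OF DA.M.a_closed[OF DA.unit_closed DA.unit_closed]] .
    next
      case (2 i)
      let ?v = "if even i then \<zero>\<^bsub>D\<^esub> else root"
      have "poly_eval r = ?v \<otimes>\<^bsub>D\<^esub> ?v \<ominus>\<^bsub>D\<^esub> root \<otimes>\<^bsub>D\<^esub> ?v"
        unfolding 2 using monomial_closed P.F_mult_closed
        by (simp only: h.map_diff h.map_mult poly_eval_monomial theta eps)
      moreover have "?v \<otimes>\<^bsub>D\<^esub> ?v = root \<otimes>\<^bsub>D\<^esub> ?v"

        by (cases "even i")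
           (simp_all only: if_True if_False D.l_null[OF DA.M.zero_closed] D.r_null[OF SA.sqrt2_closed])
      moreover have "root \<otimes>\<^bsub>D\<^esub> ?v \<in> carrier D"
        by (intro DA.m_closed SA.sqrt2_closed) (simp only: DA.M.zero_closed SA.sqrt2_closed simp_thms split: if_split)
      ultimately show ?thesis by (simp only: self)
    qed
  qed
  show "unital_map R E D scalar_value"
    unfolding scalar_value_def eps_alg_def J_eq
    by (rule h.quot_genideal_map(1)[OF P_unital_algebra DA.unital_algebra_axioms eps_relations_carrier kill])
  show "scalar_value (J +>\<^bsub>P\<^esub> f) = poly_eval f" if "f \<in> carrier P"
    unfolding scalar_value_def J_eq
    by (rule h.quot_genideal_map(2)[OF P_unital_algebra DA.unital_algebra_axioms eps_relations_carrier kill that])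
qed

lemma scalar_value_gens:
  "scalar_value theta = root" "scalar_value (eps R i) = (if even i then \<zero>\<^bsub>D\<^esub> else root)"
proof -
  interpret D: ring D by (rule DA.is_ring)
  show "scalar_value theta = root" "scalar_value (eps R i) = (if even i then \<zero>\<^bsub>D\<^esub> else root)"
    using D.l_one[OF SA.sqrt2_closed]
    by (simp_all add: theta_def eps_def scalar_value_cls monomial_closed poly_eval_monomial
        monomial_value_def del: sqrt2_ext_simps)
qed

lemma scalar_value_central:
  assumes c: "c \<in> carrier E" and x: "x \<in> carrier D"
  shows "scalar_value c \<otimes>\<^bsub>D\<^esub> x = x \<otimes>\<^bsub>D\<^esub> scalar_value c"
proof -
  interpret D: ring D by (rule DA.is_ring)
  interpret J: algebra_ideal R P J by (rule J_algebra_ideal)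
  interpret h: unital_map R P D poly_eval by (rule poly_eval_unital_map)
  obtain f where f: "f \<in> carrier P" "c = J.cls f"
    using c unfolding eps_alg_def by (rule J.cls_cases)
  have pow: "root [^]\<^bsub>D\<^esub> (k::nat) \<otimes>\<^bsub>D\<^esub> x = x \<otimes>\<^bsub>D\<^esub> root [^]\<^bsub>D\<^esub> k" for k
    by (rule D.group_commutes_pow[OF SA.sqrt2_central[OF x] SA.sqrt2_closed x])
  have "poly_eval f \<otimes>\<^bsub>D\<^esub> x = x \<otimes>\<^bsub>D\<^esub> poly_eval f" using f(1)
  proof (induction f rule: P.monoid_alg_induct)
    case zero
    show ?case unfolding h.map_zero using D.l_null[OF x] D.r_null[OF x] by simp
  next
    case (delta m)
    show ?case unfolding poly_eval_monomial monomial_value_def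
      using D.l_null[OF x] D.r_null[OF x] pow by presburger
  next
    case (add f g)
    then show ?case
      by (simp only: h.map_add D.l_distr[OF h.map_closed h.map_closed x] D.r_distr[OF h.map_closed h.map_closed x])
  next
    case (smult k f)
    then show ?case
      by (simp only: h.map_smult DA.smult_mult_l[OF _ h.map_closed x] DA.smult_mult_r[OF _ x h.map_closed])
  qed
  then show ?thesis using f by (simp add: scalar_value_cls)
qed

definition D_over_E where "D_over_E = rescale D (\<lambda>c x. scalar_value c \<otimes>\<^bsub>D\<^esub> x)"

lemma D_over_E_unital_algebra: "unital_algebra E D_over_E"
proof -
  interpret v: unital_map R E D scalar_value by (rule scalar_value_unital_map)
  show ?thesis unfolding D_over_E_def
  proof (rule rescale_unital_algebra[OF E_cring DA.is_ring _ scalar_value_central])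
    show "scalar_value \<in> ring_hom E D"
      by (rule ring_hom_memI) (simp_all only: v.map_closed v.map_mult v.map_add v.map_one)
  qed auto
qed

text \<open>
  After the specialization, \<open>e\<^sub>i\<close> is even for even \<open>i\<close> and odd for odd \<open>i\<close>; it is sent to a generator of
  \<open>S\<close> of that parity.
\<close>

definition e_image where
  "e_image i = (C.s_gen (if even i then Even_gen (i div 2) else Odd_gen (i div 2)), \<zero>\<^bsub>SS\<^esub>)"

lemma e_image_closed: "e_image i \<in> carrier D"
  by (simp add: e_image_def C.s_gen_closed)

lemma e_image_commute:
  "e_image j \<otimes>\<^bsub>D\<^esub> e_image i =
     (if odd i \<and> odd j then \<ominus>\<^bsub>D\<^esub> (e_image i \<otimes>\<^bsub>D\<^esub> e_image j) else e_image i \<otimes>\<^bsub>D\<^esub> e_image j)"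
proof -
  interpret h: unital_map R SS D "\<lambda>a. (a, \<zero>\<^bsub>SS\<^esub>)" by (rule SA.sqrt2_embed)
  let ?x = "\<lambda>i::nat. if even i then Even_gen (i div 2) else Odd_gen (i div 2)"
  have cl: "C.s_gen (?x i) \<otimes>\<^bsub>SS\<^esub> C.s_gen (?x j) \<in> carrier SS"
    by (intro SA.m_closed C.s_gen_closed)
  have "C.s_gen (?x j) \<otimes>\<^bsub>SS\<^esub> C.s_gen (?x i) = (if odd i \<and> odd j
      then \<ominus>\<^bsub>SS\<^esub> (C.s_gen (?x i) \<otimes>\<^bsub>SS\<^esub> C.s_gen (?x j)) else C.s_gen (?x i) \<otimes>\<^bsub>SS\<^esub> C.s_gen (?x j))"
    using cl by (subst C.s_gen_supercommute) (auto simp: C.sgn_pow_simps SA.smult_l_minus)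
  moreover have mult: "e_image i \<otimes>\<^bsub>D\<^esub> e_image j = (C.s_gen (?x i) \<otimes>\<^bsub>SS\<^esub> C.s_gen (?x j), \<zero>\<^bsub>SS\<^esub>)" for i j
    unfolding e_image_def by (rule h.map_mult[OF C.s_gen_closed C.s_gen_closed, symmetric])
  moreover have "\<ominus>\<^bsub>D\<^esub> (C.s_gen (?x i) \<otimes>\<^bsub>SS\<^esub> C.s_gen (?x j), \<zero>\<^bsub>SS\<^esub>) =
      (\<ominus>\<^bsub>SS\<^esub> (C.s_gen (?x i) \<otimes>\<^bsub>SS\<^esub> C.s_gen (?x j)), \<zero>\<^bsub>SS\<^esub>)"
    by (rule h.map_neg[OF cl, symmetric])
  ultimately show ?thesis by presburger
qed

definition G_to_D where "G_to_D = quot_map (free_map E D_over_E e_image)"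

lemma D_over_E_simps:
  "carrier D_over_E = carrier D" "monoid.mult D_over_E = monoid.mult D" "one D_over_E = one D"
  "zero D_over_E = zero D" "add D_over_E = add D" "c \<odot>\<^bsub>D_over_E\<^esub> x = scalar_value c \<otimes>\<^bsub>D\<^esub> x"
  by (simp_all only: D_over_E_def rescale_simps)

lemma D_over_E_diff: "x \<ominus>\<^bsub>D_over_E\<^esub> y = x \<ominus>\<^bsub>D\<^esub> y"
  by (simp only: a_minus_def a_inv_def m_inv_def D_over_E_simps monoid.simps partial_object.simps)

text \<open>
  If \<open>i\<close> and \<open>j\<close> are odd, then \<open>\<epsilon>\<^sub>i \<epsilon>\<^sub>j\<close> has the value \<open>2\<close> and the relation says that the images of
  \<open>e\<^sub>i\<close> and \<open>e\<^sub>j\<close> anticommute; otherwise it has the value \<open>0\<close> and the relation says that they commute.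
\<close>

lemma G0_to_D_unital_map: "unital_map E G0 D_over_E G_to_D"
  and G_to_D_gen: "G_to_D (e_gen i) = e_image i"
proof -
  interpret D: ring D by (rule DA.is_ring)
  interpret v: unital_map R E D scalar_value by (rule scalar_value_unital_map)
  have cl: "e_image i \<in> carrier D_over_E" for i by (simp only: D_over_E_simps e_image_closed)
  let ?h = "free_map E D_over_E e_image"
  interpret h: unital_map E Fe D_over_E ?h
    by (rule E.free_map_unital_map[OF D_over_E_unital_algebra cl])
  have gen: "?h (delta E [i]) = e_image i" for i
    by (rule E.free_map_generator[OF D_over_E_unital_algebra cl])
  have kill: "?h r = \<zero>\<^bsub>D_over_E\<^esub>" if rel: "r \<in> grassmann_relations" for r
  proof -
    obtain i j where r: "r = (delta E [i] \<otimes>\<^bsub>Fe\<^esub> delta E [j] \<ominus>\<^bsub>Fe\<^esub> delta E [j] \<otimes>\<^bsub>Fe\<^esub> delta E [i])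
       \<ominus>\<^bsub>Fe\<^esub> (eps R i \<otimes>\<^bsub>E\<^esub> eps R j) \<odot>\<^bsub>Fe\<^esub> (delta E [i] \<otimes>\<^bsub>Fe\<^esub> delta E [j])"
      using rel unfolding grassmann_relations_def by blast
    let ?u = "e_image i \<otimes>\<^bsub>D\<^esub> e_image j"
    have u: "?u \<in> carrier D" by (intro D.m_closed e_image_closed)
    have "?h r = (?u \<ominus>\<^bsub>D\<^esub> e_image j \<otimes>\<^bsub>D\<^esub> e_image i)
        \<ominus>\<^bsub>D\<^esub> (scalar_value (eps R i) \<otimes>\<^bsub>D\<^esub> scalar_value (eps R j)) \<otimes>\<^bsub>D\<^esub> ?u"
    proof -
      have ab: "delta E [i] \<otimes>\<^bsub>Fe\<^esub> delta E [j] \<in> carrier Fe" for i j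
        by (intro E.W.FA.m_closed E.word_closed)
      have s: "eps R i \<otimes>\<^bsub>E\<^esub> eps R j \<in> carrier E" by (intro EA.m_closed eps_closed)
      show ?thesis
        unfolding r
        by (simp only: h.map_diff[OF E.W.FA.M.minus_closed[OF ab ab] E.W.FA.smult_closed[OF s ab]]
            h.map_diff[OF ab ab] h.map_smult[OF s ab] h.map_mult[OF E.word_closed E.word_closed] gen
            v.map_mult[OF eps_closed eps_closed] D_over_E_diff D_over_E_simps)
    qed
    also have "\<dots> = \<zero>\<^bsub>D\<^esub>"
    proof (cases "odd i \<and> odd j")
      case True
      have "(y \<ominus>\<^bsub>D\<^esub> (\<ominus>\<^bsub>D\<^esub> y)) \<ominus>\<^bsub>D\<^esub> (\<one>\<^bsub>D\<^esub> \<oplus>\<^bsub>D\<^esub> \<one>\<^bsub>D\<^esub>) \<otimes>\<^bsub>D\<^esub> y = \<zero>\<^bsub>D\<^esub>" if "y \<in> carrier D" for y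
        using that by (simp only: D.l_distr D.one_closed D.l_one a_minus_def DA.M.minus_minus DA.M.r_neg DA.M.a_closed)
      from this[OF u] show ?thesis
        unfolding e_image_commute[of j i] using True by (simp only: scalar_value_gens SA.sqrt2_sq if_True if_False simp_thms)
    next
      case False
      have z: "scalar_value (eps R i) \<otimes>\<^bsub>D\<^esub> scalar_value (eps R j) = \<zero>\<^bsub>D\<^esub>"

        using False unfolding scalar_value_gens
        by (cases "even i"; cases "even j")
           (simp_all only: if_True if_False D.l_null[OF DA.M.zero_closed] D.l_null[OF SA.sqrt2_closed]
             D.r_null[OF SA.sqrt2_closed] simp_thms)
      have "(y \<ominus>\<^bsub>D\<^esub> y) \<ominus>\<^bsub>D\<^esub> \<zero>\<^bsub>D\<^esub> \<otimes>\<^bsub>D\<^esub> y = \<zero>\<^bsub>D\<^esub>" if "y \<in> carrier D" for y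
        using that by (simp only: D.l_null a_minus_def DA.M.r_neg DA.M.zero_closed DA.M.l_zero D.minus_zero)
      from this[OF u] show ?thesis
        unfolding z e_image_commute[of j i] using False by (simp only: if_False)
    qed
    finally show ?thesis by (simp only: D_over_E_simps)
  qed
  show "unital_map E G0 D_over_E G_to_D"
    unfolding G_to_D_def G0_eq
    by (rule h.quot_genideal_map(1)[OF E.free_unital_algebra D_over_E_unital_algebra
          grassmann_relations_carrier kill])
  show "G_to_D (e_gen i) = e_image i"
    unfolding G_to_D_def e_gen_def
    by (rule trans[OF h.quot_genideal_map(2)[OF E.free_unital_algebra D_over_E_unital_algebra
          grassmann_relations_carrier kill E.word_closed] gen])
qed

lemma G_to_D_unital_map: "unital_map R G D G_to_D"
proof -
  interpret g: unital_map E G0 D_over_E G_to_D by (rule G0_to_D_unital_map)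
  interpret v: unital_map R E D scalar_value by (rule scalar_value_unital_map)
  show ?thesis
  proof unfold_locales
    fix x assume x: "x \<in> carrier G"
    then show "G_to_D x \<in> carrier D" using g.map_closed[of x] by (simp only: G_simps D_over_E_simps)
    fix c assume c: "c \<in> carrier R"
    have cE: "c \<odot>\<^bsub>E\<^esub> \<one>\<^bsub>E\<^esub> \<in> carrier E" using c by (intro EA.smult_closed EA.unit_closed)
    have "G_to_D (c \<odot>\<^bsub>G\<^esub> x) = scalar_value (c \<odot>\<^bsub>E\<^esub> \<one>\<^bsub>E\<^esub>) \<otimes>\<^bsub>D\<^esub> G_to_D x"
      using g.map_smult[OF cE] x by (simp only: G_simps D_over_E_simps)
    also have "\<dots> = (c \<odot>\<^bsub>D\<^esub> \<one>\<^bsub>D\<^esub>) \<otimes>\<^bsub>D\<^esub> G_to_D x"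
      by (simp only: v.map_smult[OF c EA.unit_closed] v.map_one)
    also have "\<dots> = c \<odot>\<^bsub>D\<^esub> G_to_D x"
      using g.map_closed[of x] x c by (intro DA.smult_eq_mult[symmetric]) (simp_all only: G_simps D_over_E_simps)
    finally show "G_to_D (c \<odot>\<^bsub>G\<^esub> x) = c \<odot>\<^bsub>D\<^esub> G_to_D x" .
  next
    fix x y assume "x \<in> carrier G" "y \<in> carrier G"
    then show "G_to_D (x \<oplus>\<^bsub>G\<^esub> y) = G_to_D x \<oplus>\<^bsub>D\<^esub> G_to_D y"
      and "G_to_D (x \<otimes>\<^bsub>G\<^esub> y) = G_to_D x \<otimes>\<^bsub>D\<^esub> G_to_D y"
      using g.map_add[of x y] g.map_mult[of x y] by (simp_all only: G_simps D_over_E_simps)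
  next
    show "G_to_D \<one>\<^bsub>G\<^esub> = \<one>\<^bsub>D\<^esub>" using g.map_one by (simp only: G_simps D_over_E_simps)
  qed
qed

text \<open>
  The image is a subalgebra that contains all generators of \<open>S\<close>, hence \<open>S\<close>, and the square root of \<open>2\<close>.
\<close>

lemma G_to_D_surj: "carrier D \<subseteq> G_to_D ` carrier G"
proof
  interpret S: ring SS by (rule SA.is_ring)
  interpret g: unital_map R G D G_to_D by (rule G_to_D_unital_map)
  interpret g0: unital_map E G0 D_over_E G_to_D by (rule G0_to_D_unital_map)
  interpret \<iota>: unital_map R SS D "\<lambda>a. (a, \<zero>\<^bsub>SS\<^esub>)" by (rule SA.sqrt2_embed)
  let ?I = "G_to_D ` carrier G"
  let ?T = "{a \<in> carrier SS. (a, \<zero>\<^bsub>SS\<^esub>) \<in> ?I}"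
  note mult = g.image_mult[OF G.mult_closed_module]
  have gen: "(C.s_gen x, \<zero>\<^bsub>SS\<^esub>) \<in> ?I" for x
  proof -
    \<comment> \<open>The index of a Grassmann generator that is sent to \<open>x\<close>.\<close>
    define i where "i = (case x of Even_gen k \<Rightarrow> 2 * k | Odd_gen k \<Rightarrow> Suc (2 * k))"
    have "(C.s_gen x, \<zero>\<^bsub>SS\<^esub>) = G_to_D (e_gen i)"
      unfolding G_to_D_gen e_image_def i_def by (cases x) simp_all
    then show ?thesis using e_gen_closed by (simp add: G_simps)
  qed
  have "carrier SS \<subseteq> ?T"
  proof (rule C.quot_free_alg_generated[OF C.supercommutator_ideal C.S_eq])
    show "\<zero>\<^bsub>SS\<^esub> \<in> ?T" using g.image_closed(1) by simp
    show "\<one>\<^bsub>SS\<^esub> \<in> ?T" using g.map_one G.unit_closed SA.unit_closed by (auto simp: image_iff intro!: bexI[of _ "\<one>\<^bsub>G\<^esub>"])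
    show "(Idl\<^bsub>C.Fs\<^esub> C.supercommutators +>\<^bsub>C.Fs\<^esub> delta R [x]) \<otimes>\<^bsub>SS\<^esub> X \<in> ?T" if "X \<in> carrier SS" "X \<in> ?T" for x X
    proof -
      have X: "(X, \<zero>\<^bsub>SS\<^esub>) \<in> ?I" using that by simp
      have "(C.s_gen x \<otimes>\<^bsub>SS\<^esub> X, \<zero>\<^bsub>SS\<^esub>) \<in> ?I"
        unfolding \<iota>.map_mult[OF C.s_gen_closed that(1)] by (rule mult[OF gen X])
      then show ?thesis using that SA.m_closed[OF C.s_gen_closed] unfolding C.s_gen_def[symmetric] by blast
    qed
    show "X \<oplus>\<^bsub>SS\<^esub> Y \<in> ?T" if "X \<in> ?T" "Y \<in> ?T" for X Y
      using that g.image_closed(2)[of "(X, \<zero>\<^bsub>SS\<^esub>)" "(Y, \<zero>\<^bsub>SS\<^esub>)"] by simp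
    show "c \<odot>\<^bsub>SS\<^esub> X \<in> ?T" if "c \<in> carrier R" "X \<in> carrier SS" "X \<in> ?T" for c X
      using that g.image_closed(3)[of c "(X, \<zero>\<^bsub>SS\<^esub>)"] by simp
  qed
  then have emb: "(a, \<zero>\<^bsub>SS\<^esub>) \<in> ?I" if "a \<in> carrier SS" for a using that by blast
  have "root = G_to_D (theta \<odot>\<^bsub>G0\<^esub> \<one>\<^bsub>G0\<^esub>)"
  proof -
    have "G_to_D (theta \<odot>\<^bsub>G0\<^esub> \<one>\<^bsub>G0\<^esub>) = root \<otimes>\<^bsub>D\<^esub> \<one>\<^bsub>D\<^esub>"
      by (simp only: g0.map_smult[OF theta_closed G0.unit_closed] g0.map_one D_over_E_simps scalar_value_gens)
    then show ?thesis by (simp only: DA.unit_r[OF SA.sqrt2_closed])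
  qed
  then have root: "root \<in> ?I"
    using G0.smult_closed[OF theta_closed G0.unit_closed] by (metis imageI G_simps(1))
  fix x assume "x \<in> carrier D"
  then obtain a b where ab: "x = (a, b)" "a \<in> carrier SS" "b \<in> carrier SS" by auto
  then have "x = (a, \<zero>\<^bsub>SS\<^esub>) \<oplus>\<^bsub>D\<^esub> root \<otimes>\<^bsub>D\<^esub> (b, \<zero>\<^bsub>SS\<^esub>)" by simp
  then show "x \<in> ?I" using g.image_closed(2)[OF emb[OF ab(2)] mult[OF root emb[OF ab(3)]]] by simp
qed

end

section \<open>Equality of the identities\<close>

context coefficient_ring_with_half begin

lemma matrix_identities:
  "identities R (mat_alg n C.S) = identities R (mat_alg n G)"
proof
  interpret sg: unital_map R C.S G S_to_G by (rule S_to_G)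
  interpret gd: unital_map R G D G_to_D by (rule G_to_D_unital_map)
  interpret sd: unital_map R C.S D "\<lambda>a. (a, \<zero>\<^bsub>SS\<^esub>)" by (rule SA.sqrt2_embed)
  note mcm = SA.mult_closed_module G.mult_closed_module DA.mult_closed_module
  note mat = mcm[THEN mult_closed_module.mat_alg]
  show "identities R (mat_alg n C.S) \<subseteq> identities R (mat_alg n G)"
    by (rule algebra_map.identities_surj[OF sg.mat_map[OF mcm(1,2)] mat(1) mat_map_surj[OF S_to_G_surj]])
  have "identities R (mat_alg n G) \<subseteq> identities R (mat_alg n D)"
    by (rule algebra_map.identities_surj[OF gd.mat_map[OF mcm(2,3)] mat(2) mat_map_surj[OF G_to_D_surj]])
  also have "\<dots> \<subseteq> identities R (mat_alg n C.S)"
    by (rule algebra_map.identities_inj[OF sd.mat_map[OF mcm(1,3)] mat(1) mat_map_inj]) (auto intro: inj_onI)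
  finally show "identities R (mat_alg n G) \<subseteq> identities R (mat_alg n C.S)" .
qed

lemma tensor_identities:
  fixes A :: "('c, 'a, 'm) module_scheme"
  assumes "assoc_algebra R A"
  shows "identities R (tensor_alg R A C.S) = identities R (tensor_alg R A G)"
proof
  interpret A: assoc_algebra R A by fact
  interpret sg: unital_map R C.S G S_to_G by (rule S_to_G)
  interpret gd: unital_map R G D G_to_D by (rule G_to_D_unital_map)
  interpret sd: unital_map R C.S D "\<lambda>a. (a, \<zero>\<^bsub>SS\<^esub>)" by (rule SA.sqrt2_embed)
  interpret SG: tensor_functor R A C.S G S_to_G by unfold_locales
  interpret GD: tensor_functor R A G D G_to_D by unfold_locales
  interpret SD: tensor_functor R A C.S D "\<lambda>a. (a, \<zero>\<^bsub>SS\<^esub>)" by unfold_locales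
  show "identities R (tensor_alg R A C.S) \<subseteq> identities R (tensor_alg R A G)"
    by (rule algebra_map.identities_surj[OF SG.tensor_map_algebra_map[OF sg.algebra_map_axioms]
          SG.S.TA.mult_closed_module SG.tensor_map_surj[OF S_to_G_surj]])
  have "identities R (tensor_alg R A G) \<subseteq> identities R (tensor_alg R A D)"
    by (rule algebra_map.identities_surj[OF GD.tensor_map_algebra_map[OF gd.algebra_map_axioms]
          SG.S'.TA.mult_closed_module GD.tensor_map_surj[OF G_to_D_surj]])
  also have "\<dots> \<subseteq> identities R (tensor_alg R A C.S)"
    by (rule algebra_map.identities_inj[OF SD.tensor_map_algebra_map[OF sd.algebra_map_axioms]
          SG.S.TA.mult_closed_module SD.tensor_map_inj[OF SA.sqrt2_fst]]) simp
  finally show "identities R (tensor_alg R A G) \<subseteq> identities R (tensor_alg R A C.S)" .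
qed

end

theorem theorem2p13:
  fixes C :: "('c, 'r) ring_scheme" and A :: "('c, 'a, 'm) module_scheme"
  assumes "cring C"
    and "\<one>\<^bsub>C\<^esub> \<oplus>\<^bsub>C\<^esub> \<one>\<^bsub>C\<^esub> \<in> Units C"
    and "assoc_algebra C A"
  shows "identities C (tensor_alg C A (free_supercomm_alg C)) =
           identities C (tensor_alg C A (grassmann_alg C)) \<and>
         (\<forall>n. identities C (mat_alg n (free_supercomm_alg C)) =
                identities C (mat_alg n (grassmann_alg C)))"
proof -
  interpret coefficient_ring_with_half C
    by (intro coefficient_ring_with_half.intro coefficient_ring.intro coefficient_ring_with_half_axioms.intro assms(1,2))
  show ?thesis using tensor_identities[OF assms(3)] matrix_identities by blast
qed

end
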